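(* Let $T$ be the $(d_0,d_1)$-semiregular tree with $d_0,d_1\geq 6$, let $i$ be a legal coloring of $T$ and let $H\in\mathcal{H}_T^+$ be such that $H\supseteq\mathrm{Alt}_{(i)}(T)^+$. Then there exists $K\in\mathbf{Z}_{\geq 0}$ such that $H=H^{(K)}$.
   Context: The $(d_0,d_1)$-semiregular tree $T$ is the tree whose vertex set has a bipartition $V(T)=V_0(T)\sqcup V_1(T)$ such that every edge joins $V_0(T)$ to $V_1(T)$ and each vertex of type $t$ (i.e. in $V_t(T)$) is incident to exactly $d_t$ edges. $\mathrm{Aut}(T)$ carries the topology of pointwise convergence on vertices; $\mathrm{Aut}(T)^+$ is the subgroup of automorphisms preserving $V_0(T)$ and $V_1(T)$. $\partial T$ is the set of ends of $T$. $\mathcal{H}_T^+$ is the set of closed subgroups of $\mathrm{Aut}(T)$ that are contained in $\mathrm{Aut}(T)^+$ and $2$-transitive on $\partial T$. $S(v,r)$ (resp. $B(v,r)$) is the set of vertices at distance exactly $r$ (resp. at most $r$) from $v$. For $J\leq\mathrm{Aut}(T)$ and $n\in\mathbf{Z}_{\geq0}$, the $n$-closure of $J$ is $J^{(n)}:=\{g\in\mathrm{Aut}(T) : \forall v\in V(T),\ \exists h\in J,\ g|_{B(v,n)}=h|_{B(v,n)}\}$. A legal coloring $i$ of $T$ is a map on $V(T)$ given by $i_0\colon V_0(T)\to\{1,\dots,d_1\}$ and $i_1\colon V_1(T)\to\{1,\dots,d_0\}$ such that for each $v\in V_1(T)$ the restriction $i_0|_{S(v,1)}$ is a bijection onto $\{1,\dots,d_1\}$,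 and for each $v\in V_0(T)$ the restriction $i_1|_{S(v,1)}$ is a bijection onto $\{1,\dots,d_0\}$. For $g\in\mathrm{Aut}(T)$ and $v\in V(T)$ put $\sigma_{(i)}(g,v)=i|_{S(g(v),1)}\circ g\circ i|_{S(v,1)}^{-1}$, a permutation in $\mathrm{Sym}(d_t)$ where $t$ is the type of $v$. Then $\mathrm{Alt}_{(i)}(T)^+:=\{g\in\mathrm{Aut}(T)^+ : \sigma_{(i)}(g,v)\text{ is even for each }v\in V(T)\}$. *)

theory Defs
  imports
    "HOL-Analysis.Function_Topology"
    "HOL-Algebra.Group"
    "HOL-Combinatorics.Permutations"
begin

text \<open>
  A tree is given by its adjacency relation on the type of its vertices, so that
  the vertex set is always \<open>UNIV\<close>. The types 0 and 1 of vertices are the two sets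
  \<open>V0\<close> and \<open>V1\<close>. (The predicate \<open>tree\<close> of the AFP entry \<open>Graph_Theory\<close> does not
  apply: its \<open>forest\<close> only excludes directed cycles, and it regards the two
  orientations of an undirected edge as a cycle of length 2.)
\<close>

definition is_tree :: "('v \<Rightarrow> 'v \<Rightarrow> bool) \<Rightarrow> bool" where
  "is_tree E \<longleftrightarrow>
     (\<forall>u v. E u v \<longrightarrow> E v u) \<and> (\<forall>v. \<not> E v v) \<and>
     (\<forall>u v. E\<^sup>*\<^sup>* u v) \<and>
     (\<nexists>p. 3 \<le> length p \<and> distinct p \<and> successively E p \<and> E (last p) (hd p))"

definition semiregular_tree ::
    "('v \<Rightarrow> 'v \<Rightarrow> bool) \<Rightarrow> 'v set \<Rightarrow> 'v set \<Rightarrow> nat \<Rightarrow> nat \<Rightarrow> bool" where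
  "semiregular_tree E V0 V1 d0 d1 \<longleftrightarrow>
     is_tree E \<and> V0 \<union> V1 = UNIV \<and> V0 \<inter> V1 = {} \<and>
     (\<forall>u v. E u v \<longrightarrow> (u \<in> V0 \<and> v \<in> V1) \<or> (u \<in> V1 \<and> v \<in> V0)) \<and>
     (\<forall>v\<in>V0. finite {w. E v w} \<and> card {w. E v w} = d0) \<and>
     (\<forall>v\<in>V1. finite {w. E v w} \<and> card {w. E v w} = d1)"

definition gdist :: "('v \<Rightarrow> 'v \<Rightarrow> bool) \<Rightarrow> 'v \<Rightarrow> 'v \<Rightarrow> nat" where
  "gdist E u v = (LEAST n. (E ^^ n) u v)"

definition tsphere :: "('v \<Rightarrow> 'v \<Rightarrow> bool) \<Rightarrow> 'v \<Rightarrow> nat \<Rightarrow> 'v set" where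
  "tsphere E v r = {u. gdist E v u = r}"

definition tball :: "('v \<Rightarrow> 'v \<Rightarrow> bool) \<Rightarrow> 'v \<Rightarrow> nat \<Rightarrow> 'v set" where
  "tball E v r = {u. gdist E v u \<le> r}"

definition Aut :: "('v \<Rightarrow> 'v \<Rightarrow> bool) \<Rightarrow> ('v \<Rightarrow> 'v) set" where
  "Aut E = {g. bij g \<and> (\<forall>u v. E (g u) (g v) \<longleftrightarrow> E u v)}"

definition Aut_group :: "('v \<Rightarrow> 'v \<Rightarrow> bool) \<Rightarrow> ('v \<Rightarrow> 'v) monoid" where
  "Aut_group E = \<lparr>carrier = Aut E, monoid.mult = (\<circ>), one = id\<rparr>"

definition Aut_top :: "('v \<Rightarrow> 'v \<Rightarrow> bool) \<Rightarrow> ('v \<Rightarrow> 'v) topology" where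
  "Aut_top E = subtopology (product_topology (\<lambda>_. discrete_topology UNIV) UNIV) (Aut E)"

definition Aut_plus ::
    "('v \<Rightarrow> 'v \<Rightarrow> bool) \<Rightarrow> 'v set \<Rightarrow> 'v set \<Rightarrow> ('v \<Rightarrow> 'v) set" where
  "Aut_plus E V0 V1 = {g \<in> Aut E. g ` V0 = V0 \<and> g ` V1 = V1}"

text \<open>Ends are classes of rays, where two rays are equivalent if they share a tail.\<close>

definition rays :: "('v \<Rightarrow> 'v \<Rightarrow> bool) \<Rightarrow> (nat \<Rightarrow> 'v) set" where
  "rays E = {r. inj r \<and> (\<forall>n. E (r n) (r (Suc n)))}"

definition cofinal :: "('v \<Rightarrow> 'v \<Rightarrow> bool) \<Rightarrow> ((nat \<Rightarrow> 'v) \<times> (nat \<Rightarrow> 'v)) set" where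
  "cofinal E = {(r, s). r \<in> rays E \<and> s \<in> rays E \<and> (\<exists>m n. \<forall>k. r (m + k) = s (n + k))}"

definition ends :: "('v \<Rightarrow> 'v \<Rightarrow> bool) \<Rightarrow> (nat \<Rightarrow> 'v) set set" where
  "ends E = rays E // cofinal E"

definition act_end :: "('v \<Rightarrow> 'v) \<Rightarrow> (nat \<Rightarrow> 'v) set \<Rightarrow> (nat \<Rightarrow> 'v) set" where
  "act_end g e = (\<lambda>r. g \<circ> r) ` e"

definition two_transitive_on_ends ::
    "('v \<Rightarrow> 'v \<Rightarrow> bool) \<Rightarrow> ('v \<Rightarrow> 'v) set \<Rightarrow> bool" where
  "two_transitive_on_ends E H \<longleftrightarrow>
     (\<forall>a\<in>ends E. \<forall>b\<in>ends E. \<forall>a'\<in>ends E. \<forall>b'\<in>ends E.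
        a \<noteq> b \<longrightarrow> a' \<noteq> b' \<longrightarrow> (\<exists>h\<in>H. act_end h a = a' \<and> act_end h b = b'))"

definition HT_plus ::
    "('v \<Rightarrow> 'v \<Rightarrow> bool) \<Rightarrow> 'v set \<Rightarrow> 'v set \<Rightarrow> ('v \<Rightarrow> 'v) set set" where
  "HT_plus E V0 V1 =
     {H. subgroup H (Aut_group E) \<and> closedin (Aut_top E) H \<and>
         H \<subseteq> Aut_plus E V0 V1 \<and> two_transitive_on_ends E H}"

definition n_closure ::
    "('v \<Rightarrow> 'v \<Rightarrow> bool) \<Rightarrow> nat \<Rightarrow> ('v \<Rightarrow> 'v) set \<Rightarrow> ('v \<Rightarrow> 'v) set" where
  "n_closure E n J = {g \<in> Aut E. \<forall>v. \<exists>h\<in>J. \<forall>u\<in>tball E v n. g u = h u}"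

text \<open>The map \<open>i\<close> is \<open>i\<^sub>0\<close> on \<open>V0\<close> and \<open>i\<^sub>1\<close> on \<open>V1\<close>.\<close>

definition legal_coloring ::
    "('v \<Rightarrow> 'v \<Rightarrow> bool) \<Rightarrow> 'v set \<Rightarrow> 'v set \<Rightarrow> nat \<Rightarrow> nat \<Rightarrow> ('v \<Rightarrow> nat) \<Rightarrow> bool" where
  "legal_coloring E V0 V1 d0 d1 i \<longleftrightarrow>
     i ` V0 \<subseteq> {1..d1} \<and> i ` V1 \<subseteq> {1..d0} \<and>
     (\<forall>v\<in>V1. bij_betw i (tsphere E v 1) {1..d1}) \<and>
     (\<forall>v\<in>V0. bij_betw i (tsphere E v 1) {1..d0})"

text \<open>
  For a legal coloring \<open>i\<close> and a vertex \<open>v\<close> of type \<open>t\<close>, the set \<open>i ` tsphere E v 1\<close>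
  is \<open>{1..d\<^sub>t}\<close>. As usual for \<^const>\<open>permutes\<close>, the local action is extended by
  the identity outside of that set.
\<close>

definition local_action ::
    "('v \<Rightarrow> 'v \<Rightarrow> bool) \<Rightarrow> ('v \<Rightarrow> nat) \<Rightarrow> ('v \<Rightarrow> 'v) \<Rightarrow> 'v \<Rightarrow> nat \<Rightarrow> nat" where
  "local_action E i g v k =
     (if k \<in> i ` tsphere E v 1 then i (g (inv_into (tsphere E v 1) i k)) else k)"

definition Alt_plus ::
    "('v \<Rightarrow> 'v \<Rightarrow> bool) \<Rightarrow> 'v set \<Rightarrow> 'v set \<Rightarrow> ('v \<Rightarrow> nat) \<Rightarrow> ('v \<Rightarrow> 'v) set" where
  "Alt_plus E V0 V1 i = {g \<in> Aut_plus E V0 V1. \<forall>v. evenperm (local_action E i g v)}"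

end

theory Submission
  imports Defs
begin

text \<open>
  An automorphism in \<open>Alt_plus\<close> can be prescribed on a ball as long as its local actions there are
  even. Hence elements of \<open>H\<close> are determined, up to \<open>Alt_plus\<close>, by the signs of their local actions,
  and what has to be understood are the sign patterns on a sphere around \<open>v\<close> of the elements of \<open>H\<close>
  fixing the ball inside it.

  For either type of vertices, let \<open>j\<close> be maximal such that every pattern having product 1 on the
  descendants of each vertex \<open>j\<close> levels above the sphere is realised. If there is no such \<open>j\<close>, every
  pattern is realised. Otherwise the next level fails for some \<open>v\<close> and some vertex \<open>u\<close>, and the
  three-cycles in \<open>Alt_plus\<close> show that for every realised pattern the product over the descendants at
  depth \<open>j\<close> of a child \<open>x\<close> of \<open>u\<close> does not depend on \<open>x\<close>. Moving down to smaller and smaller balls,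
  this can be corrected by products over descendants at smaller depths, so that it becomes a constraint
  on all elements of \<open>H\<close>: for some \<open>K \<subseteq> {0..j}\<close> containing \<open>j\<close>, the product of the signs over
  the vertices beyond \<open>x\<close> with distance from \<open>x\<close> in \<open>K\<close> is the same for all neighbours \<open>x\<close> of \<open>u\<close>.

  The constraint only involves balls of radius \<open>j + 2\<close>, so it also holds in the closure of \<open>H\<close> of that
  order. For an element fixing a larger ball it says that the products over descendants at depth \<open>j\<close>
  are 1, because the comparison with the parent of \<open>u\<close> only involves fixed vertices. All such patterns
  are realised in \<open>H\<close>, so elements of the closure agree with elements of \<open>H\<close> on arbitrarily large
  balls, and \<open>H\<close> is closed.
\<close>

subsection \<open>Trees\<close>

locale coloured_tree =
  fixes E :: "'v \<Rightarrow> 'v \<Rightarrow> bool" and V0 V1 :: "'v set" and d0 d1 :: nat and i :: "'v \<Rightarrow> nat"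
  assumes semiregular: "semiregular_tree E V0 V1 d0 d1"
    and d0: "d0 \<ge> 6" and d1: "d1 \<ge> 6"
    and legal: "legal_coloring E V0 V1 d0 d1 i"
begin

abbreviation d :: "'v \<Rightarrow> 'v \<Rightarrow> nat" where "d \<equiv> gdist E"
abbreviation N :: "'v \<Rightarrow> 'v set" where "N v \<equiv> {w. E v w}"

lemma tree: "is_tree E"
  using semiregular by (simp add: semiregular_tree_def)

lemma sym: "E u v \<Longrightarrow> E v u"
  using tree by (auto simp: is_tree_def)

lemma irrefl: "\<not> E v v"
  using tree by (auto simp: is_tree_def)

lemma no_cycle: "3 \<le> length p \<Longrightarrow> distinct p \<Longrightarrow> successively E p \<Longrightarrow> \<not> E (last p) (hd p)"
  using tree unfolding is_tree_def by blast

lemma relpowp_dist: "(E ^^ d u v) u v"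
proof -
  have "E\<^sup>*\<^sup>* u v" using tree by (auto simp: is_tree_def)
  then obtain n where "(E ^^ n) u v" by (auto simp: rtranclp_power)
  then show ?thesis unfolding gdist_def by (rule LeastI)
qed

lemma dist_le: "(E ^^ n) u v \<Longrightarrow> d u v \<le> n"
  unfolding gdist_def by (rule Least_le)

lemma dist_refl [simp]: "d v v = 0"
  using dist_le[of 0 v v] by simp

lemma dist_eq_0 [simp]: "d u v = 0 \<longleftrightarrow> u = v"
  using relpowp_dist[of u v] by (cases "d u v = 0") auto

lemma dist_triangle: "d u w \<le> d u v + d v w"
proof (rule dist_le)
  show "(E ^^ (d u v + d v w)) u w"
    using relpowp_dist[of u v] relpowp_dist[of v w] by (auto simp: relpowp_add)
qed

lemma dist_sym: "d u v = d v u"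
proof -
  have pw: "(E ^^ n) a b \<Longrightarrow> (E ^^ n) b a" for n a b
  proof (induction n arbitrary: a b)
    case (Suc n)
    then obtain c where "(E ^^ n) a c" "E c b" by auto
    then show ?case using Suc.IH sym by (meson relpowp_Suc_I2)
  qed simp
  show ?thesis
    by (meson pw antisym dist_le relpowp_dist)
qed

lemma dist_eq_1: "d u v = Suc 0 \<longleftrightarrow> E u v"
proof
  assume "d u v = Suc 0"
  then show "E u v" using relpowp_dist[of u v] by auto
next
  assume e: "E u v"
  then have "d u v \<le> 1" by (intro dist_le) auto
  moreover have "u \<noteq> v" using e irrefl by auto
  ultimately show "d u v = Suc 0" using dist_eq_0[of u v] by linarith
qed

lemma tsphere_1: "tsphere E v 1 = N v"
  by (auto simp: tsphere_def dist_eq_1)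

lemma edge_types: "E u v \<Longrightarrow> u \<in> V0 \<longleftrightarrow> v \<notin> V0"
  using semiregular unfolding semiregular_tree_def by blast

lemma V1_iff: "v \<in> V1 \<longleftrightarrow> v \<notin> V0"
  using semiregular unfolding semiregular_tree_def by blast

lemma types_dist: "(u \<in> V0 \<longleftrightarrow> v \<in> V0) \<longleftrightarrow> even (d u v)"
proof -
  have "(E ^^ n) u v \<Longrightarrow> (u \<in> V0 \<longleftrightarrow> v \<in> V0) \<longleftrightarrow> even n" for n
  proof (induction n arbitrary: v)
    case (Suc n)
    then obtain c where c: "(E ^^ n) u c" "E c v" by auto
    show ?case using Suc.IH[OF c(1)] edge_types[OF c(2)] by auto
  qed simp
  then show ?thesis using relpowp_dist by blast
qed

text \<open>The triangle inequality leaves three cases; equality is excluded by parity, since the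
  ends of an edge have different types.\<close>

lemma dist_edge: "E x y \<Longrightarrow> d v y = Suc (d v x) \<or> d v x = Suc (d v y)"
proof -
  assume e: "E x y"
  have "d v y \<le> d v x + 1" "d v x \<le> d v y + 1"
    using dist_triangle[of v y x] dist_triangle[of v x y] e sym[OF e] dist_eq_1 by (metis One_nat_def)+
  moreover have "d v x \<noteq> d v y"
    using edge_types[OF e] types_dist[of v x] types_dist[of v y] by auto
  ultimately show ?thesis by linarith
qed

lemma dist_edge': "E x y \<Longrightarrow> d y v = Suc (d x v) \<or> d x v = Suc (d y v)"
  using dist_edge[of x y v] by (simp add: dist_sym)

lemma parent_exists:
  assumes "d v x = Suc n"
  obtains y where "E x y" "d v y = n"
proof -
  have "(E ^^ Suc n) v x" using assms relpowp_dist[of v x] by simp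
  then obtain y where y: "(E ^^ n) v y" "E y x" by auto
  have "d v y \<le> n" using y(1) by (rule dist_le)
  moreover have "d v x \<le> d v y + 1"
    using dist_triangle[of v x y] y(2) dist_eq_1 by (metis One_nat_def)
  ultimately show thesis using that[of y] y(2) sym[OF y(2)] assms by auto
qed

text \<open>Both ends are replaced by their parents until these coincide. In
  \<open>parent_unique\<close> such a path is closed to a cycle.\<close>

lemma simple_path_in_ball:
  assumes "d v y = n" "d v y' = n" "y \<noteq> y'"
  shows "\<exists>p. p \<noteq> [] \<and> hd p = y \<and> last p = y' \<and> distinct p \<and> successively E p \<and>
             2 \<le> length p \<and> (\<forall>z\<in>set p. d v z \<le> n)"
  using assms
proof (induction n arbitrary: y y')
  case 0
  then show ?case by auto
next
  case (Suc n)
  obtain z where z: "E y z" "d v z = n" using Suc.prems(1) parent_exists by blast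
  obtain z' where z': "E y' z'" "d v z' = n" using Suc.prems(2) parent_exists by blast
  show ?case
  proof (cases "z = z'")
    case True
    show ?thesis
      by (rule exI[of _ "[y,z,y']"]) (use True z z' Suc.prems sym[OF z'(1)] in auto)
  next
    case False
    then obtain p where p: "p \<noteq> []" "hd p = z" "last p = z'" "distinct p" "successively E p"
      "2 \<le> length p" "\<forall>u\<in>set p. d v u \<le> n"
      using Suc.IH[OF z(2) z'(2)] by blast
    show ?thesis
      by (rule exI[of _ "y # p @ [y']"])
        (use p z z' Suc.prems sym[OF z'(1)] in \<open>auto simp: successively_append_iff successively_Cons\<close>)
  qed
qed

lemma parent_unique:
  assumes "E x y" "E x y'" "d v x = Suc (d v y)" "d v x = Suc (d v y')"
  shows "y = y'"
proof (rule ccontr)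
  assume "y \<noteq> y'"
  then obtain p where p: "p \<noteq> []" "hd p = y" "last p = y'" "distinct p" "successively E p"
      "2 \<le> length p" "\<forall>u\<in>set p. d v u \<le> d v y"
    using simple_path_in_ball[of v y "d v y" y'] assms by auto
  \<comment> \<open>\<open>x\<close> is farther from \<open>v\<close> than the whole path between
    its two parents, so adding it gives a cycle.\<close>
  have "x \<notin> set p" using p(7) assms(3) by auto
  then have "\<not> E (last (x # p)) (hd (x # p))"
    using p assms by (intro no_cycle) (auto simp: successively_Cons)
  then show False using p sym[OF assms(2)] by auto
qed

text \<open>For an edge between \<open>u\<close> and \<open>x\<close> this is the half-tree on the
  side of \<open>x\<close>, expressed by distances so that no paths are needed.\<close>

definition branch :: "'v \<Rightarrow> 'v \<Rightarrow> 'v set" where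
  "branch u x = {z. d u z = Suc (d x z)}"

lemma branch_compl: "E u x \<Longrightarrow> z \<notin> branch u x \<longleftrightarrow> z \<in> branch x u"
  unfolding branch_def mem_Collect_eq using dist_edge'[of u x z] by linarith

text \<open>Induction along the way from \<open>z\<close> to \<open>x\<close>: the next vertex
  \<open>y\<close> has the right distance from \<open>v\<close>, and \<open>z\<close> cannot be
  closer to \<open>v\<close> than \<open>y\<close>, because the parent of \<open>y\<close> seen from
  \<open>v\<close> is another vertex (\<open>u\<close> itself if \<open>y = x\<close>).\<close>

lemma dist_across_edge:
  assumes e: "E u x" and z: "z \<in> branch u x" and v: "v \<in> branch x u"
  shows "d v z = Suc (d v u + d x z)"
  using z
proof (induction "d x z" arbitrary: z rule: less_induct)
  case less
  show ?case
  proof (cases "d x z")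
    case 0
    then show ?thesis using v by (auto simp: branch_def dist_sym)
  next
    case (Suc n)
    obtain y where y: "E z y" "d x y = n" using Suc parent_exists by blast
    have "d u y \<le> Suc n" "d u z = Suc (Suc n)"
      using dist_triangle[of u y x] e y(2) less.prems Suc dist_eq_1[of u x] by (auto simp: branch_def)
    then have yb: "y \<in> branch u x"
      using dist_edge'[OF e, of y] y(2) dist_edge[OF y(1), of u] by (auto simp: branch_def)
    have dy: "d v y = Suc (d v u + n)"
      using less.hyps[of y] Suc y yb by simp
    have "d v y \<noteq> Suc (d v z)"
    proof
      assume c: "d v y = Suc (d v z)"
      show False
      proof (cases n)
        case 0
        then have "y = x" using y by auto
        moreover have "d v y = Suc (d v u)" using dy 0 by simp
        ultimately have "z = u" using parent_unique[of y z u v] sym[OF y(1)] sym[OF e] c by auto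
        then show False using less.prems e Suc \<open>d u z = Suc (Suc n)\<close> by auto
      next
        case (Suc m)
        then obtain w where w: "E y w" "d x w = m" using y parent_exists by blast
        have "d u w \<le> Suc m"
          using dist_triangle[of u w x] e w(2) dist_eq_1[of u x] by auto
        then have "w \<in> branch u x"
          using dist_edge'[OF e, of w] w(2) dist_edge[OF w(1), of u] yb y(2) Suc by (auto simp: branch_def)
        then have "d v w = Suc (d v u + m)"
          using less.hyps[of w] \<open>d x z = Suc n\<close> Suc w by simp
        then have "z = w" using parent_unique[of y z w v] sym[OF y(1)] w c dy Suc by auto
        then show False using w \<open>d x z = Suc n\<close> Suc by auto
      qed
    qed
    then show ?thesis using dist_edge[OF y(1), of v] dy Suc by auto
  qed
qed

text \<open>For a child \<open>x\<close> of \<open>u\<close> with respect to the root \<open>v\<close>, the branch at \<open>x\<close>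
  consists of the descendants of \<open>x\<close>.\<close>

lemma branch_iff:
  assumes "E u x" "d v x = Suc (d v u)"
  shows "z \<in> branch u x \<longleftrightarrow> d v z = d v x + d x z"
proof
  assume "z \<in> branch u x"
  moreover have "v \<in> branch x u" using assms by (auto simp: branch_def dist_sym)
  ultimately show "d v z = d v x + d x z"
    using dist_across_edge[OF assms(1), of z v] assms by simp
next
  assume *: "d v z = d v x + d x z"
  show "z \<in> branch u x"
    using dist_triangle[of v z u] assms * dist_edge'[OF assms(1), of z] by (auto simp: branch_def)
qed

lemma dist_across:
  assumes "E u x" "E u y" "x \<noteq> y" "s \<in> branch u x" "t \<in> branch u y"
  shows "d s t = d s u + d u t" "s \<notin> branch u y"
proof -
  have "s \<noteq> u" using assms(1,4) by (auto simp: branch_def)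
  show 1: "s \<notin> branch u y"
  proof
    assume "s \<in> branch u y"
    then have "d s u = Suc (d s x)" "d s u = Suc (d s y)" using assms by (auto simp: branch_def dist_sym)
    then show False using parent_unique[of u x y s] assms by auto
  qed
  then have "s \<in> branch y u" using assms branch_compl by blast
  then show "d s t = d s u + d u t"
    using dist_across_edge[OF assms(2,5)] assms(5) by (simp add: branch_def)
qed

lemma branch_disjoint: "E u x \<Longrightarrow> E u y \<Longrightarrow> x \<noteq> y \<Longrightarrow> branch u x \<inter> branch u y = {}"
  using dist_across(2) by blast

section \<open>Ancestors with respect to a root\<close>

lemma ancestor_exists:
  assumes "d v z = m + k"
  obtains w where "d v w = m" "d w z = k"
proof -
  have "\<exists>w. d v w = m \<and> d w z = k" using assms
  proof (induction k arbitrary: m)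
    case 0
    then show ?case by auto
  next
    case (Suc k)
    then have "d v z = Suc m + k" by simp
    then obtain w where w: "d v w = Suc m" "d w z = k" using Suc.IH by blast
    obtain y where y: "E w y" "d v y = m" using w parent_exists by blast
    have "d y z \<le> Suc k" using dist_triangle[of y z w] w dist_eq_1[of y w] sym[OF y(1)] by auto
    moreover have "d v z \<le> d v y + d y z" by (rule dist_triangle)
    ultimately show ?case using y Suc.prems by auto
  qed
  then show thesis using that by blast
qed

lemma ancestor_unique:
  assumes "d v z = d v w + d w z" "d v z = d v w' + d w' z" "d v w = d v w'"
  shows "w = w'"
  using assms
proof (induction "d w z" arbitrary: w w')
  case 0
  then show ?case by auto
next
  case (Suc k)
  obtain x where x: "E w x" "d z x = k" using Suc.hyps(2) parent_exists[of z w k] by (metis dist_sym)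
  have "d w' z = Suc k" using Suc by auto
  then obtain x' where x': "E w' x'" "d z x' = k" using parent_exists[of z w' k] by (metis dist_sym)
  have 1: "d v x = Suc (d v w)"
    using dist_edge[OF x(1), of v] dist_triangle[of v z x] Suc x by (auto simp: dist_sym)
  have 2: "d v x' = Suc (d v w')"
    using dist_edge[OF x'(1), of v] dist_triangle[of v z x'] Suc x' \<open>d w' z = Suc k\<close> by (auto simp: dist_sym)
  have "x = x'" using Suc.hyps(1)[of x x'] x x' 1 2 Suc by (auto simp: dist_sym)
  then show ?case using parent_unique[of x w w' v] sym[OF x(1)] sym[OF x'(1)] x x' 1 2 by auto
qed

text \<open>\<open>q\<close> is the lowest common ancestor of \<open>s\<close> and \<open>t\<close>
  for the root \<open>v\<close>, and \<open>x\<close>, \<open>y\<close> are its children above them.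
  The induction passes to the parents of \<open>s\<close> and \<open>t\<close>.\<close>

lemma meet_exists:
  assumes "d v s = n" "d v t = n" "s \<noteq> t"
  obtains q m x y where "d v q + Suc m = n" "E q x" "E q y" "x \<noteq> y"
    "d v x = Suc (d v q)" "d v y = Suc (d v q)"
    "s \<in> branch q x" "t \<in> branch q y" "d x s = m" "d y t = m" "d s t = 2 * Suc m"
proof -
  have "\<exists>q m x y. d v q + Suc m = n \<and> E q x \<and> E q y \<and> x \<noteq> y \<and>
    d v x = Suc (d v q) \<and> d v y = Suc (d v q) \<and>
    s \<in> branch q x \<and> t \<in> branch q y \<and> d x s = m \<and> d y t = m" using assms
  proof (induction n arbitrary: s t)
    case 0
    then show ?case by auto
  next
    case (Suc n)
    obtain s' where s': "E s s'" "d v s' = n" using Suc.prems parent_exists by blast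
    obtain t' where t': "E t t'" "d v t' = n" using Suc.prems parent_exists by blast
    show ?case
    proof (cases "s' = t'")
      case True
      show ?thesis
        by (rule exI[of _ s'], rule exI[of _ 0], rule exI[of _ s], rule exI[of _ t])
          (use True s' t' Suc.prems sym[OF s'(1)] sym[OF t'(1)] dist_eq_1[of t' s] dist_eq_1[of t' t] in \<open>auto simp: branch_def\<close>)
    next
      case False
      then obtain q m x y where q: "d v q + Suc m = n" "E q x" "E q y" "x \<noteq> y"
        "d v x = Suc (d v q)" "d v y = Suc (d v q)" "s' \<in> branch q x" "t' \<in> branch q y" "d x s' = m" "d y t' = m"
        using Suc.IH s' t' by blast
      have "d x s \<le> Suc m" using dist_triangle[of x s s'] q dist_eq_1[of s' s] sym[OF s'(1)] by auto
      moreover have "d y t \<le> Suc m" using dist_triangle[of y t t'] q dist_eq_1[of t' t] sym[OF t'(1)] by auto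
      moreover note dist_triangle[of v s x] dist_triangle[of v t y]
      ultimately have "d x s = Suc m" "d y t = Suc m" using q Suc.prems by auto
      moreover have "s \<in> branch q x" "t \<in> branch q y"
        using branch_iff[OF q(2,5), of s] branch_iff[OF q(3,6), of t] calculation q Suc.prems by auto
      ultimately show ?thesis using q by (intro exI[of _ q] exI[of _ "Suc m"] exI[of _ x] exI[of _ y]) auto
    qed
  qed
  then obtain q m x y where q: "d v q + Suc m = n" "E q x" "E q y" "x \<noteq> y"
    "d v x = Suc (d v q)" "d v y = Suc (d v q)" "s \<in> branch q x" "t \<in> branch q y" "d x s = m" "d y t = m"
    by blast
  moreover have "d s t = 2 * Suc m"
    using dist_across(1)[OF q(2,3,4,7,8)] q(7-10) by (simp add: branch_def dist_sym)
  ultimately show thesis by (rule that)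
qed

section \<open>Degrees, colours and children\<close>

definition deg :: "'v \<Rightarrow> nat" where "deg v = (if v \<in> V0 then d0 else d1)"

lemma finite_N: "finite (N v)" and card_N: "card (N v) = deg v" and deg_ge: "6 \<le> deg v"
  using semiregular d0 d1 V1_iff unfolding semiregular_tree_def deg_def by auto

lemma bij_colours: "bij_betw i (N v) {1..deg v}"
  using legal V1_iff[of v] unfolding legal_coloring_def deg_def tsphere_1 by auto

lemma finite_ball: "finite {x. d v x \<le> n}"
proof (induction n)
  case 0
  then show ?case by simp
next
  case (Suc n)
  have "{x. d v x \<le> Suc n} \<subseteq> {x. d v x \<le> n} \<union> (\<Union>y\<in>{x. d v x \<le> n}. N y)"
  proof
    fix x assume x: "x \<in> {x. d v x \<le> Suc n}"
    show "x \<in> {x. d v x \<le> n} \<union> (\<Union>y\<in>{x. d v x \<le> n}. N y)"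
    proof (cases "d v x \<le> n")
      case False
      then have "d v x = Suc n" using x by simp
      then obtain y where "E x y" "d v y = n" using parent_exists by blast
      then show ?thesis using sym[of x y] by auto
    qed simp
  qed
  moreover have "finite ({x. d v x \<le> n} \<union> (\<Union>y\<in>{x. d v x \<le> n}. N y))"
    using Suc finite_N by blast
  ultimately show ?case by (rule finite_subset)
qed

lemma finite_sphere [simp]: "finite {x. d v x = n}"
  by (rule finite_subset[OF _ finite_ball[of v n]]) auto

definition children :: "'v \<Rightarrow> 'v \<Rightarrow> 'v set" where
  "children v u = {x. E u x \<and> d v x = Suc (d v u)}"

text \<open>At most one neighbour, the parent, is not a child, and there are at least six
  neighbours.\<close>

lemma card_children: "card (children v u) \<ge> 5"
proof -
  have "card (N u - children v u) \<le> 1"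
  proof (cases "\<exists>p. p \<in> N u - children v u")
    case True
    then obtain p where p: "p \<in> N u - children v u" by blast
    have "N u - children v u \<subseteq> {p}"
    proof
      fix y assume "y \<in> N u - children v u"
      then show "y \<in> {p}"
        using p dist_edge[of u y v] dist_edge[of u p v] parent_unique[of u y p v] by (auto simp: children_def)
    qed
    then have "card (N u - children v u) \<le> card {p}" by (intro card_mono) auto
    then show ?thesis by simp
  next
    case False
    then have "N u - children v u = {}" by blast
    then show ?thesis by (simp only: card.empty)
  qed
  moreover have "card (N u) = card (N u - children v u) + card (children v u)"
    using finite_N[of u] by (subst card_Un_disjoint[symmetric]) (auto simp: children_def intro!: arg_cong[of _ _ card])
  ultimately show ?thesis using card_N[of u] deg_ge[of u] by linarith
qed

text \<open>Supplies auxiliary children for three-cycles. The most demanding use, in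
  \<open>\<Phi>_off_branches\<close>, has to avoid four.\<close>

lemma children_avoid:
  assumes "finite F" "card F \<le> 4"
  obtains w where "w \<in> children v u" "w \<notin> F"
proof -
  have "\<not> children v u \<subseteq> F"
    using card_mono[OF assms(1), of "children v u"] assms(2) card_children[of v u] by linarith
  then show thesis using that by blast
qed

subsection \<open>Automorphisms with even local actions\<close>

lemma local_action_eq: "local_action E i g v k = (if k \<in> {1..deg v} then i (g (inv_into (N v) i k)) else k)"
  using bij_colours[of v] unfolding local_action_def tsphere_1 by (simp only: bij_betw_imp_surj_on)

lemma local_action_colour: "x \<in> N v \<Longrightarrow> local_action E i g v (i x) = i (g x)"
  using bij_betw_inv_into_left[OF bij_colours[of v]] bij_betwE[OF bij_colours[of v]] by (simp add: local_action_eq)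

lemma local_action_outside: "k \<notin> {1..deg v} \<Longrightarrow> local_action E i g v k = k"
  by (simp only: local_action_eq if_False)

lemma colours_cases:
  assumes "k \<in> {1..deg v}" obtains x where "x \<in> N v" "k = i x"
  using bij_colours[of v] assms by (metis bij_betw_imp_surj_on imageE)

lemma local_action_eqI:
  assumes "\<And>x. x \<in> N v \<Longrightarrow> i (g x) = p (i x)" "\<And>k. k \<notin> {1..deg v} \<Longrightarrow> p k = k"
  shows "local_action E i g v = p"
proof
  fix k
  show "local_action E i g v k = p k"
    by (cases "k \<in> {1..deg v}") (metis colours_cases local_action_colour assms(1), metis local_action_outside assms(2))
qed

lemma local_action_permutes:
  assumes "bij_betw g (N v) (N (g v))" "deg (g v) = deg v"
  shows "local_action E i g v permutes {1..deg v}"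
proof -
  have "bij_betw (i \<circ> g \<circ> inv_into (N v) i) {1..deg v} {1..deg v}"
    using bij_betw_trans[OF bij_betw_trans[OF bij_betw_inv_into[OF bij_colours[of v]] assms(1)] bij_colours[of "g v"]]
      assms(2) by (simp add: o_assoc)
  then have "bij_betw (local_action E i g v) {1..deg v} {1..deg v}"
    by (subst bij_betw_cong[of _ _ "i \<circ> g \<circ> inv_into (N v) i"]) (auto simp: local_action_eq)
  then show ?thesis using local_action_outside by (rule bij_imp_permutes)
qed

text \<open>The sign is an integer so that parities over sets of vertices become products.\<close>

definition lsign :: "('v \<Rightarrow> 'v) \<Rightarrow> 'v \<Rightarrow> int" where
  "lsign g v = sign (local_action E i g v)"

lemma lsign_cases: "lsign g v = 1 \<or> lsign g v = -1"
  by (simp add: lsign_def sign_def)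

lemma lsign_square [simp]: "lsign g v * lsign g v = 1"
  using lsign_cases[of g v] by auto

lemma lsign_cong: "(\<And>x. x \<in> N v \<Longrightarrow> g x = h x) \<Longrightarrow> lsign g v = lsign h v"
  unfolding lsign_def by (rule arg_cong[of _ _ sign], rule local_action_eqI) (auto simp: local_action_colour local_action_outside)

lemma lsign_id [simp]: "lsign id v = 1"
proof -
  have "local_action E i id v = id" by (rule local_action_eqI) auto
  then show ?thesis by (simp add: lsign_def)
qed

section \<open>Type-preserving automorphisms\<close>

abbreviation Autp where "Autp \<equiv> Aut_plus E V0 V1"
abbreviation ginv :: "('v \<Rightarrow> 'v) \<Rightarrow> 'v \<Rightarrow> 'v" where "ginv \<equiv> inv_into UNIV"
abbreviation Alt where "Alt \<equiv> Alt_plus E V0 V1 i"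

lemma Autp_type: "g \<in> Autp \<Longrightarrow> g x \<in> V0 \<longleftrightarrow> x \<in> V0"
proof -
  assume "g \<in> Autp"
  then have "g ` V0 = V0" "g ` V1 = V1" by (auto simp: Aut_plus_def)
  then show ?thesis using V1_iff by blast
qed

lemma AutpI:
  assumes "g \<in> Aut E" "\<And>x. g x \<in> V0 \<longleftrightarrow> x \<in> V0"
  shows "g \<in> Autp"
proof -
  have "surj g" using assms(1) by (auto simp: Aut_def bij_def)
  have "g ` {x. P x} = {x. P x}" if "\<And>x. P (g x) \<longleftrightarrow> P x" for P
  proof (intro Set.set_eqI iffI)
    fix y assume "y \<in> {x. P x}"
    moreover obtain x where "y = g x" using \<open>surj g\<close> by blast
    ultimately show "y \<in> g ` {x. P x}" using that by simp
  qed (use that in auto)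
  from this[of "\<lambda>x. x \<in> V0"] this[of "\<lambda>x. x \<in> V1"] V1_iff assms(2) have "g ` V0 = V0" "g ` V1 = V1"
    unfolding Collect_mem_eq by blast+
  then show ?thesis using assms(1) by (simp add: Aut_plus_def)
qed

lemma Autp_bij: "g \<in> Autp \<Longrightarrow> bij g"
  and Autp_edge: "g \<in> Autp \<Longrightarrow> E (g x) (g y) \<longleftrightarrow> E x y"
  by (auto simp: Aut_plus_def Aut_def)

lemma Autp_inj: "g \<in> Autp \<Longrightarrow> g x = g y \<longleftrightarrow> x = y"
  using inj_eq[OF bij_is_inj[OF Autp_bij]] .

lemma Autp_id [simp]: "id \<in> Autp"
  by (simp add: Aut_plus_def Aut_def)

lemma Autp_comp [simp]: "g \<in> Autp \<Longrightarrow> h \<in> Autp \<Longrightarrow> g \<circ> h \<in> Autp"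
proof (rule AutpI)
  assume gh: "g \<in> Autp" "h \<in> Autp"
  then show "g \<circ> h \<in> Aut E"
    unfolding Aut_def by (simp add: bij_comp Autp_bij Autp_edge[OF gh(1)] Autp_edge[OF gh(2)])
  show "(g \<circ> h) x \<in> V0 \<longleftrightarrow> x \<in> V0" for x
    by (simp add: Autp_type[OF gh(1)] Autp_type[OF gh(2)])
qed

lemma Autp_inv_simps:
  "g \<in> Autp \<Longrightarrow> ginv g (g x) = x" "g \<in> Autp \<Longrightarrow> g (ginv g x) = x"
  by (simp_all add: Autp_bij bij_is_inj bij_is_surj surj_f_inv_f)

lemma Autp_inv [simp]: "g \<in> Autp \<Longrightarrow> ginv g \<in> Autp"
proof (rule AutpI)
  assume g: "g \<in> Autp"
  have "E (ginv g u) (ginv g v) \<longleftrightarrow> E u v" for u v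
    using Autp_edge[OF g, of "ginv g u" "ginv g v"] by (simp add: Autp_inv_simps[OF g])
  then show "ginv g \<in> Aut E" using Autp_bij[OF g] by (auto simp: Aut_def bij_imp_bij_inv)
  show "ginv g x \<in> V0 \<longleftrightarrow> x \<in> V0" for x using Autp_type[OF g, of "ginv g x"] by (simp add: Autp_inv_simps[OF g])
qed

lemma Autp_N: "g \<in> Autp \<Longrightarrow> bij_betw g (N v) (N (g v))"
proof -
  assume g: "g \<in> Autp"
  have "E v (ginv g y)" if "E (g v) y" for y
    using Autp_edge[OF g, of v "ginv g y"] that by (simp add: Autp_inv_simps[OF g])
  then show ?thesis
    by (intro bij_betwI[of _ _ _ "ginv g"]) (auto simp: Autp_inv_simps[OF g] Autp_edge[OF g])
qed

lemma Autp_deg: "g \<in> Autp \<Longrightarrow> deg (g v) = deg v"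
  by (simp add: deg_def Autp_type)

lemma Autp_relpow: "g \<in> Autp \<Longrightarrow> (E ^^ n) x y \<Longrightarrow> (E ^^ n) (g x) (g y)"
proof (induction n arbitrary: y)
  case (Suc n)
  then obtain c where "(E ^^ n) x c" "E c y" by auto
  then show ?case using Suc.IH[OF Suc.prems(1)] Autp_edge[OF Suc.prems(1)] by (meson relpowp_Suc_I)
qed simp

lemma Autp_dist: "g \<in> Autp \<Longrightarrow> d (g x) (g y) = d x y"
proof (rule antisym)
  assume g: "g \<in> Autp"
  show "d (g x) (g y) \<le> d x y" using Autp_relpow[OF g relpowp_dist] by (rule dist_le)
  show "d x y \<le> d (g x) (g y)"
    using Autp_relpow[OF Autp_inv[OF g] relpowp_dist, of "g x" "g y"] by (intro dist_le) (simp add: Autp_inv_simps[OF g])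
qed

text \<open>The local action of \<open>g \<circ> h\<close> at \<open>v\<close> is that of
  \<open>h\<close> at \<open>v\<close> followed by that of \<open>g\<close> at \<open>h v\<close>,
  and signs are multiplicative.\<close>

lemma lsign_comp: 
  assumes "g \<in> Autp" "h \<in> Autp"
  shows "lsign (g \<circ> h) v = lsign g (h v) * lsign h v"
proof -
  have "local_action E i (g \<circ> h) v = local_action E i g (h v) \<circ> local_action E i h v"
    using Autp_deg[OF assms(2), of v] Autp_edge[OF assms(2)] by (intro local_action_eqI) (auto simp: local_action_colour local_action_outside)
  moreover have "permutation (local_action E i g (h v))" "permutation (local_action E i h v)"
    using local_action_permutes[OF Autp_N[OF assms(1), of "h v"]] local_action_permutes[OF Autp_N[OF assms(2), of v]]
      assms Autp_deg permutation_permutes by (metis finite_atLeastAtMost)+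
  ultimately show ?thesis by (simp add: lsign_def sign_compose)
qed

lemma lsign_inv: "g \<in> Autp \<Longrightarrow> lsign (ginv g) v = lsign g (ginv g v)"
proof -
  assume g: "g \<in> Autp"
  have "g \<circ> ginv g = id" by (rule ext) (simp add: Autp_inv_simps[OF g])
  then have "1 = lsign g (ginv g v) * lsign (ginv g) v" using lsign_comp[OF g Autp_inv[OF g], of v] by simp
  then show ?thesis using lsign_cases[of g "ginv g v"] lsign_cases[of "ginv g" v] by auto
qed

lemma Alt_iff: "g \<in> Alt \<longleftrightarrow> g \<in> Autp \<and> (\<forall>v. lsign g v = 1)"
  by (simp add: Alt_plus_def lsign_def sign_def)

lemma Alt_id [simp]: "id \<in> Alt"
  by (simp add: Alt_iff)

lemma Alt_comp [simp]: "g \<in> Alt \<Longrightarrow> h \<in> Alt \<Longrightarrow> g \<circ> h \<in> Alt"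
  by (simp add: Alt_iff lsign_comp)

lemma Alt_inv [simp]: "g \<in> Alt \<Longrightarrow> ginv g \<in> Alt"
  by (simp add: Alt_iff lsign_inv)

lemma Alt_Autp [simp]: "g \<in> Alt \<Longrightarrow> g \<in> Autp" and Alt_lsign [simp]: "g \<in> Alt \<Longrightarrow> lsign g v = 1"
  by (auto simp: Alt_iff)

section \<open>Automorphisms from local conditions, and extension of partial maps\<close>

lemma Autp_local:
  assumes edge: "\<And>x y. E x y \<Longrightarrow> E (a x) (a y)"
    and inj: "\<And>y. inj_on a (N y)"
    and type: "\<And>x. a x \<in> V0 \<longleftrightarrow> x \<in> V0"
  shows "a \<in> Autp"
proof -
  \<comment> \<open>Equal finite degrees turn local injectivity into local bijectivity.\<close>
  have img: "a ` N y = N (a y)" for y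
    using edge type by (intro card_subset_eq finite_N) (auto simp: card_image inj card_N deg_def)
  have dist: "d (a x) (a y) = d x y" for x y
  proof (induction "d x y" arbitrary: y rule: less_induct)
    case less
    show ?case
    proof (cases "d x y")
      case 0
      then show ?thesis by simp
    next
      case (Suc n)
      obtain z where z: "E y z" "d x z = n" using Suc parent_exists by blast
      have dz: "d (a x) (a z) = n" using less[of z] z Suc by simp
      show ?thesis
      proof (cases n)
        case 0
        then show ?thesis using dz z edge[of z y] sym[OF z(1)] Suc dist_eq_1[of "a z" "a y"] by simp
      next
        case (Suc m)
        then obtain w where w: "E z w" "d x w = m" using z parent_exists by blast
        have dw: "d (a x) (a w) = m" using less[of w] w Suc \<open>d x y = Suc n\<close> by simp
        \<comment> \<open>\<open>w\<close> and \<open>y\<close> are both neighbours of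
          \<open>z\<close>, so local injectivity keeps the image of the path from turning
          back.\<close>
        have ne: "a w \<noteq> a y"
          using inj_onD[OF inj[of z], of w y] w sym[OF z(1)] \<open>d x y = Suc n\<close> Suc by auto
        have "d (a x) (a z) \<noteq> Suc (d (a x) (a y))"
          using parent_unique[of "a z" "a w" "a y" "a x"] ne dz dw Suc edge[OF w(1)] edge[OF sym[OF z(1)]] by auto
        then show ?thesis using dist_edge[OF edge[OF z(1)], of "a x"] dz \<open>d x y = Suc n\<close> by auto
      qed
    qed
  qed
  have "inj a"
    by (rule injI) (metis dist dist_eq_0)
  moreover have "surj a"
  proof -
    have "y \<in> range a" if "d (a x) y = n" for n y x
      using that
    proof (induction n arbitrary: y)
      case (Suc n)
      then obtain z where z: "E y z" "d (a x) z = n" using parent_exists by blast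
      then obtain z' where "z = a z'" using Suc.IH by blast
      then have "y \<in> a ` N z'" using img sym[OF z(1)] by auto
      then show ?case by auto
    qed auto
    then show ?thesis by blast
  qed
  ultimately have "bij a" by (simp add: bij_def)
  then have "a \<in> Aut E" using dist dist_eq_1 by (auto simp: Aut_def) (metis dist dist_eq_1)+
  then show ?thesis using type by (rule AutpI)
qed

text \<open>
  A vertex of \<open>R\<close> with a neighbour outside of \<open>R\<close> has at most one neighbour in \<open>R\<close>, which leaves
  room to extend \<open>g\<close> to its other neighbours with an even local action.
\<close>

definition partial_alt :: "'v \<Rightarrow> 'v set \<Rightarrow> ('v \<Rightarrow> 'v) \<Rightarrow> bool" where
  "partial_alt r R g \<longleftrightarrow> r \<in> R \<and>
     (\<forall>x\<in>R. x \<noteq> r \<longrightarrow> (\<exists>y\<in>R. E x y \<and> d r x = Suc (d r y))) \<and>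
     (\<forall>x\<in>R. g x \<in> V0 \<longleftrightarrow> x \<in> V0) \<and>
     (\<forall>x\<in>R. \<forall>y\<in>R. E x y \<longrightarrow> E (g x) (g y)) \<and>
     (\<forall>y\<in>R. inj_on g (N y \<inter> R) \<and> (if N y \<subseteq> R then lsign g y = 1 else card (N y \<inter> R) \<le> 1))"

text \<open>A 3-cycle through a third point is even, which is why three points are required.\<close>

lemma even_permutation_moving:
  assumes "a \<in> {1..m}" "b \<in> {1..m}" "(m::nat) \<ge> 3"
  obtains p where "p permutes {1..m}" "p a = b" "sign p = 1"
proof (cases "a = b")
  case True
  then show ?thesis using that[of id] by (simp add: permutes_id)
next
  case False
  have "\<not> {1..m} \<subseteq> {a, b}" using card_mono[of "{a, b}" "{1..m}"] assms(3) False by auto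
  then obtain c where c: "c \<in> {1..m}" "c \<noteq> a" "c \<noteq> b" by blast
  have *: "transpose a b permutes {1..m}" "transpose b c permutes {1..m}"
    using assms c by (auto intro: permutes_swap_id)
  show ?thesis
  proof (rule that)
    show "transpose a b \<circ> transpose b c permutes {1..m}" using * permutes_compose by blast
    show "(transpose a b \<circ> transpose b c) a = b" using False c by (simp add: transpose_def)
    show "sign (transpose a b \<circ> transpose b c) = 1"
      using * False c by (subst sign_compose) (auto simp: sign_swap_id permutation_swap_id)
  qed
qed

lemma local_extension:
  assumes "deg v' = deg v" "Q \<subseteq> N v" "card Q \<le> 1" "g ` Q \<subseteq> N v'"
  obtains f where "bij_betw f (N v) (N v')" "\<And>x. x \<in> Q \<Longrightarrow> f x = g x" "lsign f v = 1"
proof -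
  have "finite Q" using assms(2) finite_N[of v] by (rule finite_subset)
  moreover have "card Q = 0 \<or> card Q = 1" using assms(3) by linarith
  ultimately have Q: "Q = {} \<or> (\<exists>q. Q = {q})" by (metis card_0_eq card_1_singletonE)
  obtain a b where ab: "a \<in> {1..deg v}" "b \<in> {1..deg v}" "\<And>x. x \<in> Q \<Longrightarrow> i x = a \<and> i (g x) = b"
  proof (cases "Q = {}")
    case True
    \<comment> \<open>With nothing prescribed any pair of colours serves; \<open>1\<close> is a
      default.\<close>
    then show ?thesis using that[of 1 1] deg_ge[of v] by auto
  next
    case False
    then obtain q where q: "Q = {q}" using Q by auto
    then have "i q \<in> {1..deg v}" "i (g q) \<in> {1..deg v}"
      using assms bij_colours[of v] bij_colours[of v'] by (auto simp: bij_betw_def)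
    then show ?thesis using that q by auto
  qed
  obtain p where p: "p permutes {1..deg v}" "p a = b" "sign p = 1"
    using even_permutation_moving[OF ab(1,2)] deg_ge[of v] by auto
  define f where "f = inv_into (N v') i \<circ> (p \<circ> i)"
  have bij: "bij_betw f (N v) (N v')"
    unfolding f_def using bij_colours[of v] permutes_imp_bij[OF p(1)] bij_betw_inv_into[OF bij_colours[of v']] assms(1)
    by (metis bij_betw_trans)
  have col: "i (f x) = p (i x)" if "x \<in> N v" for x
  proof -
    have "p (i x) \<in> i ` N v'"
      using that bij_colours[of v] bij_colours[of v'] permutes_in_image[OF p(1)] assms(1) by (auto simp: bij_betw_def)
    then show ?thesis by (simp add: f_def f_inv_into_f)
  qed
  show thesis
  proof (rule that[OF bij])
    fix x assume x: "x \<in> Q"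
    then have "i (f x) = i (g x)" using col ab p assms(2) by auto
    moreover have "f x \<in> N v'" "g x \<in> N v'" using x assms bij by (auto simp: bij_betw_def)
    ultimately show "f x = g x" using bij_colours[of v'] by (auto simp: bij_betw_def inj_on_def)
  next
    have "local_action E i f v = p" using col p(1) by (intro local_action_eqI) (auto simp: permutes_def)
    then show "lsign f v = 1" using p by (simp add: lsign_def)
  qed
qed

text \<open>A new vertex has exactly one neighbour in \<open>R\<close> and none among the other new
  vertices, so the extensions \<open>F y\<close> chosen at the different \<open>y\<close> can be
  glued without conflict.\<close>

lemma partial_alt_step:
  assumes "partial_alt r R g"
  obtains g' where "partial_alt r (R \<union> (\<Union>y\<in>R. N y)) g'" "\<And>x. x \<in> R \<Longrightarrow> g' x = g x"
proof -
  let ?R = "R \<union> (\<Union>y\<in>R. N y)"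
  have r: "r \<in> R" and star: "\<And>x. x \<in> R \<Longrightarrow> x \<noteq> r \<Longrightarrow> \<exists>y\<in>R. E x y \<and> d r x = Suc (d r y)"
    and type: "\<And>x. x \<in> R \<Longrightarrow> g x \<in> V0 \<longleftrightarrow> x \<in> V0"
    and edge: "\<And>x y. x \<in> R \<Longrightarrow> y \<in> R \<Longrightarrow> E x y \<Longrightarrow> E (g x) (g y)"
    and inj: "\<And>y. y \<in> R \<Longrightarrow> inj_on g (N y \<inter> R)"
    and full: "\<And>y. y \<in> R \<Longrightarrow> N y \<subseteq> R \<Longrightarrow> lsign g y = 1"
    and leaf: "\<And>y. y \<in> R \<Longrightarrow> \<not> N y \<subseteq> R \<Longrightarrow> card (N y \<inter> R) \<le> 1"
    using assms unfolding partial_alt_def by (auto split: if_splits)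
  \<comment> \<open>Otherwise \<open>x\<close> would be the parent of \<open>y\<close>, but the
    parent of every vertex of \<open>R\<close> other than \<open>r\<close> lies in
    \<open>R\<close>.\<close>
  have down: "d r x = Suc (d r y)" if "x \<notin> R" "y \<in> R" "E x y" for x y
  proof (rule ccontr)
    assume "d r x \<noteq> Suc (d r y)"
    then have dy: "d r y = Suc (d r x)" using dist_edge[OF that(3), of r] by auto
    then have "y \<noteq> r" by auto
    then obtain z where z: "z \<in> R" "E y z" "d r y = Suc (d r z)" using star \<open>y \<in> R\<close> by blast
    then have "z = x" using parent_unique[OF z(2) sym[OF \<open>E x y\<close>] z(3) dy] by blast
    then show False using z(1) \<open>x \<notin> R\<close> by blast
  qed
  have uniq: "y = y'" if "x \<notin> R" "y \<in> R" "E x y" "y' \<in> R" "E x y'" for x y y'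
    using parent_unique[OF that(3,5) down[OF that(1-3)] down[OF that(1,4,5)]] .
  have noedge: "\<not> E x y" if x: "x \<in> ?R" "x \<notin> R" and y: "y \<in> ?R" "y \<notin> R" for x y
  proof
    assume e: "E x y"
    obtain px where px: "px \<in> R" "E px x" using x by auto
    obtain py where py: "py \<in> R" "E py y" using y by auto
    have dx: "d r x = Suc (d r px)" using down[OF x(2) px(1) sym[OF px(2)]] .
    have dy: "d r y = Suc (d r py)" using down[OF y(2) py(1) sym[OF py(2)]] .
    consider "d r y = Suc (d r x)" | "d r x = Suc (d r y)" using dist_edge[OF e, of r] by blast
    then show False
    proof cases
      case 1
      then have "x = py" using parent_unique[OF sym[OF e] sym[OF py(2)] _ dy] by blast
      then show False using py x by auto
    next
      case 2
      then have "y = px" using parent_unique[OF e sym[OF px(2)] _ dx] by blast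
      then show False using px y by auto
    qed
  qed
  have "\<exists>f. bij_betw f (N y) (N (g y)) \<and> (\<forall>x\<in>N y \<inter> R. f x = g x) \<and> lsign f y = 1"
    if "y \<in> R" "\<not> N y \<subseteq> R" for y
  proof -
    have "deg (g y) = deg y" using type that by (simp add: deg_def)
    moreover have "g ` (N y \<inter> R) \<subseteq> N (g y)" using edge that by auto
    ultimately show ?thesis
      using local_extension[of "g y" y "N y \<inter> R" g] leaf[OF that] by (metis inf_le1)
  qed
  then obtain F where F: "\<And>y. y \<in> R \<Longrightarrow> \<not> N y \<subseteq> R \<Longrightarrow>
      bij_betw (F y) (N y) (N (g y)) \<and> (\<forall>x\<in>N y \<inter> R. F y x = g x) \<and> lsign (F y) y = 1"
    by metis
  define par where "par x = (SOME y. y \<in> R \<and> E x y)" for x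
  define g' where "g' x = (if x \<in> R then g x else F (par x) x)" for x
  have par: "par x = y" if "x \<notin> R" "y \<in> R" "E x y" for x y
    unfolding par_def using that uniq by (intro some_equality) auto
  have g'F: "g' x = F y x" if "y \<in> R" "\<not> N y \<subseteq> R" "E y x" for x y
    using F[OF that(1,2)] par[of x y] that sym[OF that(3)] by (auto simp: g'_def)
  show thesis
  proof (rule that)
    show "g' x = g x" if "x \<in> R" for x using that by (simp add: g'_def)
    have new: "g' x \<in> N (g y)" if "x \<notin> R" "y \<in> R" "E y x" for x y
      using g'F[of y x] F[of y] that by (auto simp: bij_betw_def)
    show "partial_alt r ?R g'"
      unfolding partial_alt_def
    proof (intro conjI ballI impI)
      show "r \<in> ?R" using r by simp
    next
      fix x assume x: "x \<in> ?R" "x \<noteq> r"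
      show "\<exists>y\<in>?R. E x y \<and> d r x = Suc (d r y)"
      proof (cases "x \<in> R")
        case True
        then show ?thesis using star x by blast
      next
        case False
        then obtain y where "y \<in> R" "E y x" using x by auto
        then show ?thesis using down[of x y] False sym[of y x] by blast
      qed
    next
      fix x assume x: "x \<in> ?R"
      show "g' x \<in> V0 \<longleftrightarrow> x \<in> V0"
      proof (cases "x \<in> R")
        case True
        then show ?thesis using type by (simp add: g'_def)
      next
        case False
        then obtain y where y: "y \<in> R" "E y x" using x by auto
        then have "E (g y) (g' x)" using new False by blast
        then show ?thesis using edge_types[of "g y" "g' x"] edge_types[of y x] type[of y] y by auto
      qed
    next
      fix x y assume *: "x \<in> ?R" "y \<in> ?R" "E x y"
      then show "E (g' x) (g' y)"
        using noedge[of x y] edge[of x y] new[of x y] new[of y x] sym[of x y] sym[of "g' y" "g' x"]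
        by (cases "x \<in> R"; cases "y \<in> R") (auto simp: g'_def)
    next
      fix y assume y: "y \<in> ?R"
      show "inj_on g' (N y \<inter> ?R)"
      proof (cases "y \<in> R")
        case True
        show ?thesis
        proof (cases "N y \<subseteq> R")
          case T: True
          then have "N y \<inter> ?R = N y \<inter> R" by blast
          then show ?thesis using inj[OF True] by (simp add: g'_def inj_on_def)
        next
          case nf: False
          have "inj_on g' (N y)"
            using F[OF True nf] g'F[OF True nf] by (auto simp: bij_betw_def inj_on_def)
          then show ?thesis by (rule inj_on_subset) auto
        qed
      next
        case False
        then have "N y \<inter> ?R \<subseteq> N y \<inter> R" using noedge[OF y False] by blast
        then have "x = x'" if "x \<in> N y \<inter> ?R" "x' \<in> N y \<inter> ?R" for x x'
          using that uniq[OF False, of x x'] by blast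
        then show ?thesis by (auto simp: inj_on_def)
      qed
    next
      fix y assume y: "y \<in> ?R"
      show "if N y \<subseteq> ?R then lsign g' y = 1 else card (N y \<inter> ?R) \<le> 1"
      proof (cases "y \<in> R")
        case True
        then have sub: "N y \<subseteq> ?R" by blast
        have "lsign g' y = 1"
        proof (cases "N y \<subseteq> R")
          case T: True
          then have "lsign g' y = lsign g y" by (intro lsign_cong) (auto simp: g'_def)
          then show ?thesis using full True T by simp
        next
          case nf: False
          have "lsign g' y = lsign (F y) y" using g'F[OF True nf] by (intro lsign_cong) auto
          then show ?thesis using F[OF True nf] by simp
        qed
        then show ?thesis using sub by simp
      next
        case False
        then have "N y \<inter> ?R \<subseteq> N y \<inter> R" using noedge[OF y False] by blast
        then have "\<forall>x\<in>N y \<inter> ?R. \<forall>x'\<in>N y \<inter> ?R. x = x'" using uniq[OF False] by blast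
        moreover have fin: "finite (N y \<inter> ?R)" using finite_N[of y] by blast
        ultimately have c: "card (N y \<inter> ?R) \<le> 1" using card_le_Suc0_iff_eq[OF fin] by simp
        moreover have "\<not> N y \<subseteq> ?R"
        proof
          assume "N y \<subseteq> ?R"
          then have "N y \<inter> ?R = N y" by blast
          then show False using c card_N[of y] deg_ge[of y] by simp
        qed
        ultimately show ?thesis by simp
      qed
    qed
  qed
qed

text \<open>Layers of neighbours are added one at a time; each map extends the previous one, and the
  limit satisfies the local conditions of \<open>Autp_local\<close>.\<close>

lemma partial_alt_extends:
  assumes "partial_alt r R g"
  obtains a where "a \<in> Alt" "\<And>x. x \<in> R \<Longrightarrow> a x = g x"
proof -
  define Rn where "Rn n = ((\<lambda>R. R \<union> (\<Union>y\<in>R. N y)) ^^ n) R" for n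
  have Rn_0: "Rn 0 = R" and Rn_Suc: "Rn (Suc n) = Rn n \<union> (\<Union>y\<in>Rn n. N y)" for n
    by (auto simp: Rn_def)
  have "\<exists>f. \<forall>n. (partial_alt r (Rn n) (f n) \<and> (n = 0 \<longrightarrow> f n = g)) \<and> (\<forall>x\<in>Rn n. f (Suc n) x = f n x)"
  proof (rule dependent_nat_choice)
    show "\<exists>x. partial_alt r (Rn 0) x \<and> ((0::nat) = 0 \<longrightarrow> x = g)" using assms Rn_0 by auto
  next
    fix h and n :: nat
    assume "partial_alt r (Rn n) h \<and> (n = 0 \<longrightarrow> h = g)"
    then obtain h' where "partial_alt r (Rn (Suc n)) h'" "\<And>x. x \<in> Rn n \<Longrightarrow> h' x = h x"
      using partial_alt_step[of r "Rn n" h] unfolding Rn_Suc by metis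
    then show "\<exists>y. (partial_alt r (Rn (Suc n)) y \<and> (Suc n = 0 \<longrightarrow> y = g)) \<and> (\<forall>x\<in>Rn n. y x = h x)"
      by blast
  qed
  then obtain f where f: "\<And>n. partial_alt r (Rn n) (f n)" "f 0 = g"
      "\<And>n x. x \<in> Rn n \<Longrightarrow> f (Suc n) x = f n x"
    by blast
  have ball: "x \<in> Rn n" if "d r x \<le> n" for x n
    using that
  proof (induction n arbitrary: x)
    case 0
    then show ?case using assms Rn_0 by (auto simp: partial_alt_def)
  next
    case (Suc n)
    show ?case
    proof (cases "d r x \<le> n")
      case True
      then show ?thesis using Suc Rn_Suc by auto
    next
      case False
      then have "d r x = Suc n" using Suc by simp
      then obtain y where "E x y" "d r y = n" using parent_exists by blast
      then show ?thesis using Suc.IH[of y] Rn_Suc sym[of x y] by auto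
    qed
  qed
  \<comment> \<open>By stage \<open>d r x\<close> the vertex \<open>x\<close> has entered the
    domain, and its value no longer changes.\<close>
  define a where "a x = f (d r x) x" for x
  have af: "a x = f n x" if "d r x \<le> n" for x n
    using that
  proof (induction n rule: dec_induct)
    case base
    then show ?case by (simp add: a_def)
  next
    case (step n)
    then show ?case using f(3)[of x n] ball[of x n] by simp
  qed
  have mono: "R \<subseteq> Rn n" and f0: "x \<in> R \<Longrightarrow> f n x = g x" for n x
  proof -
    show 1: "R \<subseteq> Rn n" for n by (induction n) (auto simp: Rn_0 Rn_Suc)
    show "x \<in> R \<Longrightarrow> f n x = g x" using f 1 by (induction n) (auto, metis subsetD)
  qed
  have nb: "d r x \<le> Suc (d r y)" if "E y x" for x y using dist_edge[OF that, of r] by auto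
  have pa: "E (a x) (a y)" if "E x y" for x y
  proof -
    have "E (f (Suc (d r x)) x) (f (Suc (d r x)) y)"
      using f(1)[of "Suc (d r x)"] ball[of _ "Suc (d r x)"] nb[OF that] that unfolding partial_alt_def by auto
    then show ?thesis using af[of x "Suc (d r x)"] af[of y "Suc (d r x)"] nb[OF that] by simp
  qed
  have loc: "inj_on a (N y) \<and> lsign a y = 1" for y
  proof -
    let ?n = "Suc (d r y)"
    have sub: "N y \<subseteq> Rn ?n" "y \<in> Rn ?n" using ball[of _ ?n] nb by auto
    then have "inj_on (f ?n) (N y)" "lsign (f ?n) y = 1"
      using f(1)[of ?n] unfolding partial_alt_def by (auto simp: Int_absorb2)
    moreover have "a x = f ?n x" if "x \<in> N y" for x using af[of x ?n] nb that by auto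
    ultimately show ?thesis using lsign_cong[of y a "f ?n"] inj_on_cong[of "N y" a "f ?n"] by metis
  qed
  have "a x \<in> V0 \<longleftrightarrow> x \<in> V0" for x
    using f(1)[of "d r x"] ball[of x "d r x"] unfolding partial_alt_def a_def by auto
  then have "a \<in> Autp" using pa loc by (intro Autp_local) auto
  then have "a \<in> Alt" unfolding Alt_iff using loc by blast
  moreover have "a x = g x" if "x \<in> R" for x using f0 that by (simp add: a_def)
  ultimately show thesis using that by blast
qed

text \<open>On the ball of radius \<open>Suc n\<close> the map \<open>g\<close> satisfies
  \<open>partial_alt\<close>: inner vertices have even local action, and a vertex on the boundary
  has only its parent in the ball.\<close>

lemma alt_on_ball:
  assumes g: "g \<in> Autp" and even: "\<And>y. d v y \<le> n \<Longrightarrow> lsign g y = 1"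
  obtains a where "a \<in> Alt" "\<And>x. d v x \<le> Suc n \<Longrightarrow> a x = g x"
proof -
  have "partial_alt v {x. d v x \<le> Suc n} g"
    unfolding partial_alt_def
  proof (intro conjI ballI impI)
    fix x assume x: "x \<in> {x. d v x \<le> Suc n}" "x \<noteq> v"
    obtain m where m: "d v x = Suc m" using x by (cases "d v x") auto
    then obtain y where y: "E x y" "d v y = m" using parent_exists by blast
    then show "\<exists>y\<in>{x. d v x \<le> Suc n}. E x y \<and> d v x = Suc (d v y)"
      using x m by (intro bexI[of _ y]) auto
  next
    fix y assume "y \<in> {x. d v x \<le> Suc n}"
    show "if N y \<subseteq> {x. d v x \<le> Suc n} then lsign g y = 1 else card (N y \<inter> {x. d v x \<le> Suc n}) \<le> 1"
    proof (cases "d v y \<le> n")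
      case True
      have "N y \<subseteq> {x. d v x \<le> Suc n}"
      proof
        fix x assume "x \<in> N y"
        then show "x \<in> {x. d v x \<le> Suc n}" using dist_edge[of y x v] True by auto
      qed
      then show ?thesis using True even by simp
    next
      case False
      have "\<forall>x\<in>N y \<inter> {x. d v x \<le> Suc n}. \<forall>x'\<in>N y \<inter> {x. d v x \<le> Suc n}. x = x'"
      proof (intro ballI)
        fix x x' assume "x \<in> N y \<inter> {x. d v x \<le> Suc n}" "x' \<in> N y \<inter> {x. d v x \<le> Suc n}"
        then show "x = x'" using parent_unique[of y x x' v] dist_edge[of y x v] dist_edge[of y x' v] False by auto
      qed
      moreover have "finite (N y \<inter> {x. d v x \<le> Suc n})" using finite_N[of y] by blast
      ultimately have c: "card (N y \<inter> {x. d v x \<le> Suc n}) \<le> 1" using card_le_Suc0_iff_eq by auto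
      obtain w where "w \<in> children v y" using children_avoid[of "{}" v y] by auto
      then have "\<not> N y \<subseteq> {x. d v x \<le> Suc n}" using False by (auto simp: children_def)
      then show ?thesis using c by simp
    qed
  qed (auto simp: inj_on_def Autp_type[OF g] Autp_inj[OF g] Autp_edge[OF g])
  then show thesis using partial_alt_extends that by (metis mem_Collect_eq)
qed

text \<open>At first only the three neighbours are permuted, on the set \<open>R\<close> that omits
  the rest of their branches. The local action at \<open>u\<close> is a 3-cycle, hence even, and the
  extension carries the branches along.\<close>

lemma three_cycle:
  assumes N: "E u x" "E u y" "E u w" and ne: "x \<noteq> y" "y \<noteq> w" "x \<noteq> w"
  obtains a where "a \<in> Alt" "a x = y" "a y = w" "a w = x" "a u = u"
    "\<And>z. z \<notin> branch u x \<Longrightarrow> z \<notin> branch u y \<Longrightarrow> z \<notin> branch u w \<Longrightarrow> a z = z"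
proof -
  let ?Y = "{x, y, w}"
  define R where "R = {z. \<forall>q\<in>?Y. z \<in> branch u q \<longrightarrow> z = q}"
  define g where "g = id(x := y, y := w, w := x)"
  have NY: "E u q" if "q \<in> ?Y" for q using that N by auto
  have self: "q \<in> branch u q" if "q \<in> ?Y" for q
    using dist_eq_1[of u q] NY[OF that] by (auto simp: branch_def)
  have disj: "q = q'" if "z \<in> branch u q" "z \<in> branch u q'" "q \<in> ?Y" "q' \<in> ?Y" for q q' z
    using branch_disjoint[OF NY NY, of q q'] that by blast
  have uR: "u \<in> R" by (auto simp: R_def branch_def)
  have YR: "q \<in> R" if "q \<in> ?Y" for q using disj[of q] self that unfolding R_def by blast
  have cross: "p = u \<and> z = q" if "E p z" "z \<in> branch u q" "p \<notin> branch u q" "q \<in> ?Y" for p z q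
  proof -
    have "p \<in> branch q u" using branch_compl NY that by blast
    then have "d p z = Suc (d p u + d q z)" using dist_across_edge[OF NY[OF that(4)] that(2)] by blast
    then show ?thesis using dist_eq_1[of p z] that(1) by simp
  qed
  have YN: "N q \<inter> R = {u}" if q: "q \<in> ?Y" for q
  proof (rule Set.set_eqI)
    fix z
    show "z \<in> N q \<inter> R \<longleftrightarrow> z \<in> {u}"
    proof
      assume z: "z \<in> N q \<inter> R"
      then have "z \<noteq> q" using irrefl by auto
      then have "z \<notin> branch u q" using z q unfolding R_def by blast
      then show "z \<in> {u}" using cross[of z q q] z sym[of q z] self q by auto
    next
      assume "z \<in> {u}"
      then show "z \<in> N q \<inter> R" using NY[OF q] sym uR by auto
    qed
  qed
  have NR: "N p \<subseteq> R" if p: "p \<in> R" "p \<notin> ?Y" for p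
  proof
    fix z assume z: "z \<in> N p"
    show "z \<in> R" unfolding R_def
    proof (intro CollectI ballI impI)
      fix q assume q: "q \<in> ?Y" "z \<in> branch u q"
      then have "p \<notin> branch u q" using p unfolding R_def by blast
      then show "z = q" using cross[of p z q] q z by auto
    qed
  qed
  have NpY: "p = u" if "p \<in> R" "p \<notin> ?Y" "q \<in> ?Y" "E p q" for p q
  proof -
    have "p \<notin> branch u q" using that unfolding R_def by blast
    then show ?thesis using cross[of p q q] that self by auto
  qed
  have gid: "g z = z" if "z \<notin> ?Y" for z using that by (auto simp: g_def)
  have gY: "g z \<in> ?Y" if "z \<in> ?Y" for z using that by (auto simp: g_def)
  have ginj: "inj g" using ne by (auto simp: inj_def g_def)
  have uY: "u \<notin> ?Y" using N irrefl by auto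
  have icol: "i x \<noteq> i y" "i y \<noteq> i w" "i x \<noteq> i w"
    using bij_colours[of u] N ne by (auto simp: bij_betw_def inj_on_def)
  have sgu: "lsign g u = 1"
  proof -
    have "local_action E i g u = transpose (i x) (i y) \<circ> transpose (i y) (i w)"
    proof (rule local_action_eqI)
      fix z assume z: "z \<in> N u"
      show "i (g z) = (transpose (i x) (i y) \<circ> transpose (i y) (i w)) (i z)"
      proof (cases "z \<in> ?Y")
        case True
        then show ?thesis using icol ne by (auto simp: g_def transpose_def)
      next
        case False
        then have "i z \<noteq> i x" "i z \<noteq> i y" "i z \<noteq> i w"
          using bij_colours[of u] N z by (auto simp: bij_betw_def inj_on_def)
        then show ?thesis using gid[OF False] by (simp add: transpose_def)
      qed
    next
      fix k assume "k \<notin> {1..deg u}"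
      moreover have "i x \<in> {1..deg u}" "i y \<in> {1..deg u}" "i w \<in> {1..deg u}"
        using bij_colours[of u] N by (auto simp: bij_betw_def)
      ultimately have "k \<noteq> i x" "k \<noteq> i y" "k \<noteq> i w" by auto
      then show "(transpose (i x) (i y) \<circ> transpose (i y) (i w)) k = k" by (simp add: transpose_def)
    qed
    then show ?thesis using icol
      by (simp add: lsign_def sign_compose permutation_swap_id sign_swap_id)
  qed
  have "partial_alt u R g"
    unfolding partial_alt_def
  proof (intro conjI ballI impI)
    show "u \<in> R" by (rule uR)
  next
    fix z assume z: "z \<in> R" "z \<noteq> u"
    obtain m where m: "d u z = Suc m" using z by (cases "d u z") auto
    then obtain z' where z': "E z z'" "d u z' = m" using parent_exists by blast
    have "z' \<in> R"
    proof (cases "z \<in> ?Y")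
      case True
      then have "d u z = 1" using NY dist_eq_1[of u z] by auto
      then show ?thesis using m z' uR by auto
    next
      case False
      then show ?thesis using NR[OF z(1)] z' by auto
    qed
    then show "\<exists>y\<in>R. E z y \<and> d u z = Suc (d u y)" using z' m by auto
  next
    fix z
    have "q \<in> V0 \<longleftrightarrow> u \<notin> V0" if "q \<in> ?Y" for q using edge_types[OF NY[OF that]] by blast
    then show "g z \<in> V0 \<longleftrightarrow> z \<in> V0" using gid[of z] gY[of z] by metis
  next
    fix p q assume pq: "p \<in> R" "q \<in> R" "E p q"
    show "E (g p) (g q)"
    proof (cases "p \<in> ?Y")
      case True
      then have "q = u" using YN[OF True] pq by blast
      then show ?thesis using gid[OF uY] NY[OF gY[OF True]] sym by simp
    next
      case p: False
      show ?thesis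
      proof (cases "q \<in> ?Y")
        case True
        then have "p = u" using NpY pq p by blast
        then show ?thesis using gid[OF uY] NY[OF gY[OF True]] by simp
      next
        case False
        then show ?thesis using gid p pq by simp
      qed
    qed
  next
    fix p assume "p \<in> R"
    show "inj_on g (N p \<inter> R)" using ginj by (rule inj_on_subset) simp
  next
    fix p assume p: "p \<in> R"
    show "if N p \<subseteq> R then lsign g p = 1 else card (N p \<inter> R) \<le> 1"
    proof (cases "p \<in> ?Y")
      case True
      then have c: "card (N p \<inter> R) = 1" using YN by simp
      moreover have "\<not> N p \<subseteq> R"
      proof
        assume "N p \<subseteq> R"
        then have "N p \<inter> R = N p" by blast
        then show False using c card_N[of p] deg_ge[of p] by simp
      qed
      ultimately show ?thesis by simp
    next
      case False
      show ?thesis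
      proof (cases "p = u")
        case True
        then show ?thesis using NR[OF p False] sgu by simp
      next
        case nu: False
        have "lsign g p = lsign id p" using NpY[OF p False] nu gid by (intro lsign_cong) auto
        then show ?thesis using NR[OF p False] by simp
      qed
    qed
  qed
  then obtain a where a: "a \<in> Alt" "\<And>z. z \<in> R \<Longrightarrow> a z = g z" using partial_alt_extends by blast
  show thesis
  proof (rule that[OF a(1)])
    show "a x = y" "a y = w" "a w = x" using a(2) YR ne by (auto simp: g_def)
    show "a u = u" using a(2)[OF uR] gid[OF uY] by simp
    fix z assume z: "z \<notin> branch u x" "z \<notin> branch u y" "z \<notin> branch u w"
    then have "z \<in> R" "z \<notin> ?Y" using self by (auto simp: R_def)
    then show "a z = z" using a(2) gid by simp
  qed
qed

subsection \<open>Signs on shells and spheres\<close>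

lemma branch_image: "g \<in> Autp \<Longrightarrow> g z \<in> branch (g u) (g x) \<longleftrightarrow> z \<in> branch u x"
  by (simp add: branch_def Autp_dist)

lemma children_fixed:
  assumes "x \<in> children v u" "d v z \<le> d v u"
  shows "z \<notin> branch u x"
  using branch_iff[of u x v z] assms by (auto simp: children_def)

lemma children_three_cycle:
  assumes "x \<in> children v u" "y \<in> children v u" "w \<in> children v u" "x \<noteq> y" "y \<noteq> w" "x \<noteq> w"
  obtains a where "a \<in> Alt" "a x = y" "a y = w" "a w = x"
    "\<And>z. d v z \<le> d v u \<Longrightarrow> a z = z"
    "\<And>z. z \<notin> branch u x \<Longrightarrow> z \<notin> branch u y \<Longrightarrow> z \<notin> branch u w \<Longrightarrow> a z = z"
proof -
  obtain a where "a \<in> Alt" "a x = y" "a y = w" "a w = x"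
    "\<And>z. z \<notin> branch u x \<Longrightarrow> z \<notin> branch u y \<Longrightarrow> z \<notin> branch u w \<Longrightarrow> a z = z"
    using three_cycle[of u x y w] assms by (auto simp: children_def)
  then show thesis using that[of a] children_fixed assms by blast
qed

lemma children_not_branch:
  assumes "x \<in> children v u" "y \<in> children v u" "x \<noteq> y"
  shows "x \<notin> branch u y"
  using branch_iff[of u y v x] assms by (auto simp: children_def)

text \<open>A three-cycle at the lowest common ancestor of \<open>s\<close> and \<open>t\<close>
  brings \<open>s\<close> into the branch of \<open>t\<close>, which shortens their
  distance.\<close>

lemma Alt_transitive_sphere:
  assumes "d v s = d v t"
  obtains a where "a \<in> Alt" "a v = v" "a s = t"
proof -
  have "\<exists>a\<in>Alt. a v = v \<and> a s = t" using assms
  proof (induction "d s t" arbitrary: s rule: less_induct)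
    case less
    show ?case
    proof (cases "s = t")
      case True
      then show ?thesis by (intro bexI[of _ id]) auto
    next
      case False
      obtain q m x y where q: "d v q + Suc m = d v t" "E q x" "E q y" "x \<noteq> y"
        "d v x = Suc (d v q)" "d v y = Suc (d v q)" "s \<in> branch q x" "t \<in> branch q y"
        "d x s = m" "d y t = m" "d s t = 2 * Suc m"
        by (rule meet_exists[OF less.prems refl False])
      obtain w where w: "w \<in> children v q" "w \<notin> {x, y}"
        by (rule children_avoid[of "{x, y}"]) (auto simp: card_insert_if)
      have "x \<in> children v q" "y \<in> children v q" using q by (auto simp: children_def)
      then obtain a where a: "a \<in> Alt" "a x = y" "\<And>z. d v z \<le> d v q \<Longrightarrow> a z = z"
        using children_three_cycle[of x v q y w] w q(4) by blast
      have av: "a v = v" using a(3) by simp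
      have "d y (a s) = m" using Autp_dist[of a x s] a q by simp
      then have "d (a s) t < d s t" using dist_triangle[of "a s" t y] q by (simp add: dist_sym)
      moreover have "d v (a s) = d v t" using Autp_dist[of a v s] a(1) av less.prems by simp
      ultimately obtain b where "b \<in> Alt" "b v = v" "b (a s) = t" using less.hyps by blast
      then show ?thesis using a(1) av by (intro bexI[of _ "b \<circ> a"]) auto
    qed
  qed
  then show thesis using that by blast
qed

text \<open>Vertices of equal type have even distance, so they lie on a common sphere around their
  midpoint.\<close>

lemma Alt_transitive:
  assumes "s \<in> V0 \<longleftrightarrow> t \<in> V0"
  obtains a where "a \<in> Alt" "a s = t"
proof -
  obtain m where "d s t = 2 * m" using assms types_dist[of s t] by blast
  then have "d s t = m + m" by simp
  then obtain w where "d s w = m" "d w t = m" by (rule ancestor_exists)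
  then show thesis using Alt_transitive_sphere[of w s t] that by (metis dist_sym)
qed

text \<open>First \<open>x\<close> is moved to \<open>x'\<close>, with a dummy \<open>r\<close> as
  the fixed child; then the image of \<open>y\<close> is moved to \<open>y'\<close> while
  \<open>x'\<close> stays fixed.\<close>

lemma children_pair_transitive:
  assumes "x \<in> children v u" "y \<in> children v u" "x \<noteq> y" "x' \<in> children v u" "y' \<in> children v u" "x' \<noteq> y'"
  obtains b where "b \<in> Alt" "b x = x'" "b y = y'" "\<And>z. d v z \<le> d v u \<Longrightarrow> b z = z"
proof -
  have move: "\<exists>b\<in>Alt. b p = q \<and> b r = r \<and> (\<forall>z. d v z \<le> d v u \<longrightarrow> b z = z)"
    if pqr: "p \<in> children v u" "q \<in> children v u" "r \<in> children v u" "r \<noteq> p" "r \<noteq> q" for p q r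
  proof (cases "p = q")
    case True
    then show ?thesis by (intro bexI[of _ id]) auto
  next
    case False
    obtain w where w: "w \<in> children v u" "w \<notin> {p, q, r}"
      by (rule children_avoid[of "{p, q, r}"]) (auto simp: card_insert_if)
    obtain a where "a \<in> Alt" "a p = q" "\<And>z. d v z \<le> d v u \<Longrightarrow> a z = z"
      "\<And>z. z \<notin> branch u p \<Longrightarrow> z \<notin> branch u q \<Longrightarrow> z \<notin> branch u w \<Longrightarrow> a z = z"
      using children_three_cycle[of p v u q w] pqr w False by auto
    moreover have "r \<notin> branch u p" "r \<notin> branch u q" "r \<notin> branch u w"
      using children_not_branch[of r v u] pqr w by auto
    ultimately show ?thesis by blast
  qed
  obtain r where r: "r \<in> children v u" "r \<notin> {x, x'}"
    by (rule children_avoid[of "{x, x'}"]) (auto simp: card_insert_if)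
  obtain b where b: "b \<in> Alt" "b x = x'" "\<And>z. d v z \<le> d v u \<Longrightarrow> b z = z"
    using move[of x x' r] assms r by auto
  have bu: "b u = u" "b v = v" using b(3) by auto
  have "E (b u) (b y)" "d (b v) (b y) = d v y" "b y \<noteq> b x"
    using b(1) assms by (simp_all add: Autp_edge Autp_dist Autp_inj children_def)
  then have "b y \<in> children v u" "b y \<noteq> x'" using bu b assms(2) by (auto simp: children_def)
  then obtain c where c: "c \<in> Alt" "c (b y) = y'" "c x' = x'" "\<And>z. d v z \<le> d v u \<Longrightarrow> c z = z"
    using move[of "b y" y' x'] assms by auto
  show thesis
    by (rule that[of "c \<circ> b"]) (use b c in auto)
qed

text \<open>
  The vertices beyond \<open>x\<close>, as seen from its neighbour \<open>u\<close>, whose distance from \<open>x\<close> lies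
  in \<open>K\<close>.
\<close>

definition shell :: "nat set \<Rightarrow> 'v \<Rightarrow> 'v \<Rightarrow> 'v set" where
  "shell K u x = {z. d x z \<in> K \<and> d u z = Suc (d x z)}"

definition shell_sign :: "nat set \<Rightarrow> ('v \<Rightarrow> 'v) \<Rightarrow> 'v \<Rightarrow> 'v \<Rightarrow> int" where
  "shell_sign K g u x = (\<Prod>z\<in>shell K u x. lsign g z)"

section \<open>Products of signs over shells\<close>

lemma finite_shell: "finite K \<Longrightarrow> finite (shell K u x)"
  by (rule finite_subset[OF _ finite_ball[of x "Max K"]]) (auto simp: shell_def)

lemma mult_sign_cases: "(a::int) = 1 \<or> a = -1 \<Longrightarrow> (b::int) = 1 \<or> b = -1 \<Longrightarrow> a * b = 1 \<or> a * b = -1"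
  by auto

lemma prod_signs: "(\<And>z. z \<in> S \<Longrightarrow> f z = 1 \<or> f z = (-1::int)) \<Longrightarrow> prod f S = 1 \<or> prod f S = -1"
proof (induction S rule: infinite_finite_induct)
  case (insert x F)
  then have "prod f F = 1 \<or> prod f F = -1" "f x = 1 \<or> f x = -1" by blast+
  then show ?case using insert.hyps by (auto simp: mult_sign_cases)
qed auto

lemma shell_sign_cases: "shell_sign K g u x = 1 \<or> shell_sign K g u x = -1"
  unfolding shell_sign_def by (rule prod_signs) (rule lsign_cases)

lemma shell_sign_square [simp]: "shell_sign K g u x * shell_sign K g u x = 1"
  using shell_sign_cases[of K g u x] by auto

lemma shell_sign_cong: "(\<And>z. z \<in> shell K u x \<Longrightarrow> lsign g z = lsign h z) \<Longrightarrow> shell_sign K g u x = shell_sign K h u x"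
  unfolding shell_sign_def by (rule prod.cong) auto

lemma shell_sign_Alt [simp]: "a \<in> Alt \<Longrightarrow> shell_sign K a u x = 1"
  by (simp add: shell_sign_def)

lemma shell_image:
  assumes "h \<in> Autp"
  shows "bij_betw h (shell K u x) (shell K (h u) (h x))"
proof (rule bij_betwI[of _ _ _ "ginv h"])
  have *: "d y (ginv h z) = d (h y) z" for y z
    using Autp_dist[OF assms, of y "ginv h z"] by (simp add: Autp_inv_simps[OF assms])
  show "h \<in> shell K u x \<rightarrow> shell K (h u) (h x)"
    using assms by (auto simp: shell_def Autp_dist[OF assms])
  show "ginv h \<in> shell K (h u) (h x) \<rightarrow> shell K u x"
    by (auto simp: shell_def *)
qed (auto simp: Autp_inv_simps[OF assms])

lemma shell_sign_comp:
  assumes "g \<in> Autp" "h \<in> Autp"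
  shows "shell_sign K (g \<circ> h) u x = shell_sign K g (h u) (h x) * shell_sign K h u x"
  using prod.reindex_bij_betw[OF shell_image[OF assms(2)], of "lsign g"]
  unfolding shell_sign_def by (simp add: lsign_comp[OF assms] prod.distrib)

lemma shell_sign_insert:
  assumes "k \<notin> K" "finite K"
  shows "shell_sign (insert k K) g u x = shell_sign K g u x * shell_sign {k} g u x"
proof -
  have "shell (insert k K) u x = shell K u x \<union> shell {k} u x" "shell K u x \<inter> shell {k} u x = {}"
    using assms(1) by (auto simp: shell_def)
  then show ?thesis unfolding shell_sign_def
    using finite_shell[OF assms(2), of u x] finite_shell[of "{k}" u x] by (simp add: prod.union_disjoint)
qed

lemma shell_children: "x \<in> children v u \<Longrightarrow> shell {k} u x = {z. d v z = Suc (d v u + k) \<and> d x z = k}"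
  using branch_iff[of u x v] by (auto simp: shell_def children_def branch_def)

section \<open>Sign patterns on a sphere\<close>

definition delta :: "'v \<Rightarrow> 'v \<Rightarrow> int" where "delta s z = (if z = s then - 1 else 1)"
text \<open>Written as a product, the pattern is constantly 1 for \<open>s = t\<close>, and patterns
  can be chained over an intermediate vertex.\<close>

definition pair_pattern :: "'v \<Rightarrow> 'v \<Rightarrow> 'v \<Rightarrow> int" where "pair_pattern s t z = delta s z * delta t z"

lemma pair_pattern_simps: "pair_pattern s s z = 1" "pair_pattern s t z = pair_pattern t s z" "pair_pattern s t z * pair_pattern t r z = pair_pattern s r z"
  by (auto simp: pair_pattern_def delta_def)

lemma prod_pair_pattern:
  assumes "finite S"
  shows "(\<Prod>z\<in>S. pair_pattern s t z) = (if s \<in> S then -1 else 1) * (if t \<in> S then -1 else 1)"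
  using assms by (simp add: pair_pattern_def delta_def prod.distrib prod.delta)

text \<open>By \<open>cls\<close>, a class of descendants containing one value \<open>-1\<close>
  contains a second one. Multiplying by the pair pattern of the two reduces the number of values
  \<open>-1\<close>; the set \<open>X\<close> records where the pairs are taken.\<close>

lemma pair_pattern_induct:
  assumes p: "\<And>z. p z = 1 \<or> p z = (-1::int)"
    and j: "j \<le> n"
    and cls: "\<And>w. d v w + j = n \<Longrightarrow> (\<Prod>z\<in>{z. d v z = n \<and> d w z = j}. p z) = 1"
    and cong: "\<And>p q. P p \<Longrightarrow> (\<And>z. d v z = n \<Longrightarrow> p z = q z) \<Longrightarrow> P q"
    and one: "P (\<lambda>_. 1)"
    and mult: "\<And>p q. P p \<Longrightarrow> P q \<Longrightarrow> P (\<lambda>z. p z * q z)"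
    and pair: "\<And>x y. d v x = n \<Longrightarrow> d v y = n \<Longrightarrow> x \<noteq> y \<Longrightarrow> d x y \<le> 2 * j \<Longrightarrow> x \<in> X \<Longrightarrow> y \<in> X \<Longrightarrow> P (pair_pattern x y)"
    and X: "\<And>z. d v z = n \<Longrightarrow> p z = -1 \<Longrightarrow> z \<in> X"
  shows "P p"
  using p cls X
proof (induction "card {z. d v z = n \<and> p z = -1}" arbitrary: p rule: less_induct)
  case less
  note IH = less.hyps and pc = less.prems(1) and cls = less.prems(2) and X = less.prems(3)
  have fin: "finite {z. d v z = n \<and> R z}" for R by (rule finite_subset[OF _ finite_sphere[of v n]]) auto
  show ?case
  proof (cases "\<exists>x. d v x = n \<and> p x = -1")
    case False
    then show ?thesis using pc by (intro cong[OF one]) metis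
  next
    case True
    then obtain x where x: "d v x = n" "p x = -1" by blast
    have "d v x = (n - j) + j" using x j by simp
    then obtain w where w: "d v w = n - j" "d w x = j" by (rule ancestor_exists)
    let ?S = "{z. d v z = n \<and> d w z = j}"
    have "\<exists>y\<in>?S. y \<noteq> x \<and> p y = -1"
    proof (rule ccontr)
      assume "\<not> (\<exists>y\<in>?S. y \<noteq> x \<and> p y = -1)"
      then have "(\<Prod>z\<in>?S. p z) = (\<Prod>z\<in>?S. if z = x then -1 else 1)"
        using pc x by (intro prod.cong) auto
      also have "\<dots> = -1" using fin w x by (simp add: prod.delta)
      finally show False using cls[of w] w j by simp
    qed
    then obtain y where y: "d v y = n" "d w y = j" "y \<noteq> x" "p y = -1" by blast
    have dxy: "d x y \<le> 2 * j" using dist_triangle[of x y w] w y by (simp add: dist_sym)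
    let ?p = "\<lambda>z. p z * pair_pattern x y z"
    have same: "d w' x = j \<longleftrightarrow> d w' y = j" if "d v w' + j = n" for w'
    proof -
      have "d v w' = d v w" using that w by simp
      then have "w = w'" if "d v z = n" "d w z = j" "d w' z = j" for z
        using ancestor_unique[of v z w w'] that w(1) j by simp
      then show ?thesis using w(2) x(1) y(1,2) by blast
    qed
    have "P ?p"
    proof (rule IH)
      have "{z. d v z = n \<and> ?p z = -1} \<subset> {z. d v z = n \<and> p z = -1}"
        using x y pc by (auto simp: pair_pattern_def delta_def split: if_splits)
      then show "card {z. d v z = n \<and> ?p z = -1} < card {z. d v z = n \<and> p z = -1}"
        by (rule psubset_card_mono[OF fin])
      show "?p z = 1 \<or> ?p z = -1" for z using pc[of z] by (auto simp: pair_pattern_def delta_def)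
      show "z \<in> X" if "d v z = n" "?p z = -1" for z
        using X[of z] X[of x] X[of y] that x y pc[of z] by (auto simp: pair_pattern_def delta_def split: if_splits)
      show "(\<Prod>z\<in>{z. d v z = n \<and> d w' z = j}. ?p z) = 1" if "d v w' + j = n" for w'
        using cls[OF that] prod_pair_pattern[OF fin[of "\<lambda>z. d w' z = j"], of x y] same[OF that] x y by (simp add: prod.distrib)
    qed
    moreover have "P (pair_pattern x y)" using pair[of x y] x y dxy X by auto
    ultimately have "P (\<lambda>z. ?p z * pair_pattern x y z)" by (rule mult)
    then show ?thesis by (rule cong) (auto simp: pair_pattern_def delta_def)
  qed
qed

end

section \<open>The group \<open>H\<close> and the sign patterns it realises\<close>

locale big_group = coloured_tree E V0 V1 d0 d1 i
  for E :: "'v \<Rightarrow> 'v \<Rightarrow> bool" and V0 V1 :: "'v set" and d0 d1 :: nat and i :: "'v \<Rightarrow> nat" +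
  fixes H :: "('v \<Rightarrow> 'v) set"
  assumes H: "H \<in> HT_plus E V0 V1" and Alt_H: "Alt_plus E V0 V1 i \<subseteq> H"
begin

lemma H_Autp [simp]: "h \<in> H \<Longrightarrow> h \<in> Autp"
  using H by (auto simp: HT_plus_def)

lemma Alt_in_H [simp]: "h \<in> Alt \<Longrightarrow> h \<in> H"
  using Alt_H by auto

lemma H_id [simp]: "id \<in> H"
  using Alt_id by (rule Alt_in_H)

lemma H_subgroup: "subgroup H (Aut_group E)"
  using H by (auto simp: HT_plus_def)

lemma H_comp [simp]: "g \<in> H \<Longrightarrow> h \<in> H \<Longrightarrow> g \<circ> h \<in> H"
  using subgroup.m_closed[OF H_subgroup] by (simp add: Aut_group_def)

lemma H_inv [simp]: "g \<in> H \<Longrightarrow> ginv g \<in> H"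
proof -
  assume g: "g \<in> H"
  have mem: "h \<in> Aut E" if "h \<in> Autp" for h using that by (simp add: Aut_plus_def)
  have "m_inv (Aut_group E) g = ginv g"
    unfolding m_inv_def
  proof (rule the_equality)
    show "ginv g \<in> carrier (Aut_group E) \<and> g \<otimes>\<^bsub>Aut_group E\<^esub> ginv g = \<one>\<^bsub>Aut_group E\<^esub> \<and>
        ginv g \<otimes>\<^bsub>Aut_group E\<^esub> g = \<one>\<^bsub>Aut_group E\<^esub>"
      using g mem[of "ginv g"] by (auto simp: Aut_group_def Autp_inv_simps[OF H_Autp])
    fix y assume "y \<in> carrier (Aut_group E) \<and> g \<otimes>\<^bsub>Aut_group E\<^esub> y = \<one>\<^bsub>Aut_group E\<^esub> \<and>
        y \<otimes>\<^bsub>Aut_group E\<^esub> g = \<one>\<^bsub>Aut_group E\<^esub>"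
    then have "y \<circ> g = id" by (simp add: Aut_group_def)
    then have "y x = ginv g x" for x
      using Autp_inv_simps(2)[OF H_Autp[OF g], of x] by (metis comp_apply id_apply)
    then show "y = ginv g" by blast
  qed
  then show "ginv g \<in> H" using subgroup.m_inv_closed[OF H_subgroup g] by simp
qed

definition fixer :: "'v \<Rightarrow> nat \<Rightarrow> ('v \<Rightarrow> 'v) set" where
  "fixer v n = {h \<in> H. \<forall>z. d v z \<le> n \<longrightarrow> h z = z}"

lemma fixer_H: "h \<in> fixer v n \<Longrightarrow> h \<in> H" and fixer_fix: "h \<in> fixer v n \<Longrightarrow> d v z \<le> n \<Longrightarrow> h z = z"
  by (auto simp: fixer_def)

lemma fixer_comp: "g \<in> fixer v n \<Longrightarrow> h \<in> fixer v n \<Longrightarrow> g \<circ> h \<in> fixer v n"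
  by (auto simp: fixer_def)

lemma fixer_inv: "g \<in> fixer v n \<Longrightarrow> ginv g \<in> fixer v n"
  using Autp_inv_simps(1)[of g] unfolding fixer_def by (auto, metis)

lemma lsign_fixed_ball:
  assumes "\<And>z. d v z \<le> n \<Longrightarrow> h z = z" "d v z < n"
  shows "lsign h z = 1"
proof -
  have "lsign h z = lsign id z"
  proof (rule lsign_cong)
    fix x assume "x \<in> N z"
    then show "h x = id x" using dist_edge[of z x v] assms by auto
  qed
  then show ?thesis by simp
qed

lemma fixer_lsign: "h \<in> fixer v n \<Longrightarrow> d v z < n \<Longrightarrow> lsign h z = 1"
  by (rule lsign_fixed_ball) (auto simp: fixer_fix)

lemma fixer_conj:
  assumes "h \<in> fixer v n" "a \<in> Alt" "a v = v"
  shows "ginv a \<circ> (h \<circ> a) \<in> fixer v n"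
proof -
  have "d v (a z) = d v z" for z using Autp_dist[of a v z] assms by simp
  then show ?thesis using assms by (simp add: fixer_def Autp_inv_simps)
qed

lemma lsign_conj: "h \<in> Autp \<Longrightarrow> a \<in> Alt \<Longrightarrow> lsign (ginv a \<circ> (h \<circ> a)) z = lsign h (a z)"
  by (simp add: lsign_comp)

text \<open>
  Only the values of the pattern \<open>p\<close> on the sphere of radius \<open>n\<close> matter. Since the elements of
  \<open>fixer v n\<close> fix this sphere pointwise, their signs there are multiplicative.
\<close>

definition realised :: "'v \<Rightarrow> nat \<Rightarrow> ('v \<Rightarrow> int) \<Rightarrow> bool" where
  "realised v n p \<longleftrightarrow> (\<exists>h\<in>fixer v n. \<forall>z. d v z = n \<longrightarrow> lsign h z = p z)"

lemma realised_cong: "realised v n p \<Longrightarrow> (\<And>z. d v z = n \<Longrightarrow> p z = q z) \<Longrightarrow> realised v n q"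
  by (auto simp: realised_def)

lemma realised_one: "realised v n (\<lambda>_. 1)"
  unfolding realised_def by (rule bexI[of _ id]) (auto simp: fixer_def)

lemma realised_mult: "realised v n p \<Longrightarrow> realised v n q \<Longrightarrow> realised v n (\<lambda>z. p z * q z)"
proof -
  assume "realised v n p" "realised v n q"
  then obtain g h where gh: "g \<in> fixer v n" "h \<in> fixer v n"
    "\<And>z. d v z = n \<Longrightarrow> lsign g z = p z" "\<And>z. d v z = n \<Longrightarrow> lsign h z = q z"
    unfolding realised_def by blast
  have "lsign (g \<circ> h) z = p z * q z" if "d v z = n" for z
    using that gh by (subst lsign_comp) (auto dest: fixer_H simp: fixer_fix)
  then show ?thesis unfolding realised_def using fixer_comp gh(1,2) by blast
qed

lemma realised_conj: "realised v n p \<Longrightarrow> a \<in> Alt \<Longrightarrow> a v = v \<Longrightarrow> realised v n (\<lambda>z. p (a z))"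
proof -
  assume *: "realised v n p" "a \<in> Alt" "a v = v"
  then obtain h where h: "h \<in> fixer v n" "\<And>z. d v z = n \<Longrightarrow> lsign h z = p z"
    unfolding realised_def by blast
  have "d v (a z) = d v z" for z using Autp_dist[of a v z] * by simp
  then have "lsign (ginv a \<circ> (h \<circ> a)) z = p (a z)" if "d v z = n" for z
    using that h * lsign_conj[of h a z] by (simp add: fixer_H)
  then show ?thesis unfolding realised_def using fixer_conj[OF h(1) *(2,3)] by blast
qed

lemma realised_lsign: "h \<in> fixer v n \<Longrightarrow> realised v n (lsign h)"
  by (auto simp: realised_def)

text \<open>
  The two vertices of a pair have a common ancestor (with respect to the root \<open>v\<close>) at most \<open>j\<close>
  levels above them, so this says that the realised sign patterns on spheres of type \<open>\<tau>\<close>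
  include all those of product 1 on the descendants of each vertex \<open>j\<close> levels above the sphere.
\<close>

definition pairs_realised :: "bool \<Rightarrow> nat \<Rightarrow> bool" where
  "pairs_realised \<tau> j \<longleftrightarrow> (\<forall>v n x y. d v x = n \<longrightarrow> d v y = n \<longrightarrow> x \<noteq> y \<longrightarrow> d x y \<le> 2 * j \<longrightarrow> (x \<in> V0 \<longleftrightarrow> \<tau>)
      \<longrightarrow> realised v n (pair_pattern x y))"

lemma pairs_realised_0: "pairs_realised \<tau> 0"
  by (simp add: pairs_realised_def)

lemma pairs_realised_mono: "pairs_realised \<tau> j \<Longrightarrow> k \<le> j \<Longrightarrow> pairs_realised \<tau> k"
  unfolding pairs_realised_def by (metis le_trans mult_le_mono2)

lemma pairs_realised_realised:
  assumes "pairs_realised \<tau> j" "d v x = n" "d v y = n" "d x y \<le> 2 * j" "x \<in> V0 \<longleftrightarrow> \<tau>"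
  shows "realised v n (pair_pattern x y)"
proof (cases "x = y")
  case True
  then show ?thesis using realised_cong[OF realised_one] by (simp add: pair_pattern_simps)
next
  case False
  then show ?thesis using assms unfolding pairs_realised_def by blast
qed

text \<open>Two descendants at depth \<open>j\<close> of one vertex are at most \<open>2 * j\<close>
  apart, so the pattern factors into pair patterns covered by the assumption.\<close>

lemma realised_classes:
  assumes "pairs_realised \<tau> j" "j \<le> n" "\<And>z. d v z = n \<Longrightarrow> z \<in> V0 \<longleftrightarrow> \<tau>" "\<And>z. p z = 1 \<or> p z = -1"
    and "\<And>w. d v w + j = n \<Longrightarrow> (\<Prod>z\<in>{z. d v z = n \<and> d w z = j}. p z) = 1"
  shows "realised v n p"
  by (rule pair_pattern_induct[where X = UNIV and P = "realised v n", OF assms(4,2,5)])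
    (use assms in \<open>auto intro: realised_cong realised_one realised_mult pairs_realised_realised\<close>)

end

section \<open>Products over shells and over classes of descendants\<close>

context coloured_tree
begin

lemma prod_image_shell:
  "a \<in> Autp \<Longrightarrow> (\<Prod>z\<in>shell K u x. p (a z)) = (\<Prod>z\<in>shell K (a u) (a x). (p z :: int))"
  using prod.reindex_bij_betw[OF shell_image] by blast

lemma prod_image_class:
  assumes a: "a \<in> Autp" and v: "a v = v"
  shows "(\<Prod>z\<in>{z. d v z = n \<and> d w z = j}. p (a z)) = (\<Prod>z\<in>{z. d v z = n \<and> d (a w) z = j}. (p z :: int))"
proof (rule prod.reindex_bij_betw)
  have *: "d y (ginv a z) = d (a y) z" for y z
    using Autp_dist[OF a, of y "ginv a z"] by (simp add: Autp_inv_simps[OF a])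
  have "d v (a z) = d v z" for z using Autp_dist[OF a, of v z] v by simp
  then show "bij_betw a {z. d v z = n \<and> d w z = j} {z. d v z = n \<and> d (a w) z = j}"
    by (intro bij_betwI[of _ _ _ "ginv a"]) (auto simp: Autp_inv_simps[OF a] Autp_dist[OF a] * v)
qed

lemma class_eq_shell:
  assumes "c \<in> children v u" "n = Suc (d v u + j)"
  shows "{z. d v z = n \<and> d c z = j} = shell {j} u c"
  using shell_children[OF assms(1), of j] assms(2) by simp

lemma children_fix:
  assumes "c \<in> children v u" "b \<in> Alt" "b v = v" "b u = u"
  shows "b c \<in> children v u"
  using assms Autp_edge[of b u c] Autp_dist[of b v c] by (simp add: children_def)

lemma branch_level:
  assumes "c \<in> children v u" "z \<in> branch u c" "d v z = Suc (d v u + k)"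
  shows "d c z = k" "d u z = Suc k"
  using branch_iff[of u c v z] assms by (auto simp: children_def branch_def)

lemma shell_branch: "z \<in> shell {k} u c \<longleftrightarrow> z \<in> branch u c \<and> d c z = k"
  by (auto simp: shell_def branch_def)

end

context big_group
begin

text \<open>All vertices at distance \<open>n\<close> from \<open>v\<close> lie in \<open>V0\<close> if \<open>\<tau>\<close>, and in \<open>V1\<close> otherwise.\<close>

definition leaf_type :: "bool \<Rightarrow> 'v \<Rightarrow> nat \<Rightarrow> bool" where
  "leaf_type \<tau> v n \<longleftrightarrow> ((v \<in> V0 \<longleftrightarrow> \<tau>) \<longleftrightarrow> even n)"

lemma leaf_typeD: "leaf_type \<tau> v n \<Longrightarrow> d v z = n \<Longrightarrow> z \<in> V0 \<longleftrightarrow> \<tau>"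
  using types_dist[of v z] by (auto simp: leaf_type_def)

lemma leaf_typeI: "d v z = n \<Longrightarrow> z \<in> V0 \<longleftrightarrow> \<tau> \<Longrightarrow> leaf_type \<tau> v n"
  using types_dist[of v z] by (auto simp: leaf_type_def)

text \<open>The fixed ball just reaches the vertices \<open>k\<close> levels below the children of
  \<open>u\<close>. Lowering \<open>k\<close> admits more elements \<open>h\<close> and so
  strengthens the condition.\<close>

definition children_agree :: "'v \<Rightarrow> 'v \<Rightarrow> nat \<Rightarrow> nat set \<Rightarrow> bool" where
  "children_agree v u k K \<longleftrightarrow> (\<forall>h\<in>fixer v (Suc (d v u + k)). \<forall>x\<in>children v u. \<forall>y\<in>children v u. shell_sign K h u x = shell_sign K h u y)"

text \<open>The bound \<open>j + 2\<close> gives \<open>w\<close> a parent and a grandparent with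
  respect to \<open>v\<close>, which \<open>flat_classes\<close> compares.\<close>

definition class_products_trivial :: "bool \<Rightarrow> nat \<Rightarrow> bool" where
  "class_products_trivial \<sigma> j \<longleftrightarrow> (\<forall>v n h w. h \<in> fixer v n \<longrightarrow> n \<ge> j + 2 \<longrightarrow> leaf_type \<sigma> v n \<longrightarrow> d v w + j = n \<longrightarrow>
      (\<Prod>z\<in>{z. d v z = n \<and> d w z = j}. lsign h z) = 1)"

subsection \<open>The first constraint\<close>

text \<open>
  Multiplying the sign pattern of \<open>h\<close> by its translate under a three-cycle leaves a pattern
  with product \<open>-1\<close> below exactly two children of \<open>u\<close>; up to a pattern that is realised by
  assumption, this is the pattern of a pair.
\<close>

lemma pattern_from_asymmetry:
  assumes pairs_realised: "pairs_realised \<tau> j" and n: "n = Suc (d v u + j)" and lt: "leaf_type \<tau> v n"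
    and h: "h \<in> fixer v n" and x: "x \<in> children v u" and y: "y \<in> children v u"
    and ne: "shell_sign {j} h u x \<noteq> shell_sign {j} h u y"
    and x1: "x1 \<in> children v u" and y1: "y1 \<in> children v u" and ne1: "x1 \<noteq> y1"
    and x0: "d v x0 = n" "d x1 x0 = j" and y0: "d v y0 = n" "d y1 y0 = j"
  shows "realised v n (pair_pattern x0 y0)"
proof -
  have xy: "x \<noteq> y" using ne by auto
  obtain w where w: "w \<in> children v u" "w \<notin> {x, y}"
    by (rule children_avoid[of "{x, y}"]) (auto simp: card_insert_if)
  obtain a where a: "a \<in> Alt" "a x = y" "a y = w" "a w = x" "\<And>z. d v z \<le> d v u \<Longrightarrow> a z = z"
    "\<And>z. z \<notin> branch u x \<Longrightarrow> z \<notin> branch u y \<Longrightarrow> z \<notin> branch u w \<Longrightarrow> a z = z"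
    using children_three_cycle[OF x y w(1)] xy w(2) by auto
  have av: "a v = v" "a u = u" using a(5) by auto
  \<comment> \<open>The product of \<open>X\<close> below \<open>c\<close> compares \<open>h\<close>
    below \<open>c\<close> and below \<open>a c\<close>, so children fixed by \<open>a\<close> drop
    out.\<close>
  define X where "X z = lsign h z * lsign h (a z)" for z
  define \<chi> where "\<chi> p c = (\<Prod>z\<in>shell {j} u c. p z)" for p :: "'v \<Rightarrow> int" and c
  have RX: "realised v n X" unfolding X_def
    using realised_mult[OF realised_lsign[OF h] realised_conj[OF realised_lsign[OF h] a(1) av(1)]] .
  have \<chi>X: "\<chi> X c = shell_sign {j} h u c * shell_sign {j} h u (a c)" for c
    unfolding \<chi>_def X_def shell_sign_def using prod_image_shell[of a "lsign h" "{j}" u c] a(1) av by (simp add: prod.distrib)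
  have out: "\<chi> X c = 1" if "c \<in> children v u" "c \<notin> {x, y, w}" for c
  proof -
    have "a c = c" using a(6)[of c] children_not_branch[of c v u] that x y w by auto
    then show ?thesis using \<chi>X[of c] by simp
  qed
  \<comment> \<open>As \<open>a\<close> permutes \<open>x\<close>, \<open>y\<close>,
    \<open>w\<close> cyclically, the three products multiply to 1. The first is \<open>-1\<close>,
    so exactly one of the others is.\<close>
  have three: "\<chi> X x = -1" "\<chi> X y * \<chi> X w = -1" "\<chi> X y = 1 \<or> \<chi> X y = -1" "\<chi> X w = 1 \<or> \<chi> X w = -1"
    using \<chi>X[of x] \<chi>X[of y] \<chi>X[of w] a(2-4) ne shell_sign_cases[of "{j}" h u x] shell_sign_cases[of "{j}" h u y]
      shell_sign_cases[of "{j}" h u w] by auto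
  obtain x' y' where xy': "x' \<in> children v u" "y' \<in> children v u" "x' \<noteq> y'" "\<chi> X x' = -1" "\<chi> X y' = -1"
    "\<And>c. c \<in> children v u \<Longrightarrow> c \<noteq> x' \<Longrightarrow> c \<noteq> y' \<Longrightarrow> \<chi> X c = 1"
  proof (cases "\<chi> X y = -1")
    case True
    then have "\<chi> X w = 1" using three by auto
    then show ?thesis using that[of x y] x y xy three(1) True out by blast
  next
    case False
    then have "\<chi> X w = -1" "\<chi> X y = 1" using three by auto
    then show ?thesis using that[of x w] x w three(1) out by blast
  qed
  obtain b where b: "b \<in> Alt" "b x1 = x'" "b y1 = y'" "\<And>z. d v z \<le> d v u \<Longrightarrow> b z = z"
    using children_pair_transitive[OF x1 y1 ne1 xy'(1-3)] by blast
  have bv: "b v = v" "b u = u" using b(4) by auto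
  \<comment> \<open>With \<open>b\<close> moving \<open>x1\<close>, \<open>y1\<close> to the two
    exceptional children \<open>x'\<close>, \<open>y'\<close>, the two factors have the same product
    on every class, so \<open>Z\<close> is realised by assumption.\<close>
  define Z where "Z z = X (b z) * pair_pattern x0 y0 z" for z
  have RXb: "realised v n (\<lambda>z. X (b z))" using realised_conj[OF RX b(1) bv(1)] .
  have X1: "X z = 1 \<or> X z = -1" for z unfolding X_def using mult_sign_cases lsign_cases by blast
  have fin: "finite {z. d v z = n \<and> d c z = j}" for c
    by (rule finite_subset[OF _ finite_sphere[of v n]]) auto
  have anc: "c = c'" if "d v c + j = n" "d v c' + j = n" "d v z = n" "d c z = j" "d c' z = j" for c c' z
    using ancestor_unique[of v z c c'] that by simp
  have cls: "(\<Prod>z\<in>{z. d v z = n \<and> d c z = j}. Z z) = 1" if c: "d v c + j = n" for c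
  proof -
    let ?S = "{z. d v z = n \<and> d c z = j}"
    have eq: "(\<Prod>z\<in>?S. Z z) = (\<Prod>z\<in>?S. X (b z)) * ((if c = x1 then -1 else 1) * (if c = y1 then -1 else 1))"
    proof -
      have "x0 \<in> ?S \<longleftrightarrow> c = x1" "y0 \<in> ?S \<longleftrightarrow> c = y1"
        using anc[OF c _ x0(1), of x1] anc[OF c _ y0(1), of y1] x0 y0 x1 y1 n by (auto simp: children_def)
      then show ?thesis using prod_pair_pattern[OF fin[of c], of x0 y0] by (simp add: Z_def prod.distrib)
    qed
    show ?thesis
    proof (cases "c \<in> children v u")
      case True
      have "(\<Prod>z\<in>?S. X (b z)) = \<chi> X (b c)"
        unfolding class_eq_shell[OF True n] \<chi>_def using prod_image_shell[of b X "{j}" u c] b(1) bv by simp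
      moreover have "b c \<in> children v u" using children_fix[OF True b(1) bv] .
      moreover have "b c = x' \<longleftrightarrow> c = x1" "b c = y' \<longleftrightarrow> c = y1"
        using Autp_inj[of b c x1] Autp_inj[of b c y1] b by auto
      ultimately show ?thesis using eq xy'(3-6) ne1 by (cases "c = x1"; cases "c = y1") auto
    next
      case False
      \<comment> \<open>\<open>b z\<close> lies outside the branches moved by \<open>a\<close>, so
        \<open>X\<close> is a square there.\<close>
      have "X (b z) = 1" if z: "z \<in> ?S" for z
      proof -
        have "b z \<notin> branch u e" if e: "e \<in> children v u" for e
        proof
          assume "b z \<in> branch u e"
          moreover have zb: "d v (b z) = n" "d (b c) (b z) = j" "d v (b c) = d v c"
            using z Autp_dist[of b v z] Autp_dist[of b c z] Autp_dist[of b v c] b(1) bv by auto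
          ultimately have "d e (b z) = j" using branch_level(1)[OF e, of "b z" j] n by auto
          then have "e = b c" using anc[of e "b c" "b z"] zb c e n by (auto simp: children_def)
          moreover have "b (ginv b c) = c" "ginv b u = u" "ginv b v = v" "ginv b (b c) = c"
            using b(1) bv Autp_inv_simps[of b] by (metis Alt_Autp)+
          ultimately have "c \<in> children v u" using children_fix[OF e, of "ginv b"] b(1) by simp
          then show False using False by simp
        qed
        then show ?thesis using a(6)[of "b z"] x y w by (simp add: X_def)
      qed
      then have "(\<Prod>z\<in>?S. X (b z)) = 1" by (intro prod.neutral) auto
      then show ?thesis using eq False x1 y1 by auto
    qed
  qed
  have "realised v n Z"
  proof (rule realised_classes[OF pairs_realised _ _ _ cls])
    show "j \<le> n" using n by simp
    show "Z z = 1 \<or> Z z = -1" for z using X1[of "b z"] by (auto simp: Z_def pair_pattern_def delta_def)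
  qed (use leaf_typeD[OF lt] in auto)
  then have "realised v n (\<lambda>z. X (b z) * Z z)" using RXb realised_mult by blast
  moreover have "X (b z) * X (b z) = 1" for z using X1[of "b z"] by auto
  then have "X (b z) * Z z = pair_pattern x0 y0 z" for z by (simp add: Z_def mult.assoc[symmetric])
  ultimately show ?thesis by simp
qed

text \<open>A pair that fails for \<open>Suc j\<close> but not for \<open>j\<close> has distance
  exactly \<open>2 * Suc j\<close>. At its lowest common ancestor \<open>u\<close>, a disagreement
  between children would realise its pattern by \<open>pattern_from_asymmetry\<close>.\<close>

lemma children_agree_exists:
  assumes "pairs_realised \<tau> j" "\<not> pairs_realised \<tau> (Suc j)"
  obtains v u where "d v u \<ge> 1" "leaf_type \<tau> u (Suc j)" "children_agree v u j {j}"
proof -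
  obtain v n x0 y0 where *: "d v x0 = n" "d v y0 = n" "x0 \<noteq> y0" "d x0 y0 \<le> 2 * Suc j" "x0 \<in> V0 \<longleftrightarrow> \<tau>"
    "\<not> realised v n (pair_pattern x0 y0)"
    using assms(2) unfolding pairs_realised_def by blast
  have "\<not> d x0 y0 \<le> 2 * j" using assms(1) * unfolding pairs_realised_def by blast
  moreover obtain u m x1 y1 where q: "d v u + Suc m = n" "E u x1" "E u y1" "x1 \<noteq> y1"
    "d v x1 = Suc (d v u)" "d v y1 = Suc (d v u)" "x0 \<in> branch u x1" "y0 \<in> branch u y1" "d x1 x0 = m" "d y1 y0 = m"
    "d x0 y0 = 2 * Suc m"
    by (rule meet_exists[OF *(1-3)])
  ultimately have m: "m = j" using *(4) by simp
  have n: "n = Suc (d v u + j)" using q(1) m by simp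
  have st: "children_agree v u j {j}"
    unfolding children_agree_def n[symmetric]
  proof (intro ballI, rule ccontr)
    fix h x y assume hxy: "h \<in> fixer v n" "x \<in> children v u" "y \<in> children v u" "shell_sign {j} h u x \<noteq> shell_sign {j} h u y"
    have "x1 \<in> children v u" "y1 \<in> children v u" using q by (auto simp: children_def)
    then have "realised v n (pair_pattern x0 y0)"
      using pattern_from_asymmetry[OF assms(1) n leaf_typeI[OF *(1,5)] hxy _ _ q(4) *(1) _ *(2)] q(9,10) m by blast
    then show False using * by simp
  qed
  have "d u x0 = Suc j" using q m by (simp add: branch_def)
  then have lt: "leaf_type \<tau> u (Suc j)" using *(5) leaf_typeI by blast
  show thesis
  proof (cases "d v u \<ge> 1")
    case True
    then show ?thesis using that lt st by blast
  next
    case False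
    \<comment> \<open>If \<open>u\<close> is the root, the root is moved to a neighbour; this only
      shrinks the fixer and the set of children. The bound \<open>d v u \<ge> 1\<close> is used in
      \<open>lift_step\<close>.\<close>
    then have vu: "v = u" using dist_eq_0[of v u] by linarith
    obtain v' where v': "E v v'" using q(2) vu by blast
    have dv: "d v' u = 1" using v' vu dist_eq_1 dist_sym by simp
    have le: "d v' z \<le> Suc (d v z)" for z using dist_triangle[of v' z v] dv vu by simp
    have "children_agree v' u j {j}"
      unfolding children_agree_def
    proof (intro ballI)
      fix h x y assume h: "h \<in> fixer v' (Suc (d v' u + j))" and xy: "x \<in> children v' u" "y \<in> children v' u"
      have "d v' z \<le> Suc (d v' u + j)" if "d v z \<le> Suc (d v u + j)" for z
        using le[of z] that dv vu by simp
      then have "h \<in> fixer v (Suc (d v u + j))" using h unfolding fixer_def by blast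
      moreover have "x \<in> children v u" "y \<in> children v u" using xy vu dist_eq_1 by (auto simp: children_def)
      ultimately show "shell_sign {j} h u x = shell_sign {j} h u y" using st unfolding children_agree_def by blast
    qed
    then show ?thesis using that[of v' u] lt dv by simp
  qed
qed

text \<open>Inside the ball the signs are 1 automatically, so only the sphere has to be checked for
  \<open>alt_on_ball\<close>.\<close>

lemma alt_factor:
  assumes "g \<in> Autp" "\<And>z. d v z \<le> n \<Longrightarrow> g z = z" "\<And>z. d v z = n \<Longrightarrow> lsign g z = 1"
  obtains a where "a \<in> Alt" "\<And>z. d v z \<le> n \<Longrightarrow> a z = z" "\<And>z. d v z \<le> Suc n \<Longrightarrow> a z = g z"
proof -
  have "lsign g z = 1" if "d v z \<le> n" for z
    using assms(2,3) lsign_fixed_ball[of v n g z] that by (cases "d v z = n") auto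
  then obtain a where a: "a \<in> Alt" "\<And>x. d v x \<le> Suc n \<Longrightarrow> a x = g x"
    using alt_on_ball[OF assms(1), of v n] by blast
  then show thesis using that[of a] assms(2) by simp
qed

end

subsection \<open>Correcting the constraint by lower levels\<close>

text \<open>
  The constraint \<open>children_agree v u (Suc k) K\<close> on elements fixing a ball is extended to elements
  fixing a ball of radius one less. By how much such an element violates the constraint is
  measured by \<open>\<Phi>\<close>; it depends only on the sign pattern \<open>p\<close> on the sphere of radius \<open>L\<close>, and
  invariance under three-cycles leaves no other possibility than \<open>\<Phi> p y z = 1\<close> for all \<open>p\<close>, or
  \<open>\<Phi> p y z\<close> being the product of the signs \<open>p\<close> below \<open>y\<close> and below \<open>z\<close>. In the second
  case the constraint holds after adding \<open>k\<close> to \<open>K\<close>.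
\<close>

locale lift_step = big_group E V0 V1 d0 d1 i H
  for E :: "'v \<Rightarrow> 'v \<Rightarrow> bool" and V0 V1 :: "'v set" and d0 d1 :: nat and i :: "'v \<Rightarrow> nat"
    and H :: "('v \<Rightarrow> 'v) set" +
  fixes v u :: 'v and k :: nat and K :: "nat set" and L :: nat
  assumes children_agree: "children_agree v u (Suc k) K" and L: "L = Suc (d v u + k)"
begin

text \<open>\<open>ginv h \<circ> h'\<close> has trivial signs on the sphere, so it agrees with an
  element of \<open>Alt\<close> on the next ball. The quotient of the two fixes that ball and falls
  under \<open>children_agree\<close>, while elements of \<open>Alt\<close> have shell sign
  1.\<close>

lemma shell_sign_determined:
  assumes h: "h \<in> fixer v L" "h' \<in> fixer v L" and eq: "\<And>s. d v s = L \<Longrightarrow> lsign h s = lsign h' s"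
    and y: "y \<in> children v u" and z: "z \<in> children v u"
  shows "shell_sign K h u y * shell_sign K h u z = shell_sign K h' u y * shell_sign K h' u z"
proof -
  have hA: "h \<in> Autp" "h' \<in> Autp" using h fixer_H H_Autp by blast+
  define g where "g = ginv h \<circ> h'"
  have gF: "g \<in> fixer v L" unfolding g_def using h fixer_comp fixer_inv by blast
  then have gA: "g \<in> Autp" using fixer_H H_Autp by blast
  have fix_h: "h' s = s" "ginv h s = s" if "d v s \<le> L" for s
    using that fixer_fix[OF h(2)] fixer_fix[OF fixer_inv[OF h(1)]] by auto
  have "lsign g s = 1" if "d v s = L" for s
    using that fix_h[of s] eq[of s] lsign_comp[OF Autp_inv[OF hA(1)] hA(2), of s] lsign_inv[OF hA(1), of s]
    by (simp add: g_def)
  then obtain a where a: "a \<in> Alt" "\<And>s. d v s \<le> L \<Longrightarrow> a s = s" "\<And>s. d v s \<le> Suc L \<Longrightarrow> a s = g s"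
    using alt_factor[OF gA, of v L] fixer_fix[OF gF] by blast
  have aA: "a \<in> Autp" using a(1) by simp
  have ai: "ginv a s = s" if "d v s \<le> L" for s
    using Autp_inv_simps(1)[OF aA, of s] a(2)[OF that] by simp
  have "g \<circ> ginv a \<in> fixer v (Suc L)"
    unfolding fixer_def
  proof (intro CollectI conjI allI impI)
    show "g \<circ> ginv a \<in> H" using fixer_H[OF gF] a(1) by simp
    fix s assume s: "d v s \<le> Suc L"
    have "d v (ginv a s) = d v s" using Autp_dist[OF Autp_inv[OF aA], of v s] ai[of v] by simp
    then show "(g \<circ> ginv a) s = s" using a(3)[of "ginv a s"] s Autp_inv_simps(2)[OF aA, of s] by simp
  qed
  then have "shell_sign K (g \<circ> ginv a) u y = shell_sign K (g \<circ> ginv a) u z"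
    using children_agree y z unfolding children_agree_def L add_Suc_right by blast
  moreover have lev: "d v u \<le> L" "d v y \<le> L" "d v z \<le> L" using y z L by (auto simp: children_def)
  ultimately have "shell_sign K g u y = shell_sign K g u z"
    using shell_sign_comp[OF gA Autp_inv[OF aA]] ai a(1) by simp
  moreover have "h \<circ> g = h'" by (rule ext) (simp add: g_def Autp_inv_simps[OF hA(1)])
  then have "shell_sign K h' u s = shell_sign K h u s * shell_sign K g u s" if "d v s \<le> L" for s
    using shell_sign_comp[OF hA(1) gA, of K u s] fixer_fix[OF gF] lev that by simp
  ultimately show ?thesis using lev shell_sign_cases[of K g u z] by auto
qed

text \<open>By \<open>shell_sign_determined\<close> the choice of \<open>h\<close> does not matter
  if \<open>p\<close> is realised. For other \<open>p\<close> the value is arbitrary, but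
  \<open>\<Phi>_refl\<close>, \<open>\<Phi>_sym\<close> and \<open>\<Phi>_trans\<close> still
  hold.\<close>

definition \<Phi> :: "('v \<Rightarrow> int) \<Rightarrow> 'v \<Rightarrow> 'v \<Rightarrow> int" where
  "\<Phi> p y z = (let h = (SOME h. h \<in> fixer v L \<and> (\<forall>s. d v s = L \<longrightarrow> lsign h s = p s)) in shell_sign K h u y * shell_sign K h u z)"

lemma \<Phi>_eq:
  assumes "h \<in> fixer v L" "\<And>s. d v s = L \<Longrightarrow> lsign h s = p s" "y \<in> children v u" "z \<in> children v u"
  shows "\<Phi> p y z = shell_sign K h u y * shell_sign K h u z"
proof -
  define h' where "h' = (SOME h. h \<in> fixer v L \<and> (\<forall>s. d v s = L \<longrightarrow> lsign h s = p s))"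
  have "h' \<in> fixer v L \<and> (\<forall>s. d v s = L \<longrightarrow> lsign h' s = p s)"
    unfolding h'_def by (rule someI[of _ h]) (use assms in auto)
  then have "shell_sign K h' u y * shell_sign K h' u z = shell_sign K h u y * shell_sign K h u z"
    using assms by (intro shell_sign_determined) auto
  then show ?thesis by (simp add: \<Phi>_def h'_def[symmetric] Let_def)
qed

lemma \<Phi>_cases: "\<Phi> p y z = 1 \<or> \<Phi> p y z = -1"
  unfolding \<Phi>_def Let_def using mult_sign_cases shell_sign_cases by blast

lemma \<Phi>_refl: "\<Phi> p y y = 1" and \<Phi>_sym: "\<Phi> p y z = \<Phi> p z y"
  and \<Phi>_trans: "\<Phi> p x y * \<Phi> p y z = \<Phi> p x z"
proof -
  have "(a * b) * (b * c) = a * (c :: int)" if "b * b = 1" for a b c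
    using that by (metis mult.assoc mult.right_neutral)
  then show "\<Phi> p x y * \<Phi> p y z = \<Phi> p x z" by (simp add: \<Phi>_def Let_def)
qed (simp_all add: \<Phi>_def Let_def mult.commute)

lemma \<Phi>_cong:
  assumes "realised v L p" "\<And>s. d v s = L \<Longrightarrow> p s = q s" "y \<in> children v u" "z \<in> children v u"
  shows "\<Phi> q y z = \<Phi> p y z"
proof -
  obtain h where h: "h \<in> fixer v L" "\<And>s. d v s = L \<Longrightarrow> lsign h s = p s"
    using assms(1) unfolding realised_def by blast
  then show ?thesis using \<Phi>_eq[OF h assms(3,4)] \<Phi>_eq[OF h(1) _ assms(3,4), of q] assms(2) by simp
qed

lemma \<Phi>_one: "y \<in> children v u \<Longrightarrow> z \<in> children v u \<Longrightarrow> \<Phi> (\<lambda>_. 1) y z = 1"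
  using \<Phi>_eq[of id "\<lambda>_. 1" y z] by (simp add: fixer_def)

lemma \<Phi>_mult:
  assumes "realised v L p" "realised v L q" "y \<in> children v u" "z \<in> children v u"
  shows "\<Phi> (\<lambda>s. p s * q s) y z = \<Phi> p y z * \<Phi> q y z"
proof -
  obtain g h where g: "g \<in> fixer v L" "\<And>s. d v s = L \<Longrightarrow> lsign g s = p s"
    and h: "h \<in> fixer v L" "\<And>s. d v s = L \<Longrightarrow> lsign h s = q s"
    using assms(1,2) unfolding realised_def by blast
  have A: "g \<in> Autp" "h \<in> Autp" using g h fixer_H by auto
  have fix_h: "h s = s" if "d v s \<le> L" for s using fixer_fix[OF h(1) that] .
  have sgc: "lsign (g \<circ> h) s = p s * q s" if "d v s = L" for s
    using lsign_comp[OF A, of s] fix_h[of s] that g h by simp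
  have "\<Phi> (\<lambda>s. p s * q s) y z = shell_sign K (g \<circ> h) u y * shell_sign K (g \<circ> h) u z"
    by (rule \<Phi>_eq[OF fixer_comp[OF g(1) h(1)] sgc assms(3,4)])
  moreover have "h u = u" "h y = y" "h z = z" using fix_h assms L by (auto simp: children_def)
  ultimately show ?thesis
    using \<Phi>_eq[OF g assms(3,4)] \<Phi>_eq[OF h assms(3,4)] shell_sign_comp[OF A, of K u] by simp
qed

lemma \<Phi>_conj:
  assumes "realised v L p" "a \<in> Alt" "a v = v" "a u = u" "y \<in> children v u" "z \<in> children v u"
  shows "\<Phi> (\<lambda>s. p (a s)) y z = \<Phi> p (a y) (a z)"
proof -
  obtain h where h: "h \<in> fixer v L" "\<And>s. d v s = L \<Longrightarrow> lsign h s = p s"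
    using assms(1) unfolding realised_def by blast
  have A: "h \<in> Autp" "a \<in> Autp" using fixer_H[OF h(1)] assms(2) by auto
  have "d v (a s) = d v s" for s using Autp_dist[OF A(2), of v s] assms(3) by simp
  then have sgc: "lsign (ginv a \<circ> (h \<circ> a)) s = p (a s)" if "d v s = L" for s
    using that h(2)[of "a s"] lsign_conj[OF A(1) assms(2), of s] by simp
  have "\<Phi> (\<lambda>s. p (a s)) y z = shell_sign K (ginv a \<circ> (h \<circ> a)) u y * shell_sign K (ginv a \<circ> (h \<circ> a)) u z"
    by (rule \<Phi>_eq[OF fixer_conj[OF h(1) assms(2,3)] sgc assms(5,6)])
  moreover have "shell_sign K (ginv a \<circ> (h \<circ> a)) u s = shell_sign K h u (a s)" for s
    using shell_sign_comp[OF Autp_inv[OF A(2)] Autp_comp[OF A], of K u s] shell_sign_comp[OF A, of K u s] assms(2,4) by simp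
  ultimately show ?thesis
    using \<Phi>_eq[OF h] children_fix assms by simp
qed

lemma \<Phi>_image:
  assumes "realised v L (pair_pattern (a s) (a t))" "a \<in> Alt" "a v = v" "a u = u" "y \<in> children v u" "z \<in> children v u"
  shows "\<Phi> (pair_pattern (a s) (a t)) (a y) (a z) = \<Phi> (pair_pattern s t) y z"
proof -
  have "(\<lambda>r. pair_pattern (a s) (a t) (a r)) = pair_pattern s t"
    by (rule ext) (use assms(2) Autp_inj[of a] in \<open>simp add: pair_pattern_def delta_def\<close>)
  then show ?thesis using \<Phi>_conj[OF assms] by simp
qed

lemma \<Phi>_chain:
  assumes "realised v L (pair_pattern s t)" "realised v L (pair_pattern t r)" "y \<in> children v u" "z \<in> children v u"
  shows "\<Phi> (pair_pattern s r) y z = \<Phi> (pair_pattern s t) y z * \<Phi> (pair_pattern t r) y z"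
proof -
  have "pair_pattern s r = (\<lambda>z. pair_pattern s t z * pair_pattern t r z)" by (rule ext) (simp only: pair_pattern_simps(3))
  then show ?thesis using \<Phi>_mult[OF assms] by simp
qed

text \<open>For a child \<open>w\<close> whose branch avoids \<open>s\<close> and \<open>t\<close>,
  a three-cycle on \<open>y\<close>, \<open>z\<close>, \<open>w\<close> fixes \<open>s\<close> and
  \<open>t\<close>. The values of \<open>\<Phi>\<close> on the three consecutive pairs of children
  are then equal with product 1, hence all 1.\<close>

lemma \<Phi>_off_branches:
  assumes R: "realised v L (pair_pattern s t)" and yz: "y \<in> children v u" "z \<in> children v u"
    and s: "s \<notin> branch u y" "s \<notin> branch u z" and t: "t \<notin> branch u y" "t \<notin> branch u z"
  shows "\<Phi> (pair_pattern s t) y z = 1"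
proof (cases "y = z")
  case True
  then show ?thesis by (simp add: \<Phi>_refl)
next
  case ne: False
  \<comment> \<open>A vertex lies below at most one child, so avoiding \<open>cs\<close> and
    \<open>ct\<close> keeps \<open>s\<close> and \<open>t\<close> out of the branch at
    \<open>w\<close>.\<close>
  have one: "\<exists>c. {x \<in> children v u. r \<in> branch u x} \<subseteq> {c}" for r
  proof (cases "\<exists>c. c \<in> children v u \<and> r \<in> branch u c")
    case True
    then obtain c where "c \<in> children v u" "r \<in> branch u c" by blast
    then show ?thesis using branch_disjoint[of u c] by (intro exI[of _ c]) (auto simp: children_def)
  qed auto
  obtain cs ct where cs: "{x \<in> children v u. s \<in> branch u x} \<subseteq> {cs}" and ct: "{x \<in> children v u. t \<in> branch u x} \<subseteq> {ct}"
    using one by blast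
  obtain w where w: "w \<in> children v u" "w \<notin> {y, z, cs, ct}"
    by (rule children_avoid[of "{y, z, cs, ct}"]) (auto simp: card_insert_if)
  then have w': "s \<notin> branch u w" "t \<notin> branch u w" using cs ct by blast+
  obtain a where a: "a \<in> Alt" "a y = z" "a z = w" "a w = y" "\<And>r. d v r \<le> d v u \<Longrightarrow> a r = r"
    "\<And>r. r \<notin> branch u y \<Longrightarrow> r \<notin> branch u z \<Longrightarrow> r \<notin> branch u w \<Longrightarrow> a r = r"
    using children_three_cycle[OF yz w(1)] ne w(2) by auto
  have fix_a: "a v = v" "a u = u" "a s = s" "a t = t" using a(5,6) s t w' by auto
  have "\<Phi> (pair_pattern s t) (a p) (a q) = \<Phi> (pair_pattern s t) p q" if "p \<in> children v u" "q \<in> children v u" for p q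
    using \<Phi>_image[of a s t p q] R a(1) fix_a that by simp
  from this[OF yz] this[OF yz(2) w(1)]
  have "\<Phi> (pair_pattern s t) z w = \<Phi> (pair_pattern s t) y z" "\<Phi> (pair_pattern s t) w y = \<Phi> (pair_pattern s t) z w" using a by auto
  moreover have "\<Phi> (pair_pattern s t) y z * \<Phi> (pair_pattern s t) z w * \<Phi> (pair_pattern s t) w y = 1"
    by (simp add: \<Phi>_trans \<Phi>_refl)
  ultimately show ?thesis using \<Phi>_cases[of "pair_pattern s t" y z] by auto
qed

section \<open>Values of \<open>\<Phi>\<close> on pair patterns\<close>

context
  fixes \<sigma> :: bool
  assumes lt: "leaf_type \<sigma> v L"
begin

lemma realised_pair_pattern: "pairs_realised \<sigma> m \<Longrightarrow> d v s = L \<Longrightarrow> d v t = L \<Longrightarrow> d s t \<le> 2 * m \<Longrightarrow> realised v L (pair_pattern s t)"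
  using pairs_realised_realised leaf_typeD[OF lt] by blast

text \<open>The lowest common ancestor \<open>q\<close> of \<open>s\<close> and \<open>t\<close> is
  farther from the root than \<open>u\<close>, so a three-cycle at \<open>q\<close> fixes
  \<open>y\<close> and \<open>z\<close>. It moves \<open>s\<close> to \<open>s1\<close>,
  \<open>s2\<close>, \<open>s3\<close> with the same value of \<open>\<Phi>\<close> at each step. As
  \<open>s3\<close> is back near \<open>s\<close>, induction shows that the value is 1, and it also
  handles \<open>s1\<close> and \<open>t\<close>.\<close>

lemma \<Phi>_close:
  assumes "pairs_realised \<sigma> m" "m \<le> k" "d v s = L" "d v t = L" "d s t \<le> 2 * m" and yz: "y \<in> children v u" "z \<in> children v u"
  shows "\<Phi> (pair_pattern s t) y z = 1"
  using assms(1-5)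
proof (induction m arbitrary: s t)
  case 0
  then have "pair_pattern s t = (\<lambda>_. 1)" by (auto simp: pair_pattern_simps)
  then show ?case using \<Phi>_one yz by simp
next
  case (Suc m)
  have Qm: "pairs_realised \<sigma> m" using pairs_realised_mono[OF Suc.prems(1)] by simp
  note IH = Suc.IH[OF Qm] and R = realised_pair_pattern[OF Suc.prems(1)]
  show ?case
  proof (cases "d s t \<le> 2 * m")
    case True
    then show ?thesis using IH Suc.prems by simp
  next
    case far: False
    then have "s \<noteq> t" by auto
    then obtain q m' x x' where q: "d v q + Suc m' = L" "E q x" "E q x'" "x \<noteq> x'"
      "d v x = Suc (d v q)" "d v x' = Suc (d v q)" "s \<in> branch q x" "t \<in> branch q x'" "d x s = m'" "d x' t = m'"
      "d s t = 2 * Suc m'"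
      by (rule meet_exists[OF Suc.prems(3,4)])
    have m': "m' = m" using q(11) far Suc.prems(5) by simp
    obtain w where w: "w \<in> children v q" "w \<notin> {x, x'}"
      by (rule children_avoid[of "{x, x'}"]) (auto simp: card_insert_if)
    have "x \<in> children v q" "x' \<in> children v q" using q by (auto simp: children_def)
    then obtain a where a: "a \<in> Alt" "a x = x'" "a x' = w" "a w = x" "\<And>r. d v r \<le> d v q \<Longrightarrow> a r = r"
      using children_three_cycle[of x v q x' w] w q(4) by auto
    have "d v u < d v q" using q(1) m' Suc.prems(2) L by simp
    then have fix_a: "a v = v" "a u = u" "a y = y" "a z = z" "a q = q"
      using a(5) yz by (auto simp: children_def)
    have da: "d (a r) (a r') = d r r'" for r r' using Autp_dist a(1) by simp
    define s1 s2 s3 where "s1 = a s" and "s2 = a s1" and "s3 = a s2"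
    have "d v (a r) = d v r" for r using da[of v r] fix_a by simp
    then have lev: "d v s1 = L" "d v s2 = L" "d v s3 = L" using Suc.prems(3) by (auto simp: s1_def s2_def s3_def)
    have dx: "d x' s1 = m" "d w s2 = m" "d x s3 = m"
      using da[of x s] da[of x' s1] da[of w s2] a q(9) m' by (auto simp: s1_def s2_def s3_def)
    have close: "d s1 t \<le> 2 * m" "d s s3 \<le> 2 * m"
      using dist_triangle[of s1 t x'] dist_triangle[of s s3 x] dx q(9,10) m' by (auto simp: dist_sym)
    have "d q s = Suc m" using q(7,9) m' by (simp add: branch_def)
    then have "d s s1 \<le> 2 * Suc m" using dist_triangle[of s s1 q] da[of q s] fix_a by (simp add: s1_def dist_sym)
    moreover have "d s1 s2 = d s s1" "d s2 s3 = d s s1" using da[of s s1] da[of s1 s2] by (auto simp: s1_def s2_def s3_def)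
    ultimately have R': "realised v L (pair_pattern s s1)" "realised v L (pair_pattern s1 s2)" "realised v L (pair_pattern s2 s3)" "realised v L (pair_pattern s1 t)"
      using R lev Suc.prems(3,4) close by auto
    have "\<Phi> (pair_pattern s1 s2) y z = \<Phi> (pair_pattern s s1) y z" "\<Phi> (pair_pattern s2 s3) y z = \<Phi> (pair_pattern s1 s2) y z"
      using \<Phi>_image[of a s s1 y z] \<Phi>_image[of a s1 s2 y z] R' a(1) fix_a yz by (auto simp: s1_def s2_def s3_def)
    moreover have "\<Phi> (pair_pattern s s3) y z = 1" using IH Suc.prems lev close by simp
    moreover have "\<Phi> (pair_pattern s s3) y z = \<Phi> (pair_pattern s s1) y z * \<Phi> (pair_pattern s1 s2) y z * \<Phi> (pair_pattern s2 s3) y z"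
    proof -
      have "realised v L (pair_pattern s s2)"
        using realised_cong[OF realised_mult[OF R'(1,2)], of "pair_pattern s s2"] by (simp only: pair_pattern_simps(3))
      then show ?thesis using \<Phi>_chain R' yz by simp
    qed
    ultimately have "\<Phi> (pair_pattern s s1) y z = 1" using \<Phi>_cases[of "pair_pattern s s1" y z] by auto
    moreover have "\<Phi> (pair_pattern s1 t) y z = 1" using IH Suc.prems lev close by simp
    ultimately show ?thesis using \<Phi>_chain[OF R'(1,4) yz] by simp
  qed
qed

lemma in_branch:
  assumes "x \<in> children v u" "s \<in> branch u x" "y \<in> children v u"
  shows "s \<in> branch u y \<longleftrightarrow> y = x"
  using branch_disjoint[of u x y] assms by (auto simp: children_def)

lemma below_close:
  assumes "x \<in> children v u" "y \<in> children v u" "s \<in> branch u x" "t \<in> branch u y" "d v s = L" "d v t = L"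
  shows "d s t \<le> 2 * Suc k" "x = y \<Longrightarrow> d s t \<le> 2 * k"
  using branch_level[OF assms(1,3), of k] branch_level[OF assms(2,4), of k] assms(5,6) L
    dist_triangle[of s t u] dist_triangle[of s t x] by (auto simp: dist_sym)

text \<open>The three-cycle on \<open>x\<close>, \<open>y\<close>, \<open>w\<close> moves
  \<open>s\<close> to \<open>s1\<close>, \<open>s2\<close>, \<open>s3\<close>, the last again below
  \<open>x\<close>. The step from \<open>s1\<close> to \<open>s2\<close> is invisible at
  \<open>x\<close> and \<open>z\<close>, and the step from \<open>s2\<close> to \<open>s3\<close>
  seen from \<open>x\<close> is the step from \<open>s\<close> to \<open>s1\<close> seen from
  \<open>y\<close>. Replacing \<open>s1\<close> by \<open>t\<close> below \<open>y\<close> changes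
  nothing.\<close>

lemma \<Phi>_two_branches:
  assumes Qk: "pairs_realised \<sigma> (Suc k)" and children: "x \<in> children v u" "y \<in> children v u" "z \<in> children v u" and ne: "x \<noteq> y" "z \<noteq> x" "z \<noteq> y"
    and s: "s \<in> branch u x" "d v s = L" and t: "t \<in> branch u y" "d v t = L"
  shows "\<Phi> (pair_pattern s t) x z = \<Phi> (pair_pattern s t) y z"
proof -
  have Qk': "pairs_realised \<sigma> k" using pairs_realised_mono[OF Qk] by simp
  note R = realised_pair_pattern[OF Qk]
  obtain w where w: "w \<in> children v u" "w \<notin> {x, y, z}"
    by (rule children_avoid[of "{x, y, z}"]) (auto simp: card_insert_if)
  obtain a where a: "a \<in> Alt" "a x = y" "a y = w" "a w = x" "\<And>r. d v r \<le> d v u \<Longrightarrow> a r = r"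
    "\<And>r. r \<notin> branch u x \<Longrightarrow> r \<notin> branch u y \<Longrightarrow> r \<notin> branch u w \<Longrightarrow> a r = r"
    using children_three_cycle[OF children(1,2) w(1)] ne w(2) by auto
  have fix_a: "a v = v" "a u = u" "a z = z"
    using a(5) a(6)[of z] children_not_branch[OF children(3)] children w ne by auto
  have da: "d (a r) (a r') = d r r'" for r r' using Autp_dist a(1) by simp
  define s1 s2 s3 where "s1 = a s" and "s2 = a s1" and "s3 = a s2"
  have "d v (a r) = d v r" for r using da[of v r] fix_a by simp
  then have lev: "d v s1 = L" "d v s2 = L" "d v s3 = L" using s(2) by (auto simp: s1_def s2_def s3_def)
  have branch: "s1 \<in> branch u y" "s2 \<in> branch u w" "s3 \<in> branch u x"
    using branch_image[of a s u x] branch_image[of a s1 u y] branch_image[of a s2 u w] a(1-4) fix_a s(1)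
    by (auto simp: s1_def s2_def s3_def)
  have R': "realised v L (pair_pattern s s1)" "realised v L (pair_pattern s1 s2)" "realised v L (pair_pattern s2 s3)" "realised v L (pair_pattern s1 t)" "realised v L (pair_pattern s s2)"
    by (rule R; use lev s t branch below_close(1) children w in blast)+
  have "\<Phi> (pair_pattern s s3) x z = \<Phi> (pair_pattern s s1) x z * \<Phi> (pair_pattern s1 s2) x z * \<Phi> (pair_pattern s2 s3) x z"
    using \<Phi>_chain R' children by simp
  moreover have "\<Phi> (pair_pattern s s3) x z = 1"
    using \<Phi>_close[OF Qk' le_refl s(2) lev(3) _ children(1,3)] below_close(2)[OF children(1,1) s(1) branch(3) s(2) lev(3)] by simp
  moreover have "\<Phi> (pair_pattern s1 s2) x z = 1"
    using \<Phi>_off_branches[OF R'(2) children(1,3)] in_branch[OF children(2) branch(1)] in_branch[OF w(1) branch(2)] children ne w by auto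
  moreover have "\<Phi> (pair_pattern s2 s3) x z = \<Phi> (pair_pattern s s1) y z"
    using \<Phi>_image[of a s1 s2 w z] \<Phi>_image[of a s s1 y z] R' a(1-4) fix_a children w by (simp add: s1_def s2_def s3_def)
  ultimately have "\<Phi> (pair_pattern s s1) x z = \<Phi> (pair_pattern s s1) y z"
    using \<Phi>_cases[of "pair_pattern s s1" x z] \<Phi>_cases[of "pair_pattern s s1" y z] by auto
  moreover have "\<Phi> (pair_pattern s1 t) r z = 1" if "r \<in> children v u" for r
    using \<Phi>_close[OF Qk' le_refl lev(1) t(2) _ that children(3)] below_close(2)[OF children(2,2) branch(1) t(1) lev(1) t(2)] by simp
  ultimately show ?thesis using \<Phi>_chain[OF R'(1,4)] children by simp
qed

text \<open>\<open>children_pair_transitive\<close> carries one configuration to another, up to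
  changes of \<open>s\<close> and \<open>t\<close> within their branches
  (\<open>\<Phi>_close\<close>) and of \<open>z\<close>
  (\<open>\<Phi>_off_branches\<close>).\<close>

lemma \<Phi>_uniform:
  assumes Qk: "pairs_realised \<sigma> (Suc k)"
  obtains \<epsilon> where "\<epsilon> = 1 \<or> \<epsilon> = (-1::int)"
    "\<And>x y z s t. x \<in> children v u \<Longrightarrow> y \<in> children v u \<Longrightarrow> z \<in> children v u \<Longrightarrow> x \<noteq> y \<Longrightarrow> z \<noteq> x \<Longrightarrow> z \<noteq> y \<Longrightarrow>
      s \<in> branch u x \<Longrightarrow> t \<in> branch u y \<Longrightarrow> d v s = L \<Longrightarrow> d v t = L \<Longrightarrow> \<Phi> (pair_pattern s t) x z = \<epsilon>"
proof -
  define T where "T x y z s t \<longleftrightarrow> x \<in> children v u \<and> y \<in> children v u \<and> z \<in> children v u \<and> x \<noteq> y \<and> z \<noteq> x \<and> z \<noteq> y \<and>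
      s \<in> branch u x \<and> t \<in> branch u y \<and> d v s = L \<and> d v t = L" for x y z s t
  have Qk': "pairs_realised \<sigma> k" using pairs_realised_mono[OF Qk] by simp
  have same: "\<Phi> (pair_pattern s t) x z = \<Phi> (pair_pattern s0 t0) x0 z0"
    if T0: "T x0 y0 z0 s0 t0" and T1: "T x y z s t" for x0 y0 z0 s0 t0 x y z s t
  proof -
    have T0': "x0 \<in> children v u" "y0 \<in> children v u" "z0 \<in> children v u" "x0 \<noteq> y0" "z0 \<noteq> x0" "z0 \<noteq> y0"
      "s0 \<in> branch u x0" "t0 \<in> branch u y0" "d v s0 = L" "d v t0 = L" using T0 by (auto simp: T_def)
    have T1': "x \<in> children v u" "y \<in> children v u" "z \<in> children v u" "x \<noteq> y" "z \<noteq> x" "z \<noteq> y"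
      "s \<in> branch u x" "t \<in> branch u y" "d v s = L" "d v t = L" using T1 by (auto simp: T_def)
    obtain b where b: "b \<in> Alt" "b x0 = x" "b y0 = y" "\<And>r. d v r \<le> d v u \<Longrightarrow> b r = r"
      using children_pair_transitive[OF T0'(1,2,4) T1'(1,2,4)] by blast
    have bv: "b v = v" "b u = u" using b(4) by auto
    have z': "b z0 \<in> children v u" "b z0 \<noteq> x" "b z0 \<noteq> y"
      using children_fix[OF T0'(3) b(1) bv] Autp_inj[of b z0 x0] Autp_inj[of b z0 y0] b T0' by auto
    have st: "b s0 \<in> branch u x" "b t0 \<in> branch u y" "d v (b s0) = L" "d v (b t0) = L"
      using branch_image[of b s0 u x0] branch_image[of b t0 u y0] Autp_dist[of b v s0] Autp_dist[of b v t0] b bv T0'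
      by auto
    have R: "realised v L (pair_pattern r r')" if "c \<in> children v u" "c' \<in> children v u" "r \<in> branch u c" "r' \<in> branch u c'" "d v r = L" "d v r' = L" for r r' c c'
      using realised_pair_pattern[OF Qk] below_close(1) that by blast
    have R': "realised v L (pair_pattern s t)" "realised v L (pair_pattern s (b s0))" "realised v L (pair_pattern (b s0) (b t0))" "realised v L (pair_pattern (b t0) t)"
      "realised v L (pair_pattern s (b t0))"
      using R st T1' by blast+
    have "\<Phi> (pair_pattern s (b s0)) x (b z0) = 1" "\<Phi> (pair_pattern (b t0) t) x (b z0) = 1"
      using \<Phi>_close[OF Qk' le_refl _ _ _ T1'(1) z'(1)] below_close(2) st T1' by blast+
    then have "\<Phi> (pair_pattern s t) x (b z0) = \<Phi> (pair_pattern (b s0) (b t0)) x (b z0)"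
      using \<Phi>_chain[OF R'(5,4) T1'(1) z'(1)] \<Phi>_chain[OF R'(2,3) T1'(1) z'(1)] by simp
    also have "\<dots> = \<Phi> (pair_pattern s0 t0) x0 z0"
      using \<Phi>_image[OF R'(3) b(1) bv T0'(1,3)] b(2) by simp
    finally have "\<Phi> (pair_pattern s t) x (b z0) = \<Phi> (pair_pattern s0 t0) x0 z0" .
    moreover have "\<Phi> (pair_pattern s t) (b z0) z = 1"
      using \<Phi>_off_branches[OF R'(1) z'(1) T1'(3)] in_branch[OF T1'(1,7)] in_branch[OF T1'(2,8)] z' T1' by auto
    ultimately show ?thesis using \<Phi>_trans[of "pair_pattern s t" x "b z0" z] by simp
  qed
  show thesis
  proof (cases "\<exists>x y z s t. T x y z s t")
    case True
    then obtain x0 y0 z0 s0 t0 where T0: "T x0 y0 z0 s0 t0" by blast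
    show ?thesis
    proof (rule that[of "\<Phi> (pair_pattern s0 t0) x0 z0"])
      fix x y z s t
      assume "x \<in> children v u" "y \<in> children v u" "z \<in> children v u" "x \<noteq> y" "z \<noteq> x" "z \<noteq> y"
        "s \<in> branch u x" "t \<in> branch u y" "d v s = L" "d v t = L"
      then have "T x y z s t" unfolding T_def by blast
      then show "\<Phi> (pair_pattern s t) x z = \<Phi> (pair_pattern s0 t0) x0 z0" by (rule same[OF T0])
    qed (rule \<Phi>_cases)
  next
    case False
    \<comment> \<open>Without any configuration the condition is void, and \<open>1\<close> is a
      default.\<close>
    show ?thesis
    proof (rule that[of 1])
      fix x y z s t
      assume "x \<in> children v u" "y \<in> children v u" "z \<in> children v u" "x \<noteq> y" "z \<noteq> x" "z \<noteq> y"
        "s \<in> branch u x" "t \<in> branch u y" "d v s = L" "d v t = L"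
      then have "T x y z s t" unfolding T_def by blast
      then show "\<Phi> (pair_pattern s t) x z = 1" using False by blast
    qed simp
  qed
qed

text \<open>The expected value of \<open>\<Phi>\<close>; any \<open>\<epsilon>\<close> other than 1
  stands for \<open>-1\<close>.\<close>

definition weight :: "int \<Rightarrow> ('v \<Rightarrow> int) \<Rightarrow> 'v \<Rightarrow> 'v \<Rightarrow> int" where
  "weight \<epsilon> p y z = (if \<epsilon> = 1 then 1 else (\<Prod>s\<in>shell {k} u y. p s) * (\<Prod>s\<in>shell {k} u z. p s))"

text \<open>For vertices below the same child both sides are 1. Otherwise comparison with a third
  child \<open>x\<close> shows that \<open>c\<close> and \<open>c'\<close> each contribute
  \<open>\<epsilon>\<close>, and the other children contribute nothing.\<close>

lemma \<Phi>_pair: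
  assumes Qk: "pairs_realised \<sigma> (Suc k)" and \<epsilon>: "\<epsilon> = 1 \<or> \<epsilon> = -1"
    "\<And>x y z s t. x \<in> children v u \<Longrightarrow> y \<in> children v u \<Longrightarrow> z \<in> children v u \<Longrightarrow> x \<noteq> y \<Longrightarrow> z \<noteq> x \<Longrightarrow> z \<noteq> y \<Longrightarrow>
      s \<in> branch u x \<Longrightarrow> t \<in> branch u y \<Longrightarrow> d v s = L \<Longrightarrow> d v t = L \<Longrightarrow> \<Phi> (pair_pattern s t) x z = \<epsilon>"
    and c: "c \<in> children v u" "c' \<in> children v u" and s: "s \<in> branch u c" "d v s = L" and t: "t \<in> branch u c'" "d v t = L"
    and yz: "y \<in> children v u" "z \<in> children v u"
  shows "\<Phi> (pair_pattern s t) y z = weight \<epsilon> (pair_pattern s t) y z"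
proof -
  have Qk': "pairs_realised \<sigma> k" using pairs_realised_mono[OF Qk] by simp
  have R: "realised v L (pair_pattern s t)" using realised_pair_pattern[OF Qk s(2) t(2) below_close(1)[OF c s(1) t(1) s(2) t(2)]] .
  have mem: "s \<in> shell {k} u y \<longleftrightarrow> y = c" "t \<in> shell {k} u y \<longleftrightarrow> y = c'" if "y \<in> children v u" for y
    using in_branch[OF c(1) s(1) that] in_branch[OF c(2) t(1) that] branch_level(1)[OF c(1) s(1), of k]
      branch_level(1)[OF c(2) t(1), of k] s(2) t(2) L by (auto simp: shell_branch)
  have \<chi>: "(\<Prod>r\<in>shell {k} u y. pair_pattern s t r) = (if y = c then -1 else 1) * (if y = c' then -1 else 1)" if "y \<in> children v u" for y
    using prod_pair_pattern[OF finite_shell[of "{k}" u y], of s t] mem[OF that] by simp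
  show ?thesis
  proof (cases "c = c'")
    case True
    then have "\<Phi> (pair_pattern s t) y z = 1"
      using \<Phi>_close[OF Qk' le_refl s(2) t(2) _ yz] below_close(2)[OF c s(1) t(1) s(2) t(2)] by simp
    then show ?thesis using True \<chi>[OF yz(1)] \<chi>[OF yz(2)] by (simp add: weight_def)
  next
    case ne: False
    have one: "\<Phi> (pair_pattern s t) c x = \<epsilon>" "\<Phi> (pair_pattern s t) c' x = \<epsilon>" if "x \<in> children v u" "x \<noteq> c" "x \<noteq> c'" for x
      using \<epsilon>(2)[OF c that(1) ne that(2,3) s(1) t(1) s(2) t(2)]
        \<Phi>_two_branches[OF Qk c that(1) ne that(2,3) s t] by auto
    obtain x where x: "x \<in> children v u" "x \<notin> {c, c'}"
      by (rule children_avoid[of "{c, c'}"]) (auto simp: card_insert_if)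
    have "\<epsilon> * \<epsilon> = 1" using \<epsilon>(1) by auto
    then have cc: "\<Phi> (pair_pattern s t) c c' = 1"
      using \<Phi>_trans[of "pair_pattern s t" c x c'] one[of x] x \<Phi>_sym[of "pair_pattern s t" x c'] by simp
    have zero: "\<Phi> (pair_pattern s t) y z = 1" if "y \<notin> {c, c'}" "z \<notin> {c, c'}"
      using \<Phi>_off_branches[OF R yz] in_branch[OF c(1) s(1)] in_branch[OF c(2) t(1)] yz that by auto
    have weight: "weight \<epsilon> (pair_pattern s t) y z = (if \<epsilon> = 1 then 1 else
        (if y \<in> {c, c'} then -1 else 1) * (if z \<in> {c, c'} then -1 else 1))"
      unfolding weight_def \<chi>[OF yz(1)] \<chi>[OF yz(2)] using ne by simp
    consider "y \<in> {c, c'}" "z \<in> {c, c'}" | "y \<in> {c, c'}" "z \<notin> {c, c'}" |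
      "y \<notin> {c, c'}" "z \<in> {c, c'}" | "y \<notin> {c, c'}" "z \<notin> {c, c'}" by blast
    then show ?thesis
    proof cases
      case 1
      then have "\<Phi> (pair_pattern s t) y z = 1" using cc \<Phi>_sym[of "pair_pattern s t" c' c] \<Phi>_refl by fastforce
      then show ?thesis unfolding weight using 1 by simp
    next
      case 2
      then have "\<Phi> (pair_pattern s t) y z = \<epsilon>" using one[OF yz(2)] by blast
      then show ?thesis unfolding weight using 2 \<epsilon>(1) by auto
    next
      case 3
      then have "\<Phi> (pair_pattern s t) z y = \<epsilon>" using one[OF yz(1)] by blast
      then show ?thesis unfolding weight \<Phi>_sym[of "pair_pattern s t" y z] using 3 \<epsilon>(1) by auto
    next
      case 4
      then show ?thesis unfolding weight using zero by simp
    qed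
  qed
qed

text \<open>The pattern of \<open>h\<close> need not factor into pair patterns, but its product with
  a translate under a three-cycle \<open>a\<close> does. With a child \<open>c\<close> fixed by
  \<open>a\<close>, both sides for this product at \<open>y\<close>, \<open>c\<close> equal those
  for \<open>h\<close> at \<open>y\<close>, \<open>z\<close>.\<close>

lemma \<Phi>_formula:
  assumes h: "h \<in> fixer v L" and j: "j \<le> L" and Qj: "pairs_realised \<sigma> j"
    and cls: "\<And>a w. a \<in> Alt \<Longrightarrow> (\<And>r. d v r \<le> d v u \<Longrightarrow> a r = r) \<Longrightarrow> d v w + j = L \<Longrightarrow>
        (\<Prod>s\<in>{s. d v s = L \<and> d w s = j}. lsign h s * lsign h (a s)) = 1"
    and pair: "\<And>c c' s t y z. c \<in> children v u \<Longrightarrow> c' \<in> children v u \<Longrightarrow> s \<in> branch u c \<Longrightarrow> d v s = L \<Longrightarrow> t \<in> branch u c' \<Longrightarrow>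
        d v t = L \<Longrightarrow> d s t \<le> 2 * j \<Longrightarrow> y \<in> children v u \<Longrightarrow> z \<in> children v u \<Longrightarrow> \<Phi> (pair_pattern s t) y z = weight \<epsilon> (pair_pattern s t) y z"
    and yz: "y \<in> children v u" "z \<in> children v u" "y \<noteq> z"
  shows "\<Phi> (lsign h) y z = weight \<epsilon> (lsign h) y z"
proof -
  obtain w where w: "w \<in> children v u" "w \<notin> {y, z}"
    by (rule children_avoid[of "{y, z}"]) (auto simp: card_insert_if)
  obtain c where c: "c \<in> children v u" "c \<notin> {y, z, w}"
    by (rule children_avoid[of "{y, z, w}"]) (auto simp: card_insert_if)
  obtain a where a: "a \<in> Alt" "a y = z" "a z = w" "a w = y" "\<And>r. d v r \<le> d v u \<Longrightarrow> a r = r"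
    "\<And>r. r \<notin> branch u y \<Longrightarrow> r \<notin> branch u z \<Longrightarrow> r \<notin> branch u w \<Longrightarrow> a r = r"
    using children_three_cycle[OF yz(1,2) w(1)] yz(3) w(2) by auto
  have fix_a: "a v = v" "a u = u" "a c = c"
    using a(5) a(6)[of c] children_not_branch[OF c(1)] yz w c by auto
  let ?X = "\<lambda>s. lsign h s * lsign h (a s)"
  have R: "realised v L (lsign h)" "realised v L (\<lambda>s. lsign h (a s))"
    using realised_lsign[OF h] realised_conj[OF realised_lsign[OF h] a(1) fix_a(1)] by auto
  have DDL: "d v s = L" if "s \<in> shell {k} u x" "x \<in> children v u" for s x
    using shell_children[OF that(2), of k] that(1) L by simp
  have "realised v L ?X \<and> \<Phi> ?X y c = weight \<epsilon> ?X y c"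
  proof (rule pair_pattern_induct[where p = ?X and v = v and n = L and j = j
        and P = "\<lambda>p. realised v L p \<and> \<Phi> p y c = weight \<epsilon> p y c" and X = "branch u y \<union> branch u z \<union> branch u w"])
    show "?X s = 1 \<or> ?X s = -1" for s using mult_sign_cases lsign_cases by blast
    show "j \<le> L" by (rule j)
    show "(\<Prod>s\<in>{s. d v s = L \<and> d x s = j}. ?X s) = 1" if "d v x + j = L" for x
      using cls[OF a(1,5) that] .
  next
    fix p q assume p: "realised v L p \<and> \<Phi> p y c = weight \<epsilon> p y c" and eq: "\<And>s. d v s = L \<Longrightarrow> p s = q s"
    have "(\<Prod>s\<in>shell {k} u x. p s) = (\<Prod>s\<in>shell {k} u x. q s)" if "x \<in> children v u" for x
      using DDL that eq by (intro prod.cong) auto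
    then have "weight \<epsilon> q y c = weight \<epsilon> p y c" using yz c by (simp add: weight_def)
    then show "realised v L q \<and> \<Phi> q y c = weight \<epsilon> q y c" using p realised_cong[of v L p q] \<Phi>_cong[of p q y c] eq yz c by auto
  next
    show "realised v L (\<lambda>_. 1) \<and> \<Phi> (\<lambda>_. 1) y c = weight \<epsilon> (\<lambda>_. 1) y c"
      using realised_one \<Phi>_one yz c by (simp add: weight_def)
  next
    fix p q assume "realised v L p \<and> \<Phi> p y c = weight \<epsilon> p y c" "realised v L q \<and> \<Phi> q y c = weight \<epsilon> q y c"
    then show "realised v L (\<lambda>s. p s * q s) \<and> \<Phi> (\<lambda>s. p s * q s) y c = weight \<epsilon> (\<lambda>s. p s * q s) y c"
      using realised_mult[of v L p q] \<Phi>_mult[of p q y c] yz c by (simp add: weight_def prod.distrib)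
  next
    fix s t assume st: "d v s = L" "d v t = L" "s \<noteq> t" "d s t \<le> 2 * j"
      "s \<in> branch u y \<union> branch u z \<union> branch u w" "t \<in> branch u y \<union> branch u z \<union> branch u w"
    then obtain e e' where "e \<in> children v u" "e' \<in> children v u" "s \<in> branch u e" "t \<in> branch u e'" using yz w by blast
    then show "realised v L (pair_pattern s t) \<and> \<Phi> (pair_pattern s t) y c = weight \<epsilon> (pair_pattern s t) y c"
      using pair[of e e' s t y c] realised_pair_pattern[OF Qj] st yz c by blast
  next
    fix s assume "d v s = L" "?X s = -1"
    then show "s \<in> branch u y \<union> branch u z \<union> branch u w" using a(6)[of s] by fastforce
  qed
  then have "\<Phi> ?X y c = weight \<epsilon> ?X y c" by simp
  moreover have "\<Phi> ?X y c = \<Phi> (lsign h) y z"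
    using \<Phi>_mult[OF R yz(1) c(1)] \<Phi>_conj[OF R(1) a(1) fix_a(1,2) yz(1) c(1)] fix_a a(2)
      \<Phi>_trans[of "lsign h" y c z] \<Phi>_sym[of "lsign h" c z] by simp
  moreover have "weight \<epsilon> ?X y c = weight \<epsilon> (lsign h) y z"
  proof -
    have "(\<Prod>s\<in>shell {k} u x. ?X s) = (\<Prod>s\<in>shell {k} u x. lsign h s) * (\<Prod>s\<in>shell {k} u (a x). lsign h s)" for x
      using prod_image_shell[of a "lsign h" "{k}" u x] a(1) fix_a(2) by (simp add: prod.distrib)
    moreover have "(\<Prod>s\<in>shell {k} u c. lsign h s) * (\<Prod>s\<in>shell {k} u c. lsign h s) = 1"
      using shell_sign_square[of "{k}" h u c] by (simp add: shell_sign_def)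
    ultimately show ?thesis using a(2) fix_a(3) by (simp add: weight_def)
  qed
  ultimately show ?thesis by simp
qed

text \<open>In the first alternative \<open>\<Phi>_uniform\<close> supplies
  \<open>\<epsilon>\<close>, which decides whether \<open>k\<close> is added. In the second, the
  pairs needed are at most \<open>2 * j\<close> apart and invisible to \<open>\<Phi>\<close>, so
  \<open>K\<close> itself works.\<close>

lemma lift_step:
  assumes K: "k \<notin> K" "finite K" and l: "d v u \<ge> 1"
    and alt: "pairs_realised \<sigma> (Suc k) \<or> (\<exists>j\<le>k. pairs_realised \<sigma> j \<and> class_products_trivial \<sigma> j)"
  shows "children_agree v u k K \<or> children_agree v u k (insert k K)"
proof -
  have fin: "\<exists>K'\<in>{K, insert k K}. children_agree v u k K'"
    if \<epsilon>: "\<epsilon> = 1 \<or> \<epsilon> = -1" and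
      F: "\<And>h y z. h \<in> fixer v L \<Longrightarrow> y \<in> children v u \<Longrightarrow> z \<in> children v u \<Longrightarrow> y \<noteq> z \<Longrightarrow> \<Phi> (lsign h) y z = weight \<epsilon> (lsign h) y z" for \<epsilon>
  proof -
    have F': "shell_sign K h u y * shell_sign K h u z = weight \<epsilon> (lsign h) y z" if "h \<in> fixer v L" "y \<in> children v u" "z \<in> children v u" "y \<noteq> z" for h y z
      using F[OF that] \<Phi>_eq[OF that(1) refl that(2,3)] by simp
    show ?thesis
    proof (cases "\<epsilon> = 1")
      case True
      have "shell_sign K h u y = shell_sign K h u z" if "h \<in> fixer v L" "y \<in> children v u" "z \<in> children v u" for h y z
        using F'[OF that] True shell_sign_cases[of K h u y] shell_sign_cases[of K h u z] by (cases "y = z") (auto simp: weight_def)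
      then have "children_agree v u k K" unfolding children_agree_def L[symmetric] by blast
      then show ?thesis by blast
    next
      case False
      have "shell_sign (insert k K) h u y = shell_sign (insert k K) h u z" if "h \<in> fixer v L" "y \<in> children v u" "z \<in> children v u" for h y z
      proof (cases "y = z")
        case ne: False
        have "shell_sign K h u y * shell_sign K h u z = shell_sign {k} h u y * shell_sign {k} h u z"
          using F'[OF that ne] False by (simp add: weight_def shell_sign_def)
        then show ?thesis
          using shell_sign_insert[OF K, of h u] shell_sign_cases[of K h u y] shell_sign_cases[of K h u z]
            shell_sign_cases[of "{k}" h u y] shell_sign_cases[of "{k}" h u z] by auto
      qed simp
      then have "children_agree v u k (insert k K)" unfolding children_agree_def L[symmetric] by blast
      then show ?thesis by blast
    qed
  qed
  have sq: "(\<Prod>s\<in>S. lsign h s) * (\<Prod>s\<in>S. lsign h s) = 1" for S h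
    by (simp add: prod.distrib[symmetric])
  have "\<exists>K'\<in>{K, insert k K}. children_agree v u k K'"
    using alt
  proof
    assume Qk: "pairs_realised \<sigma> (Suc k)"
    obtain \<epsilon> where \<epsilon>: "\<epsilon> = 1 \<or> \<epsilon> = (-1::int)"
      "\<And>x y z s t. x \<in> children v u \<Longrightarrow> y \<in> children v u \<Longrightarrow> z \<in> children v u \<Longrightarrow> x \<noteq> y \<Longrightarrow> z \<noteq> x \<Longrightarrow> z \<noteq> y \<Longrightarrow>
      s \<in> branch u x \<Longrightarrow> t \<in> branch u y \<Longrightarrow> d v s = L \<Longrightarrow> d v t = L \<Longrightarrow> \<Phi> (pair_pattern s t) x z = \<epsilon>"
      using \<Phi>_uniform[OF Qk] by metis
    show ?thesis
    proof (rule fin[OF \<epsilon>(1)])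
      fix h y z assume h: "h \<in> fixer v L" and yz: "y \<in> children v u" "z \<in> children v u" "y \<noteq> z"
      show "\<Phi> (lsign h) y z = weight \<epsilon> (lsign h) y z"
      proof (rule \<Phi>_formula[OF h _ Qk _ _ yz])
        show "Suc k \<le> L" using L by simp
      next
        fix a w assume a: "a \<in> Alt" "\<And>r. d v r \<le> d v u \<Longrightarrow> a r = r" and w: "d v w + Suc k = L"
        \<comment> \<open>\<open>w\<close> has the same distance from the root as \<open>u\<close>,
          so \<open>a\<close> fixes it, and \<open>h\<close> and its translate have equal products
          on its class.\<close>
        have "a v = v" "a w = w" using a(2) w L by auto
        then show "(\<Prod>s\<in>{s. d v s = L \<and> d w s = Suc k}. lsign h s * lsign h (a s)) = 1"
          using prod_image_class[of a v "lsign h" L w "Suc k"] a(1) sq by (simp add: prod.distrib)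
      next
        fix c c' s t y z
        assume A: "c \<in> children v u" "c' \<in> children v u" "s \<in> branch u c" "d v s = L" "t \<in> branch u c'" "d v t = L"
          "y \<in> children v u" "z \<in> children v u"
        show "\<Phi> (pair_pattern s t) y z = weight \<epsilon> (pair_pattern s t) y z"
          by (rule \<Phi>_pair[OF Qk \<epsilon>(1) _ A]) (rule \<epsilon>(2); assumption)
      qed
    qed
  next
    assume "\<exists>j\<le>k. pairs_realised \<sigma> j \<and> class_products_trivial \<sigma> j"
    then obtain j where j: "j \<le> k" "pairs_realised \<sigma> j" "class_products_trivial \<sigma> j" by blast
    show ?thesis
    proof (rule fin[of 1])
      fix h y z assume h: "h \<in> fixer v L" and yz: "y \<in> children v u" "z \<in> children v u" "y \<noteq> z"
      have Z: "(\<Prod>s\<in>{s. d v s = L \<and> d w s = j}. lsign h s) = 1" if "d v w + j = L" for w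
        using j h lt that L l unfolding class_products_trivial_def by simp
      show "\<Phi> (lsign h) y z = weight 1 (lsign h) y z"
      proof (rule \<Phi>_formula[OF h _ j(2) _ _ yz])
        show "j \<le> L" using L j by simp
      next
        fix a w assume a: "a \<in> Alt" "\<And>r. d v r \<le> d v u \<Longrightarrow> a r = r" and w: "d v w + j = L"
        have av: "a v = v" using a(2) by auto
        have "d v (a w) + j = L" using w Autp_dist[of a v w] a(1) av by simp
        then show "(\<Prod>s\<in>{s. d v s = L \<and> d w s = j}. lsign h s * lsign h (a s)) = 1"
          using prod_image_class[of a v "lsign h" L w j] a(1) av Z w by (simp add: prod.distrib)
      next
        fix c c' s t y z
        assume "d v s = L" "d v t = L" "d s t \<le> 2 * j" "y \<in> children v u" "z \<in> children v u"
        then show "\<Phi> (pair_pattern s t) y z = weight 1 (pair_pattern s t) y z" using \<Phi>_close[OF j(2,1)] by (simp add: weight_def)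
      qed
    qed simp
  qed
  then show ?thesis by blast
qed

end

end

context big_group
begin

subsection \<open>A constraint for the whole group\<close>

text \<open>\<open>lift_step\<close> is iterated from depth \<open>j\<close> down to depth 0, with
  \<open>m\<close> counting the steps and \<open>K\<close> collecting the added levels.\<close>

lemma children_agree_descends:
  assumes st: "children_agree v u j {j}" and l: "d v u \<ge> 1"
    and alt: "\<And>\<sigma>. pairs_realised \<sigma> j \<or> (\<exists>j'<j. pairs_realised \<sigma> j' \<and> class_products_trivial \<sigma> j')"
  obtains K where "K \<subseteq> {..j}" "j \<in> K" "children_agree v u 0 K"
proof -
  have "\<exists>K. K \<subseteq> {j - m..j} \<and> j \<in> K \<and> children_agree v u (j - m) K" if "m \<le> j" for m
    using that
  proof (induction m)
    case 0
    then show ?case using st by (intro exI[of _ "{j}"]) auto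
  next
    case (Suc m)
    then obtain K where K: "K \<subseteq> {j - m..j}" "j \<in> K" "children_agree v u (j - m) K" by auto
    define k where "k = j - Suc m"
    have k: "j - m = Suc k" "k < j" using Suc.prems by (auto simp: k_def)
    interpret lift_step E V0 V1 d0 d1 i H v u k K "Suc (d v u + k)"
      using K(3) k by unfold_locales auto
    define \<sigma> where "\<sigma> = (v \<in> V0 \<longleftrightarrow> even (Suc (d v u + k)))"
    have lt: "leaf_type \<sigma> v (Suc (d v u + k))" by (auto simp: leaf_type_def \<sigma>_def)
    have "pairs_realised \<sigma> (Suc k) \<or> (\<exists>j\<le>k. pairs_realised \<sigma> j \<and> class_products_trivial \<sigma> j)"
      using alt[of \<sigma>]
    proof
      assume "pairs_realised \<sigma> j"
      then show ?thesis using pairs_realised_mono k(2) by (meson Suc_leI)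
    next
      assume "\<exists>j'<j. pairs_realised \<sigma> j' \<and> class_products_trivial \<sigma> j'"
      then obtain j' where j': "pairs_realised \<sigma> j'" "class_products_trivial \<sigma> j'" by blast
      then show ?thesis using pairs_realised_mono[OF j'(1), of "Suc k"] by (cases "Suc k \<le> j'") auto
    qed
    moreover have "k \<notin> K" "finite K" using K(1) k(1) finite_subset by auto
    ultimately have "children_agree v u k K \<or> children_agree v u k (insert k K)" using lift_step[OF lt] l by blast
    then show ?case
    proof
      assume "children_agree v u k K"
      then show ?thesis using K k by (intro exI[of _ K]) (auto simp: k_def)
    next
      assume "children_agree v u k (insert k K)"
      then show ?thesis using K k by (intro exI[of _ "insert k K"]) (auto simp: k_def)
    qed
  qed
  from this[of j] show thesis using that unfolding atMost_atLeast0 by auto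
qed

lemma shell_sign_ginv:
  assumes "h \<in> Autp"
  shows "shell_sign K (ginv h) (h u) (h x) = shell_sign K h u x"
proof -
  have "ginv h \<circ> h = id" by (rule ext) (simp add: Autp_inv_simps[OF assms])
  then have "1 = shell_sign K (ginv h) (h u) (h x) * shell_sign K h u x"
    using shell_sign_comp[OF Autp_inv[OF assms] assms, of K u x] shell_sign_Alt[OF Alt_id] by simp
  then show ?thesis using shell_sign_cases[of K h u x] by auto
qed

text \<open>Here \<open>h \<circ> a\<close> is compared with \<open>a' \<circ> h\<close>, where the three-cycle \<open>a'\<close> at \<open>h u\<close> is
  the conjugate of the three-cycle \<open>a\<close> at \<open>u\<close> on the ball on which \<open>children_agree\<close> applies.\<close>

lemma children_flat:
  assumes st: "children_agree v u 0 K" and h: "h \<in> H" and x: "x \<in> children v u" and y: "y \<in> children v u"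
  shows "shell_sign K h u x = shell_sign K h u y"
proof (cases "x = y")
  case ne: False
  have hA: "h \<in> Autp" using h by simp
  obtain w where w: "w \<in> children v u" "w \<notin> {x, y}"
    by (rule children_avoid[of "{x, y}"]) (auto simp: card_insert_if)
  obtain c where c: "c \<in> children v u" "c \<notin> {x, y, w}"
    by (rule children_avoid[of "{x, y, w}"]) (auto simp: card_insert_if)
  obtain a where a: "a \<in> Alt" "a x = y" "a y = w" "a w = x" "\<And>r. d v r \<le> d v u \<Longrightarrow> a r = r"
    "\<And>r. r \<notin> branch u x \<Longrightarrow> r \<notin> branch u y \<Longrightarrow> r \<notin> branch u w \<Longrightarrow> a r = r"
    using children_three_cycle[OF x y w(1)] ne w(2) by auto
  have hch: "h r \<in> children (h v) (h u)" if "r \<in> children v u" for r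
    using that by (simp add: children_def Autp_edge[OF hA] Autp_dist[OF hA])
  obtain a' where a': "a' \<in> Alt" "a' (h x) = h y" "a' (h y) = h w" "a' (h w) = h x"
    "\<And>r. d (h v) r \<le> d (h v) (h u) \<Longrightarrow> a' r = r"
    "\<And>r. r \<notin> branch (h u) (h x) \<Longrightarrow> r \<notin> branch (h u) (h y) \<Longrightarrow> r \<notin> branch (h u) (h w) \<Longrightarrow> a' r = r"
    using children_three_cycle[OF hch[OF x] hch[OF y] hch[OF w(1)]] ne w(2) by (auto simp: Autp_inj[OF hA])
  have A: "a \<in> Autp" "a' \<in> Autp" using a(1) a'(1) by auto
  define g where "g = ginv h \<circ> (ginv a' \<circ> (h \<circ> a))"
  have g: "g r = r" if r: "d v r \<le> Suc (d v u)" for r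
  proof -
    have "h (a r) = a' (h r)"
    proof (cases "r \<in> {x, y, w}")
      case True
      then show ?thesis using a a' by auto
    next
      case False
      \<comment> \<open>The ball meets each of the three branches only in its root.\<close>
      have "r \<notin> branch u e" if "e \<in> {x, y, w}" for e
      proof
        assume "r \<in> branch u e"
        moreover have "e \<in> children v u" using that x y w by auto
        ultimately have "d e r = 0" using branch_iff[of u e v r] r by (auto simp: children_def)
        then show False using False that by auto
      qed
      then have nb: "r \<notin> branch u x" "r \<notin> branch u y" "r \<notin> branch u w" by auto
      then have "a' (h r) = h r" by (intro a'(6)) (simp_all add: branch_image[OF hA])
      then show ?thesis using a(6)[OF nb] by simp
    qed
    then show ?thesis by (simp add: g_def Autp_inv_simps[OF hA] Autp_inv_simps[OF A(2)])
  qed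
  have "g \<in> H" unfolding g_def using h a(1) a'(1) by simp
  then have "g \<in> fixer v (Suc (d v u + 0))" unfolding fixer_def using g by simp
  then have eq: "shell_sign K g u c = shell_sign K g u x" using st c(1) x unfolding children_agree_def by blast
  have Cg: "shell_sign K g u r = shell_sign K h u r * shell_sign K h u (a r)" if "r \<in> children v u" for r
  proof -
    have "h (a r) = a' (h r)"
    proof -
      have "g r = r" using g that by (simp add: children_def)
      then have "a' (h (g r)) = a' (h r)" by simp
      then show ?thesis by (simp add: g_def Autp_inv_simps[OF hA] Autp_inv_simps[OF A(2)])
    qed
    moreover have "h (a u) = h u" "a u = u" using a(5) by auto
    moreover have "ginv a' (h u) = h u"
      using a'(5)[of "h u"] Autp_inv_simps(1)[OF A(2), of "h u"] by simp
    ultimately have "shell_sign K g u r = shell_sign K (ginv h) (h u) (h r) * shell_sign K h u (a r)"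
      unfolding g_def using hA A a(1) a'(1)
      by (simp add: shell_sign_comp Autp_inv_simps[OF A(2)])
    then show ?thesis by (simp add: shell_sign_ginv[OF hA])
  qed
  \<comment> \<open>At the fixed child \<open>c\<close> the shell sign of \<open>g\<close> is a
    square, while at \<open>x\<close> it is the product of the two signs to be compared.\<close>
  have "a c = c" using a(6)[of c] children_not_branch[OF c(1)] x y w c by auto
  then have "shell_sign K h u x * shell_sign K h u y = 1" using eq Cg[OF c(1)] Cg[OF x] a(2) by simp
  then show ?thesis using shell_sign_cases[of K h u x] shell_sign_cases[of K h u y] by auto
qed simp

text \<open>A neighbour \<open>q\<close> that is not a child is rotated with two children by a
  three-cycle \<open>c\<close> at \<open>u\<close>. Although \<open>c\<close> may move
  \<open>v\<close>, the map \<open>h \<circ> c\<close> lies in \<open>H\<close>, and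
  \<open>children_flat\<close> for it compares \<open>q\<close> with \<open>w\<close>.\<close>

lemma neighbours_flat:
  assumes st: "children_agree v u 0 K" and h: "h \<in> H" and x: "E u x" and y: "E u y"
  shows "shell_sign K h u x = shell_sign K h u y"
proof -
  obtain w where w: "w \<in> children v u" using children_avoid[of "{}" v u] by auto
  have "shell_sign K h u q = shell_sign K h u w" if q: "E u q" for q
  proof (cases "q \<in> children v u")
    case True
    then show ?thesis using children_flat[OF st h] w by blast
  next
    case False
    obtain w' where w': "w' \<in> children v u" "w' \<notin> {w}" by (rule children_avoid[of "{w}"]) auto
    have N: "E u w" "E u w'" using w w' by (auto simp: children_def)
    obtain c where c: "c \<in> Alt" "c q = w'" "c w' = w" "c w = q" "c u = u"
      using three_cycle[OF q N(2,1)] False w w' by auto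
    have "shell_sign K (h \<circ> c) u r = shell_sign K h u (c r)" for r
      using shell_sign_comp[of h c K u r] h c(1,5) by simp
    moreover have "shell_sign K (h \<circ> c) u w = shell_sign K (h \<circ> c) u w'"
      using children_flat[OF st _ w w'(1)] h c(1) by simp
    ultimately show ?thesis using c by simp
  qed
  then show ?thesis using x y by metis
qed

section \<open>Constraints at all vertices of one type\<close>

definition flat :: "bool \<Rightarrow> nat set \<Rightarrow> ('v \<Rightarrow> 'v) \<Rightarrow> bool" where
  "flat t K g \<longleftrightarrow> (\<forall>u x y. (u \<in> V0 \<longleftrightarrow> t) \<longrightarrow> E u x \<longrightarrow> E u y \<longrightarrow> shell_sign K g u x = shell_sign K g u y)"

text \<open>Elements of \<open>Alt\<close> carry \<open>u\<close> to every vertex of its type, and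
  composing with them does not affect shell signs beyond moving the shells.\<close>

lemma H_flat:
  assumes st: "children_agree v u 0 K" and h: "h \<in> H"
  shows "flat (u \<in> V0) K h"
  unfolding flat_def
proof (intro allI impI)
  fix u' x y assume u': "u' \<in> V0 \<longleftrightarrow> u \<in> V0" and xy: "E u' x" "E u' y"
  obtain b where b: "b \<in> Alt" "b u = u'" using Alt_transitive[of u u'] u' by blast
  have bA: "b \<in> Autp" using b(1) by simp
  have "shell_sign K (h \<circ> b) u (ginv b r) = shell_sign K h u' r" for r
    using shell_sign_comp[of h b K u "ginv b r"] h b Autp_inv_simps(2)[OF bA, of r] by simp
  moreover have "E u (ginv b r)" if "E u' r" for r
    using Autp_edge[OF bA, of u "ginv b r"] that b(2) by (simp add: Autp_inv_simps[OF bA])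
  moreover have "h \<circ> b \<in> H" using h b(1) by simp
  ultimately show "shell_sign K h u' x = shell_sign K h u' y"
    using neighbours_flat[OF st, of "h \<circ> b" "ginv b x" "ginv b y"] xy by simp
qed

text \<open>
  The parity condition says that \<open>flat\<close> refers to the vertices \<open>u\<close> for which the vertices at
  distance \<open>j\<close> from a neighbour of \<open>u\<close>, and \<open>Suc j\<close> from \<open>u\<close>, have type \<open>\<tau>\<close>.
\<close>

definition rule_for :: "bool \<Rightarrow> nat \<Rightarrow> nat set \<Rightarrow> bool" where
  "rule_for \<tau> j K \<longleftrightarrow> K \<subseteq> {..j} \<and> j \<in> K \<and> (\<forall>h\<in>H. flat (\<tau> \<longleftrightarrow> odd j) K h)"

lemma rule_exists:
  assumes "pairs_realised \<tau> j" "\<not> pairs_realised \<tau> (Suc j)" "\<And>\<sigma>. pairs_realised \<sigma> j \<or> (\<exists>j'<j. pairs_realised \<sigma> j' \<and> class_products_trivial \<sigma> j')"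
  obtains K where "rule_for \<tau> j K"
proof -
  obtain v u where u: "d v u \<ge> 1" "leaf_type \<tau> u (Suc j)" "children_agree v u j {j}"
    using children_agree_exists[OF assms(1,2)] by blast
  obtain K where K: "K \<subseteq> {..j}" "j \<in> K" "children_agree v u 0 K"
    using children_agree_descends[OF u(3,1) assms(3)] by blast
  have "(u \<in> V0) = (\<tau> \<longleftrightarrow> odd j)" using u(2) by (auto simp: leaf_type_def)
  then have "rule_for \<tau> j K" using K H_flat[OF K(3)] by (simp add: rule_for_def)
  then show thesis by (rule that)
qed

text \<open>\<open>u\<close> is the parent of \<open>w\<close>, and \<open>x\<close> the parent of
  \<open>u\<close>. The shell beyond \<open>x\<close> stays at distance less than \<open>n\<close>
  from \<open>v\<close>, where signs are 1, and beyond \<open>w\<close> only level \<open>j\<close>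
  reaches the sphere.\<close>

lemma flat_classes:
  assumes K: "K \<subseteq> {..j}" "j \<in> K" and flat: "flat (\<tau> \<longleftrightarrow> odd j) K g"
    and fixed: "\<And>z. d v z \<le> n \<Longrightarrow> g z = z" and n: "n \<ge> j + 2" and lt: "leaf_type \<tau> v n"
    and w: "d v w + j = n"
  shows "(\<Prod>z\<in>{z. d v z = n \<and> d w z = j}. lsign g z) = 1"
proof -
  have "d v w = Suc (n - j - 1)" using w n by simp
  then obtain u where u: "E w u" "d v u = n - j - 1" using parent_exists by blast
  have "d v u = Suc (n - j - 2)" using u n by simp
  then obtain x where x: "E u x" "d v x = n - j - 2" using parent_exists by blast
  have wch: "w \<in> children v u" using u w n sym[OF u(1)] by (simp add: children_def)
  have "even (d v u) \<longleftrightarrow> (even n \<longleftrightarrow> odd j)"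
  proof -
    have "n = Suc (d v u + j)" using u w n by simp
    then show ?thesis by auto
  qed
  then have tu: "u \<in> V0 \<longleftrightarrow> (\<tau> \<longleftrightarrow> odd j)" using types_dist[of v u] lt by (auto simp: leaf_type_def)
  have small: "lsign g z = 1" if "d v z < n" for z using lsign_fixed_ball[of v n g z] fixed that by blast
  have "shell_sign K g u x = 1"
    unfolding shell_sign_def
  proof (rule prod.neutral, intro ballI small)
    fix z assume "z \<in> shell K u x"
    then have "d x z \<le> j" using K by (auto simp: shell_def)
    then show "d v z < n" using dist_triangle[of v z x] x n by simp
  qed
  moreover have "shell_sign K g u w = shell_sign K g u x"
    using flat tu sym[OF u(1)] x(1) unfolding flat_def by blast
  moreover have "shell_sign K g u w = shell_sign {j} g u w"
  proof -
    have "finite (K - {j})" using K(1) finite_subset by blast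
    then have "shell_sign (insert j (K - {j})) g u w = shell_sign (K - {j}) g u w * shell_sign {j} g u w"
      by (intro shell_sign_insert) auto
    moreover have "insert j (K - {j}) = K" using K(2) by blast
    moreover have "shell_sign (K - {j}) g u w = 1"
      unfolding shell_sign_def
    proof (rule prod.neutral, intro ballI small)
      fix z assume "z \<in> shell (K - {j}) u w"
      then have "d w z \<in> K - {j}" by (auto simp: shell_def)
      then have "d w z < j" using K(1) by fastforce
      then show "d v z < n" using dist_triangle[of v z w] w by simp
    qed
    ultimately show ?thesis by simp
  qed
  moreover have "shell {j} u w = {z. d v z = n \<and> d w z = j}"
    using class_eq_shell[OF wch, of n j] u w n by simp
  ultimately show ?thesis by (simp add: shell_sign_def)
qed

lemma rule_class_products_trivial: "rule_for \<tau> j K \<Longrightarrow> class_products_trivial \<tau> j"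
  unfolding class_products_trivial_def
proof (intro allI impI)
  fix v n h w
  assume *: "rule_for \<tau> j K" "h \<in> fixer v n" "j + 2 \<le> n" "leaf_type \<tau> v n" "d v w + j = n"
  show "(\<Prod>z\<in>{z. d v z = n \<and> d w z = j}. lsign h z) = 1"
    by (rule flat_classes[of K j \<tau> h v n w])
      (use * fixer_H[OF *(2)] fixer_fix[OF *(2)] in \<open>auto simp: rule_for_def\<close>)
qed

lemma threshold: "(\<forall>j. pairs_realised \<tau> j) \<or> (\<exists>j. pairs_realised \<tau> j \<and> \<not> pairs_realised \<tau> (Suc j))"
proof (rule ccontr)
  assume *: "\<not> ?thesis"
  have "pairs_realised \<tau> j" for j by (induction j) (use * pairs_realised_0 in auto)
  then show False using * by blast
qed

text \<open>
  Lower levels of the constraint may have the other type, so the type with the smaller threshold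
  has to be treated first.
\<close>

lemma rule_exists_threshold:
  assumes "pairs_realised \<tau> j" "\<not> pairs_realised \<tau> (Suc j)"
  obtains K where "rule_for \<tau> j K"
proof -
  have "pairs_realised (\<not> \<tau>) j \<or> (\<exists>j'<j. pairs_realised (\<not> \<tau>) j' \<and> class_products_trivial (\<not> \<tau>) j')"
  proof (cases "pairs_realised (\<not> \<tau>) j")
    case False
    then obtain j' where j': "pairs_realised (\<not> \<tau>) j'" "\<not> pairs_realised (\<not> \<tau>) (Suc j')" using threshold[of "\<not> \<tau>"] by blast
    then have lt: "j' < j" using False pairs_realised_mono[OF j'(1)] by (meson not_le)
    \<comment> \<open>At the smaller threshold \<open>j'\<close> the pairs of both types are
      realised, so the first alternative always holds.\<close>
    have "pairs_realised \<sigma> j' \<or> (\<exists>k<j'. pairs_realised \<sigma> k \<and> class_products_trivial \<sigma> k)" for \<sigma>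
      using j'(1) pairs_realised_mono[OF assms(1), of j'] lt by (cases "\<sigma> = \<tau>") auto
    then obtain K where "rule_for (\<not> \<tau>) j' K" using rule_exists[OF j'] by blast
    then show ?thesis using rule_class_products_trivial j' lt by blast
  qed simp
  then have "pairs_realised \<sigma> j \<or> (\<exists>j'<j. pairs_realised \<sigma> j' \<and> class_products_trivial \<sigma> j')" for \<sigma>
    using assms(1) by (cases "\<sigma> = \<tau>") auto
  then show thesis using rule_exists[OF assms] that by blast
qed

subsection \<open>Comparison with the closures\<close>

lemma far_vertex: "E v w \<Longrightarrow> \<exists>y. d w y = m \<and> d v y = Suc m"
proof (induction m)
  case 0
  then show ?case using dist_eq_1 by (intro exI[of _ w]) auto
next
  case (Suc m)
  then obtain y where y: "d w y = m" "d v y = Suc m" by blast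
  obtain y' where y': "y' \<in> children v y" using children_avoid[of "{}" v y] by auto
  then have "d y y' = Suc 0" "d v y' = Suc (Suc m)" "d v w = Suc 0"
    using dist_eq_1 y Suc.prems by (auto simp: children_def)
  then have "d w y' = Suc m" using dist_triangle[of w y' y] dist_triangle[of v y' w] y by simp
  then show ?case using \<open>d v y' = Suc (Suc m)\<close> by blast
qed

text \<open>
  A pair with one vertex on the given sphere around \<open>v\<close> and the other one far away, on a common
  sphere around a neighbour \<open>w\<close> of \<open>v\<close>.
\<close>

lemma realised_single:
  assumes pairs_realised: "\<And>j. pairs_realised \<tau> j" and lt: "leaf_type \<tau> v n" and x: "d v x = n"
  shows "realised v n (delta x)"
proof -
  obtain w where w: "w \<in> children x v" using children_avoid[of "{}" x v] by auto
  then have vw: "E v w" and xw: "d w x = Suc n" using x by (auto simp: children_def dist_sym)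
  obtain y where y: "d w y = Suc n" "d v y = Suc (Suc n)" using far_vertex[OF vw] by blast
  have "realised w (Suc n) (pair_pattern x y)"
    by (rule pairs_realised_realised[OF pairs_realised[of "d x y"] xw y(1) _ leaf_typeD[OF lt x]]) simp
  then obtain h where h: "h \<in> fixer w (Suc n)" "\<And>z. d w z = Suc n \<Longrightarrow> lsign h z = pair_pattern x y z"
    unfolding realised_def by blast
  have "d w z \<le> Suc n" if "d v z \<le> n" for z using dist_edge'[OF vw, of z] that by auto
  then have "h \<in> fixer v n" using h(1) unfolding fixer_def by blast
  moreover have "lsign h z = delta x z" if z: "d v z = n" for z
  proof (cases "d w z = Suc n")
    case True
    moreover have "z \<noteq> y" using z y by auto
    ultimately show ?thesis using h(2) by (simp add: pair_pattern_def delta_def)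
  next
    case False
    then have "d w z < Suc n" using dist_edge'[OF vw, of z] z by auto
    moreover have "z \<noteq> x" using False xw by auto
    ultimately show ?thesis using fixer_lsign[OF h(1)] by (simp add: delta_def)
  qed
  ultimately show ?thesis unfolding realised_def by blast
qed

lemma realised_all:
  assumes pairs_realised: "\<And>j. pairs_realised \<tau> j" and lt: "leaf_type \<tau> v n" and p: "\<And>z. p z = 1 \<or> p z = (-1::int)"
  shows "realised v n p"
proof -
  have "realised v n (\<lambda>z. if z \<in> S then -1 else 1)" if "finite S" "S \<subseteq> {z. d v z = n}" for S
    using that
  proof (induction S rule: finite_induct)
    case empty
    then show ?case using realised_one by simp
  next
    case (insert x S)
    then have "realised v n (\<lambda>z. delta x z * (if z \<in> S then -1 else 1))"
      using realised_mult realised_single[OF pairs_realised lt] by auto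
    then show ?case by (rule realised_cong) (use insert.hyps in \<open>auto simp: delta_def\<close>)
  qed
  from this[of "{z. d v z = n \<and> p z = -1}"]
  have "realised v n (\<lambda>z. if z \<in> {z. d v z = n \<and> p z = -1} then -1 else 1)"
    using finite_subset[OF _ finite_sphere[of v n]] by auto
  then show ?thesis by (rule realised_cong) (use p in auto)
qed

section \<open>Elements of the closures\<close>

lemma n_closureD: "g \<in> n_closure E m H \<Longrightarrow> \<exists>h\<in>H. \<forall>z. d v z \<le> m \<longrightarrow> g z = h z"
  by (auto simp: n_closure_def tball_def)

lemma n_closure_mono: "g \<in> n_closure E m H \<Longrightarrow> k \<le> m \<Longrightarrow> g \<in> n_closure E k H"
  unfolding n_closure_def tball_def by (auto, meson le_trans)

lemma n_closure_Autp: "g \<in> n_closure E m H \<Longrightarrow> g \<in> Autp"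
proof (rule AutpI)
  assume g: "g \<in> n_closure E m H"
  then show "g \<in> Aut E" by (simp add: n_closure_def)
  fix x
  obtain h where "h \<in> H" "g x = h x" using n_closureD[OF g, of x] by force
  then show "g x \<in> V0 \<longleftrightarrow> x \<in> V0" using Autp_type[of h x] by simp
qed

lemma n_closure_translate:
  assumes g: "g \<in> n_closure E m H" and h: "h \<in> H"
  shows "h \<circ> g \<in> n_closure E m H"
  unfolding n_closure_def
proof (intro CollectI conjI allI)
  show "h \<circ> g \<in> Aut E"
    using Autp_comp[OF H_Autp[OF h] n_closure_Autp[OF g]] by (simp add: Aut_plus_def)
  fix v
  obtain k where "k \<in> H" "\<forall>z. d v z \<le> m \<longrightarrow> g z = k z" using n_closureD[OF g] by blast
  then show "\<exists>k\<in>H. \<forall>z\<in>tball E v m. (h \<circ> g) z = k z"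
    using h by (intro bexI[of _ "h \<circ> k"]) (auto simp: tball_def)
qed

text \<open>The shells stay within distance \<open>Suc j\<close> of \<open>u\<close>, and local
  actions look one step further, whence the order \<open>j + 2\<close>.\<close>

lemma n_closure_flat:
  assumes K: "K \<subseteq> {..j}" and flat: "\<forall>h\<in>H. flat t K h" and g: "g \<in> n_closure E (j + 2) H"
  shows "flat t K g"
  unfolding flat_def
proof (intro allI impI)
  fix u x y assume t: "u \<in> V0 \<longleftrightarrow> t" and xy: "E u x" "E u y"
  obtain h where h: "h \<in> H" "\<forall>z. d u z \<le> j + 2 \<longrightarrow> g z = h z" using n_closureD[OF g] by blast
  have "shell_sign K g u q = shell_sign K h u q" for q
  proof (rule shell_sign_cong, rule lsign_cong)
    fix z r assume z: "z \<in> shell K u q" and r: "r \<in> N z"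
    have "d u z \<le> Suc j" using z K by (auto simp: shell_def)
    then have "d u r \<le> j + 2" using dist_edge[of z r u] r by auto
    then show "g r = h r" using h by blast
  qed
  moreover have "shell_sign K h u x = shell_sign K h u y" using flat h t xy unfolding flat_def by blast
  ultimately show "shell_sign K g u x = shell_sign K g u y" by simp
qed

text \<open>Without a threshold every pattern is realised and the order \<open>0\<close> will do.
  With threshold \<open>j\<close>, the closure inherits the constraint, which makes the class
  products trivial, and such patterns are realised.\<close>

lemma signs_realised:
  obtains m where "\<And>n v g. m \<le> n \<Longrightarrow> leaf_type \<tau> v n \<Longrightarrow> g \<in> n_closure E m H \<Longrightarrow>
    (\<And>z. d v z \<le> n \<Longrightarrow> g z = z) \<Longrightarrow> realised v n (lsign g)"
proof (cases "\<forall>j. pairs_realised \<tau> j")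
  case True
  show ?thesis
    by (rule that[of 0]) (rule realised_all, use True lsign_cases in auto)
next
  case False
  then obtain j where j: "pairs_realised \<tau> j" "\<not> pairs_realised \<tau> (Suc j)" using threshold by blast
  obtain K where "rule_for \<tau> j K" using rule_exists_threshold[OF j] by blast
  then have K: "K \<subseteq> {..j}" "j \<in> K" "\<forall>h\<in>H. flat (\<tau> \<longleftrightarrow> odd j) K h" by (auto simp: rule_for_def)
  show ?thesis
  proof (rule that[of "j + 2"])
    fix n v g assume n: "j + 2 \<le> n" and lt: "leaf_type \<tau> v n" and g: "g \<in> n_closure E (j + 2) H"
      and fixed: "\<And>z. d v z \<le> n \<Longrightarrow> g z = z"
    have "flat (\<tau> \<longleftrightarrow> odd j) K g" using n_closure_flat[OF K(1,3) g] .
    then have cls: "(\<Prod>z\<in>{z. d v z = n \<and> d w z = j}. lsign g z) = 1" if "d v w + j = n" for w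
      using flat_classes[OF K(1,2) _ fixed n lt that] by blast
    show "realised v n (lsign g)"
      by (rule realised_classes[OF j(1) _ leaf_typeD[OF lt] lsign_cases cls]) (use n in auto)
  qed
qed

text \<open>A basic neighbourhood of \<open>g\<close> restricts only finitely many vertices, and
  these lie in a ball around \<open>v\<close>.\<close>

lemma H_closed:
  assumes g: "g \<in> Aut E" and approx: "\<And>n. \<exists>h\<in>H. \<forall>z. d v z \<le> n \<longrightarrow> g z = h z"
  shows "g \<in> H"
proof (rule ccontr)
  assume "g \<notin> H"
  have "closedin (Aut_top E) H" using H by (auto simp: HT_plus_def)
  then have "openin (Aut_top E) (Aut E - H)" by (simp add: closedin_def Aut_top_def)
  then obtain T where T: "openin (product_topology (\<lambda>_. discrete_topology UNIV) (UNIV :: 'v set)) T"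
    "Aut E - H = T \<inter> Aut E"
    by (auto simp: Aut_top_def openin_subtopology)
  have "g \<in> T" using T(2) g \<open>g \<notin> H\<close> by blast
  then obtain U where U: "finite {x. U x \<noteq> (UNIV :: 'v set)}" "g \<in> Pi\<^sub>E UNIV U" "Pi\<^sub>E UNIV U \<subseteq> T"
    using T(1) unfolding openin_product_topology_alt by auto
  \<comment> \<open>Inserting \<open>0\<close> covers the case in which no vertex is
    restricted.\<close>
  define n where "n = Max (insert 0 (d v ` {x. U x \<noteq> UNIV}))"
  obtain h where h: "h \<in> H" "\<forall>z. d v z \<le> n \<longrightarrow> g z = h z" using approx by blast
  have "h x \<in> U x" for x
  proof (cases "U x = UNIV")
    case False
    then have "d v x \<le> n" unfolding n_def using U(1) by (intro Max_ge) auto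
    then show ?thesis using U(2) h(2) by (metis PiE_mem UNIV_I)
  qed simp
  then have "h \<in> T" using U(3) by auto
  moreover have "h \<in> Aut E" using H_Autp[OF h(1)] by (simp add: Aut_plus_def)
  ultimately show False using T(2) h(1) by blast
qed

text \<open>If \<open>h\<close> agrees with \<open>g\<close> on a ball, then
  \<open>ginv h \<circ> g\<close> fixes it, and its signs on the sphere are those of some
  \<open>k\<close> in \<open>H\<close>. Correcting by an element of \<open>Alt\<close> gives
  agreement on the next ball.\<close>

lemma n_closure_stable: "\<exists>K. H = n_closure E K H"
proof -
  obtain m where m: "\<And>\<tau> n v g. m \<tau> \<le> n \<Longrightarrow> leaf_type \<tau> v n \<Longrightarrow> g \<in> n_closure E (m \<tau>) H \<Longrightarrow>
    (\<And>z. d v z \<le> n \<Longrightarrow> g z = z) \<Longrightarrow> realised v n (lsign g)"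
  proof -
    have "\<exists>m. \<forall>n v g. m \<le> n \<longrightarrow> leaf_type \<tau> v n \<longrightarrow> g \<in> n_closure E m H \<longrightarrow>
      (\<forall>z. d v z \<le> n \<longrightarrow> g z = z) \<longrightarrow> realised v n (lsign g)" for \<tau>
      by (rule signs_realised[of \<tau>]) blast
    then obtain m where "\<And>\<tau>. \<forall>n v g. m \<tau> \<le> n \<longrightarrow> leaf_type \<tau> v n \<longrightarrow> g \<in> n_closure E (m \<tau>) H \<longrightarrow>
      (\<forall>z. d v z \<le> n \<longrightarrow> g z = z) \<longrightarrow> realised v n (lsign g)" by metis
    then show thesis by (intro that[of m]) blast
  qed
  define K where "K = max (m True) (m False)"
  have mK: "m \<tau> \<le> K" for \<tau> by (cases \<tau>) (auto simp: K_def)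
  have "g \<in> H" if g: "g \<in> n_closure E K H" for g
  proof (rule H_closed)
    show "g \<in> Aut E" using g by (simp add: n_closure_def)
    fix v n
    \<comment> \<open>The induction starts at radius \<open>K\<close>, where the closure provides
      \<open>h\<close>; smaller radii follow from larger ones.\<close>
    have "\<exists>h\<in>H. \<forall>z. d v z \<le> n \<longrightarrow> g z = h z" if "K \<le> n" for n
      using that
    proof (induction n rule: dec_induct)
      case base
      then show ?case using n_closureD[OF g] .
    next
      case (step n)
      then obtain h where h: "h \<in> H" "\<And>z. d v z \<le> n \<Longrightarrow> g z = h z" by blast
      have hA: "h \<in> Autp" and gA: "g \<in> Autp" using h(1) n_closure_Autp[OF g] by auto
      define f where "f = ginv h \<circ> g"
      have fC: "f \<in> n_closure E K H" unfolding f_def using n_closure_translate[OF g] h(1) by simp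
      have fA: "f \<in> Autp" using n_closure_Autp[OF fC] .
      have ff: "f z = z" if "d v z \<le> n" for z
        using h(2)[OF that] by (simp add: f_def Autp_inv_simps[OF hA])
      define \<tau> where "\<tau> = (v \<in> V0 \<longleftrightarrow> even n)"
      have "leaf_type \<tau> v n" by (auto simp: leaf_type_def \<tau>_def)
      then have "realised v n (lsign f)"
        using m[of \<tau> n v f] mK[of \<tau>] n_closure_mono[OF fC] ff step.hyps by auto
      then obtain k where k: "k \<in> fixer v n" "\<And>z. d v z = n \<Longrightarrow> lsign k z = lsign f z"
        unfolding realised_def by blast
      have kA: "k \<in> Autp" using fixer_H[OF k(1)] by simp
      have kf: "k z = z" "ginv k z = z" if "d v z \<le> n" for z
        using fixer_fix[OF k(1) that] fixer_fix[OF fixer_inv[OF k(1)] that] by auto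
      have "lsign (f \<circ> ginv k) z = 1" if z: "d v z = n" for z
        using lsign_comp[OF fA Autp_inv[OF kA], of z] lsign_inv[OF kA, of z] k(2)[OF z] kf[of z] z by simp
      then obtain a where a: "a \<in> Alt" "\<And>z. d v z \<le> Suc n \<Longrightarrow> a z = (f \<circ> ginv k) z"
        using alt_factor[OF Autp_comp[OF fA Autp_inv[OF kA]], of v n] ff kf by auto
      have "g z = (h \<circ> (a \<circ> k)) z" if z: "d v z \<le> Suc n" for z
      proof -
        have "d v (k z) = d v z" using Autp_dist[OF kA, of v z] kf(1)[of v] by simp
        then have "a (k z) = f z" using a(2)[of "k z"] z Autp_inv_simps(1)[OF kA, of z] by simp
        then show ?thesis by (simp add: f_def Autp_inv_simps[OF hA])
      qed
      moreover have "h \<circ> (a \<circ> k) \<in> H" using h(1) a(1) fixer_H[OF k(1)] by simp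
      ultimately show ?case by blast
    qed
    from this[of "max K n"] show "\<exists>h\<in>H. \<forall>z. d v z \<le> n \<longrightarrow> g z = h z" by (meson max.cobounded1 max.coboundedI2 le_refl order_trans max.cobounded2)
  qed
  moreover have "g \<in> n_closure E K H" if "g \<in> H" for g
    using that H_Autp[OF that] unfolding n_closure_def Aut_plus_def by blast
  ultimately have "H = n_closure E K H" by blast
  then show ?thesis by blast
qed

end

theorem theorem8:
  fixes E :: "'v \<Rightarrow> 'v \<Rightarrow> bool"
    and V0 V1 :: "'v set"
    and d0 d1 :: nat
    and i :: "'v \<Rightarrow> nat"
    and H :: "('v \<Rightarrow> 'v) set"
  assumes "semiregular_tree E V0 V1 d0 d1"
    and "d0 \<ge> 6" and "d1 \<ge> 6"
    and "legal_coloring E V0 V1 d0 d1 i"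
    and "H \<in> HT_plus E V0 V1"
    and "Alt_plus E V0 V1 i \<subseteq> H"
  shows "\<exists>K::nat. H = n_closure E K H"
proof -
  interpret big_group E V0 V1 d0 d1 i H
    by unfold_locales (fact assms)+
  show ?thesis by (rule n_closure_stable)
qed

end
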